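(* Let $r\geq 1$, $\delta\geq 0$ and $\Phi\in\mathfrak{F}_{r,\delta}$. Let $u\in A_1$ and let $v$ be a weight on $\mathbb{R}^n$ such that $v^r\in A_\infty$. Then there exists $\varepsilon_0>0$ such that for every $0<\varepsilon<\varepsilon_0$ there is a constant $C>0$ (depending on $\varepsilon$, but not on $t$ or $f$) for which the inequality \[uv^r\left(\left\{x\in \mathbb{R}^n: \frac{M_\Phi(fv)(x)}{v(x)}>t\right\}\right)\leq C\int_{\mathbb{R}^n}\left(\eta_\varepsilon\circ \Phi\right)\left(\frac{|f(x)|}{t}\right)u(x)v^r(x)\,dx\] holds for every $t>0$ and every measurable function $f$ on $\mathbb{R}^n$, where $\eta_\varepsilon(z)=z(1+\log^+z)^{\delta/\varepsilon}$.
   Context: A weight is a nonnegative locally integrable function on $\mathbb{R}^n$ that is positive almost everywhere. Cubes have sides parallel to the coordinate axes. For a nonnegative function $w$ and a measurable set $E$, $w(E)=\int_E w$; in particular $uv^r(E)=\int_E u v^r\,dx$. $\log^+z=\max\{0,\log z\}$ (with $\log^+0=0$). $A_1$ is the Muckenhoupt class of weights $w$ for which there is $C>0$ with $\frac1{|Q|}\int_Q w\le C\,w(x)$ for almost every $x\in Q$ and every cube $Q$. A weight $w$ belongs to $A_\infty$ if there is $C>0$ such that $\left(\frac{1}{|Q|}\int_Q w\right)\exp\left(\frac{1}{|Q|}\int_Q \log w^{-1}\right)\leq C$ for every cube $Q$. A Young function is a convex, increasing function $\Phi:[0,\infty)\to[0,\infty)$ with $\Phi(0)=0$ and $\Phi(t)\to\infty$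 as $t\to\infty$. It is submultiplicative if $\Phi(st)\le\Phi(s)\Phi(t)$ for all $s,t>0$. It has lower type $r$ if there is $C>0$ with $\Phi(st)\le C s^r\Phi(t)$ for all $0<s\le1$ and $t>0$. For $r\ge1$, $\delta\ge0$, $\mathfrak{F}_{r,\delta}$ is the family of Young functions $\Phi$ that are submultiplicative, have lower type $r$, and satisfy $\frac{\Phi(t)}{t^r}\le C_0(\log t)^\delta$ for all $t\ge t^*$, for some constants $C_0>0$ and $t^*\ge1$. For a cube $Q$, the Luxemburg average is $\|f\|_{\Phi,Q}=\inf\left\{\lambda>0:\frac1{|Q|}\int_Q\Phi\left(\frac{|f|}{\lambda}\right)\le1\right\}$, and the generalized maximal operator is $M_\Phi f(x)=\sup_{Q\ni x}\|f\|_{\Phi,Q}$, the supremum being over all cubes $Q$ containing $x$. *)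

theory Defs
  imports "HOL-Analysis.Analysis"
begin

text \<open>Closed, nondegenerate cubes with sides parallel to the coordinate axes.  Choosing open cubes
  instead changes neither the weight classes nor the maximal function below.\<close>

definition cubes :: "(real ^ 'n) set set" where
  "cubes = {cbox a (\<chi> i. a $ i + l) | a l. 0 < l}"

text \<open>Integrability on all compact sets includes Lebesgue measurability of \<open>w\<close>.\<close>

definition weight :: "(real ^ 'n \<Rightarrow> real) \<Rightarrow> bool" where
  "weight w \<longleftrightarrow>
     (\<forall>x. 0 \<le> w x) \<and>
     (\<forall>K. compact K \<longrightarrow> set_integrable lebesgue K w) \<and>
     (AE x in lebesgue. 0 < w x)"

definition average :: "(real ^ 'n) set \<Rightarrow> (real ^ 'n \<Rightarrow> real) \<Rightarrow> real" where
  "average Q w = (LINT x:Q|lebesgue. w x) / measure lebesgue Q"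

definition A_1 :: "(real ^ 'n \<Rightarrow> real) set" where
  "A_1 = {w. weight w \<and>
     (\<exists>C>0. \<forall>Q\<in>cubes. AE x in lebesgue. x \<in> Q \<longrightarrow> average Q w \<le> C * w x)}"

text \<open>The positive part of \<open>ln w\<close> is integrable on every cube because \<open>w\<close> is, so the average of
  \<open>ln (1 / w)\<close> is either finite or \<open>+\<infinity>\<close>, and in the latter case the inequality defining
  \<open>A\<^sub>\<infinity>\<close> fails.  As the Bochner integral of a non-integrable function is 0, finiteness has to be
  required explicitly.\<close>

definition A_infinity :: "(real ^ 'n \<Rightarrow> real) set" where
  "A_infinity = {w. weight w \<and>
     (\<exists>C>0. \<forall>Q\<in>cubes.
        set_integrable lebesgue Q (\<lambda>x. ln (1 / w x)) \<and>
        average Q w * exp (average Q (\<lambda>x. ln (1 / w x))) \<le> C)}"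

text \<open>Functions on \<open>[0, \<infinity>)\<close> are total functions whose values at negative arguments play no role.\<close>

definition young_function :: "(real \<Rightarrow> real) \<Rightarrow> bool" where
  "young_function \<Phi> \<longleftrightarrow>
     (\<forall>t\<ge>0. 0 \<le> \<Phi> t) \<and> convex_on {0..} \<Phi> \<and> mono_on {0..} \<Phi> \<and> \<Phi> 0 = 0 \<and>
     filterlim \<Phi> at_top at_top"

definition submultiplicative :: "(real \<Rightarrow> real) \<Rightarrow> bool" where
  "submultiplicative \<Phi> \<longleftrightarrow> (\<forall>s>0. \<forall>t>0. \<Phi> (s * t) \<le> \<Phi> s * \<Phi> t)"

definition lower_type :: "real \<Rightarrow> (real \<Rightarrow> real) \<Rightarrow> bool" where
  "lower_type r \<Phi> \<longleftrightarrow>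
     (\<exists>C>0. \<forall>s t. 0 < s \<and> s \<le> 1 \<and> 0 < t \<longrightarrow> \<Phi> (s * t) \<le> C * s powr r * \<Phi> t)"

text \<open>The value \<open>0 powr 0 = 0\<close> could only matter at \<open>t = 1\<close>; it is harmless because \<open>t\<^sub>0\<close> may be
  enlarged.\<close>

definition young_class :: "real \<Rightarrow> real \<Rightarrow> (real \<Rightarrow> real) set" where
  "young_class r \<delta> = {\<Phi>. young_function \<Phi> \<and> submultiplicative \<Phi> \<and> lower_type r \<Phi> \<and>
     (\<exists>C\<^sub>0>0. \<exists>t\<^sub>0\<ge>1. \<forall>t\<ge>t\<^sub>0. \<Phi> t / t powr r \<le> C\<^sub>0 * ln t powr \<delta>)}"

text \<open>The infimum is taken in \<open>[0, \<infinity>]\<close>, so it is \<open>\<infinity>\<close> when no \<open>l\<close> is admissible.\<close>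

definition luxemburg :: "(real \<Rightarrow> real) \<Rightarrow> (real ^ 'n) set \<Rightarrow> (real ^ 'n \<Rightarrow> real) \<Rightarrow> ennreal" where
  "luxemburg \<Phi> Q f = Inf {ennreal l | l. 0 < l \<and>
     (\<integral>\<^sup>+x\<in>Q. ennreal (\<Phi> (\<bar>f x\<bar> / l)) \<partial>lebesgue) / emeasure lebesgue Q \<le> 1}"

definition maximal :: "(real \<Rightarrow> real) \<Rightarrow> (real ^ 'n \<Rightarrow> real) \<Rightarrow> real ^ 'n \<Rightarrow> ennreal" where
  "maximal \<Phi> f x = (SUP Q\<in>{Q\<in>cubes. x \<in> Q}. luxemburg \<Phi> Q f)"

definition weighted_measure :: "(real ^ 'n \<Rightarrow> real) \<Rightarrow> (real ^ 'n) set \<Rightarrow> ennreal" where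
  "weighted_measure w E = (\<integral>\<^sup>+x\<in>E. ennreal (w x) \<partial>lebesgue)"

text \<open>\<open>log_plus 0 = 0\<close> holds because \<open>ln 0 = 0\<close>.\<close>

definition log_plus :: "real \<Rightarrow> real" where
  "log_plus z = max 0 (ln z)"

definition eta :: "real \<Rightarrow> real \<Rightarrow> real \<Rightarrow> real" where
  "eta \<delta> \<epsilon> z = z * (1 + log_plus z) powr (\<delta> / \<epsilon>)"

end

theory Submission
  imports Defs
begin

text \<open>
  Put \<open>w = v\<^sup>r\<close> and \<open>h = \<eta>\<^sub>\<epsilon>(\<Phi>(|f| / t))\<close>, and write \<open>\<langle>g\<rangle>\<^sub>Q\<close> for averages.  If \<open>x\<close> belongs to the level set, then some
  cube \<open>Q\<close> containing \<open>x\<close> satisfies \<open>\<langle>\<Phi>(|f| v / (t v(x)))\<rangle>\<^sub>Q > 1\<close>.  Lower type, submultiplicativity, the growth bound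
  and the reverse Hoelder inequality for \<open>w\<close> turn this into
  \<open>w(x) \<le> K max(1, \<langle>w\<rangle>\<^sub>Q / w(x))\<^sup>\<kappa> \<langle>h w\<rangle>\<^sub>Q\<close> with \<open>\<kappa>\<close> as small as we like; any \<open>\<epsilon> \<le> 1\<close> will do.

  Pass to dyadic \<open>Q\<close> and sort the pairs \<open>(x, Q)\<close> by the integer \<open>l\<close> with \<open>\<langle>w\<rangle>\<^sub>Q / w(x) \<approx> 2\<^sup>l\<close>.  For fixed \<open>Q\<close>, the points with
  a given \<open>l\<close> carry at most a fraction \<open>2\<close> to the power \<open>- \<gamma> |l|\<close> of the \<open>u\<close>-mass, because the level sets of \<open>w\<close> in \<open>Q\<close>
  decay in both directions; this beats the factor \<open>max(1, 2\<^sup>l)\<^sup>\<kappa>\<close>.  For fixed \<open>l\<close>, choose for every dyadic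
  level of \<open>\<langle>w\<rangle>\<^sub>Q\<close> the maximal cubes.  They form a Carleson family with respect to \<open>w dx\<close>, on which the \<open>w\<close>-average of \<open>h\<close>
  is bounded below by a constant depending on \<open>l\<close>; hence the sum of \<open>\<langle>u\<rangle>\<^sub>Q w(Q)\<close> over the family is controlled by
  a layer-cake argument in the values \<open>\<langle>u\<rangle>\<^sub>Q\<close>, since the dyadic maximal function of \<open>u\<close> is at most \<open>C u\<close>.
\<close>

subsection \<open>Half-open cubes, dyadic cells and masses\<close>

text \<open>The obstacle is that w(x) varies over the level set, which is therefore not a level set
  of a maximal function of h, and comparing w(x) with the average of w costs a power of their ratio.
  Only the distribution of w and u inside Q can pay for this. For fixed l the account is as follows.
  The points of Q with ratio about 2^l have \<open>u w dx\<close>-mass at most a constant times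
  2^(-l - g|l|) times the u-average of Q times w(Q). A single such point in the level set forces the
  integral of h w over Q to be at least \<rho>(l) w(Q), where \<rho>(l) is about 2^(-l -
  \<kappa>|l|), and the Carleson sum costs 1/\<rho>(l). The factors 2^(-l) cancel, and 2^(-(g -
  \<kappa>)|l|) is summable once \<kappa> < g. Such a small \<kappa> is available because it only
  measures the loss in trading a power of a logarithm for a power of the parameter c in
  \<open>log_split\<close>. The bound \<epsilon> \<le> 1 serves to have \<delta> \<le> \<delta> /
  \<epsilon>. All exponents come from one stopping lemma for two measures, used with Lebesgue
  measure and a weight in either order.\<close>

abbreviation vol :: "(real ^ 'n) set \<Rightarrow> real" where
  "vol \<equiv> measure lebesgue"

text \<open>Half-open, so that the cubes of one grid partition space without exceptional null sets
  and dyadic nesting is exact.\<close>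

definition hcube :: "real ^ 'n \<Rightarrow> real \<Rightarrow> (real ^ 'n) set" where
  "hcube a l = {x. \<forall>i. a $ i \<le> x $ i \<and> x $ i < a $ i + l}"

text \<open>Grid cubes as fibres of the floor map: nesting becomes integer division by powers of
  two. Origin and mesh are free, so the same notion serves the dyadic subdivision of an arbitrary
  cube (mesh \<open>L / 2 ^ j\<close>, origin at its corner) and the standard grid.\<close>

definition cell :: "real ^ 'n \<Rightarrow> real \<Rightarrow> real ^ 'n \<Rightarrow> (real ^ 'n) set" where
  "cell a s x = {y. \<forall>i. \<lfloor>(y $ i - a $ i) / s\<rfloor> = \<lfloor>(x $ i - a $ i) / s\<rfloor>}"

lemma cell_eq_hcube:
  assumes "s > 0"
  shows "cell a s x = hcube (\<chi> i. a $ i + s * \<lfloor>(x $ i - a $ i) / s\<rfloor>) s"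
proof -
  have "\<lfloor>(y $ i - a $ i) / s\<rfloor> = k \<longleftrightarrow> a $ i + s * k \<le> y $ i \<and> y $ i < a $ i + s * k + s" for y i k
    using assms by (simp add: floor_eq_iff field_simps)
  then show ?thesis
    unfolding cell_def hcube_def by auto
qed

lemma mem_cell_self [simp]: "x \<in> cell a s x"
  by (simp add: cell_def)

lemma cell_eq_of_mem: "y \<in> cell a s x \<Longrightarrow> cell a s y = cell a s x"
  by (auto simp: cell_def)

lemma floor_divide_power2: "\<lfloor>t / 2 ^ d\<rfloor> = \<lfloor>t\<rfloor> div 2 ^ d" for t :: real
  using floor_divide_real_eq_div[of "2 ^ d" t] by simp

lemma cell_mono:
  assumes "s' = s * 2 ^ d"
  shows "cell a s x \<subseteq> cell a s' x"
proof -
  have "\<lfloor>(y $ i - a $ i) / s'\<rfloor> = \<lfloor>(y $ i - a $ i) / s\<rfloor> div 2 ^ d" for y i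
    using floor_divide_power2[of "(y $ i - a $ i) / s" d] by (simp add: assms)
  then show ?thesis
    unfolding cell_def by auto
qed

lemma cell_eq_base:
  assumes "L > 0" "x \<in> hcube a L"
  shows "cell a L x = hcube a L"
proof -
  have "\<lfloor>(x $ i - a $ i) / L\<rfloor> = 0" for i
    using assms by (auto simp: hcube_def floor_eq_iff divide_less_eq algebra_simps)
  then show ?thesis
    by (simp add: cell_eq_hcube[OF \<open>L > 0\<close>])
qed

lemma cell_eq_floor_vec: "cell a s x = {y. (\<chi> i. \<lfloor>(y $ i - a $ i) / s\<rfloor>) = (\<chi> i. \<lfloor>(x $ i - a $ i) / s\<rfloor>)}"
  unfolding cell_def by (auto simp: vec_eq_iff)

lemma countable_cells:
  fixes a :: "real ^ 'n"
  shows "countable (range (cell a s))"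
proof -
  have "range (cell a s) \<subseteq> (\<lambda>k :: int ^ 'n. {y. (\<chi> i. \<lfloor>(y $ i - a $ i) / s\<rfloor>) = k}) ` UNIV"
    using cell_eq_floor_vec[of a s] by auto
  then show ?thesis
    by (meson countable_image countableI_type countable_subset)
qed

lemma finite_vec_set:
  fixes A :: "'n::finite \<Rightarrow> 'a set"
  assumes "\<And>i. finite (A i)"
  shows "finite {k :: 'a ^ 'n. \<forall>i. k $ i \<in> A i}"
proof -
  have "{k :: 'a ^ 'n. \<forall>i. k $ i \<in> A i} \<subseteq> vec_lambda ` (PiE UNIV A)"
  proof
    fix k :: "'a ^ 'n" assume "k \<in> {k. \<forall>i. k $ i \<in> A i}"
    then have "vec_nth k \<in> PiE UNIV A" by auto
    then show "k \<in> vec_lambda ` (PiE UNIV A)"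
      by (metis image_eqI vec_nth_inverse)
  qed
  then show ?thesis
    by (meson assms finite_PiE finite_UNIV finite_imageI finite_subset finite)
qed

lemma finite_subcells:
  fixes a :: "real ^ 'n"
  assumes "L > 0"
  shows "finite (cell a (L / 2 ^ j) ` hcube a L)"
proof -
  let ?f = "\<lambda>y. (\<chi> i. \<lfloor>(y $ i - a $ i) / (L / 2 ^ j)\<rfloor>) :: int ^ 'n"
  have "?f x \<in> {k. \<forall>i. k $ i \<in> {0..<2 ^ j}}" if "x \<in> hcube a L" for x
  proof -
    have "0 \<le> (x $ i - a $ i) / (L / 2 ^ j) \<and> (x $ i - a $ i) / (L / 2 ^ j) < 2 ^ j" for i
    proof -
      have "0 \<le> x $ i - a $ i" "x $ i - a $ i < L"
        using that by (auto simp: hcube_def algebra_simps)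
      then have "(x $ i - a $ i) / L < 1" "0 \<le> (x $ i - a $ i) / L"
        using assms by simp_all
      then have "(x $ i - a $ i) / L * 2 ^ j < 1 * 2 ^ j" "0 \<le> (x $ i - a $ i) / L * 2 ^ j"
        by (intro mult_strict_right_mono mult_nonneg_nonneg; simp)+
      then show ?thesis
        by simp
    qed
    then show ?thesis
      by (auto simp: floor_less_iff)
  qed
  then have "?f ` hcube a L \<subseteq> {k. \<forall>i. k $ i \<in> {0..<2 ^ j}}"
    by blast
  then have "finite (?f ` hcube a L)"
    by (rule finite_subset) (rule finite_vec_set, simp)
  moreover have "cell a (L / 2 ^ j) ` hcube a L \<subseteq> (\<lambda>k. {y. ?f y = k}) ` ?f ` hcube a L"
    using cell_eq_floor_vec[of a "L / 2 ^ j"] by auto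
  ultimately show ?thesis
    by (meson finite_imageI finite_subset)
qed

lemma cbox_hcube_negligible: "negligible (cbox a (\<chi> i. a $ i + l) - hcube a l)"
  by (rule negligible_subset[OF negligible_frontier_interval[of a "\<chi> i. a $ i + l"]])
     (auto simp: hcube_def mem_box_cart less_imp_le)

lemma hcube_subset_cbox: "hcube a l \<subseteq> cbox a (\<chi> i. a $ i + l)"
  by (auto simp: hcube_def mem_box_cart less_imp_le)

lemma hcube_sets [measurable]: "hcube a l \<in> sets lebesgue"
proof -
  have "hcube a l = cbox a (\<chi> i. a $ i + l) - (cbox a (\<chi> i. a $ i + l) - hcube a l)"
    using hcube_subset_cbox by blast
  moreover have "cbox a (\<chi> i. a $ i + l) - hcube a l \<in> sets lebesgue"
    using cbox_hcube_negligible[of a l] unfolding negligible_iff_null_sets by (rule null_setsD2)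
  ultimately show ?thesis
    by (metis sets.Diff lmeasurable_cbox fmeasurableD)
qed

lemma measure_hcube:
  assumes "l > 0"
  shows "vol (hcube a l :: (real ^ 'n) set) = l ^ CARD('n)"
proof -
  have "vol (cbox a (\<chi> i. a $ i + l) - (cbox a (\<chi> i. a $ i + l) - hcube a l))
      = vol (cbox a (\<chi> i. a $ i + l))"
    using cbox_hcube_negligible[of a l] unfolding negligible_iff_null_sets
    by (intro measure_Diff_null_set) auto
  moreover have "cbox a (\<chi> i. a $ i + l) - (cbox a (\<chi> i. a $ i + l) - hcube a l) = hcube a l"
    using hcube_subset_cbox[of a l] by blast
  ultimately have "vol (hcube a l) = vol (cbox a (\<chi> i. a $ i + l))"
    by simp
  also have "\<dots> = l ^ CARD('n)"
  proof -
    have "cbox a (\<chi> i. a $ i + l) \<noteq> {}"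
      using assms by (auto simp: interval_ne_empty_cart)
    then show ?thesis
      by (simp add: content_cbox_cart)
  qed
  finally show ?thesis .
qed

lemma cell_sets [measurable]: "s > 0 \<Longrightarrow> cell a s x \<in> sets lebesgue"
  by (simp add: cell_eq_hcube)

lemma measure_cell: "s > 0 \<Longrightarrow> vol (cell a s x :: (real ^ 'n) set) = s ^ CARD('n)"
  by (simp add: cell_eq_hcube measure_hcube)

definition hcubes :: "(real ^ 'n) set set" where
  "hcubes = {hcube a l | a l. 0 < l}"

lemma hcubesI: "0 < l \<Longrightarrow> hcube a l \<in> hcubes"
  by (auto simp: hcubes_def)

lemma cell_hcubes: "0 < s \<Longrightarrow> cell a s x \<in> hcubes"
  by (simp add: cell_eq_hcube hcubesI)

lemma hcubes_sets [measurable_dest]: "Q \<in> hcubes \<Longrightarrow> Q \<in> sets lebesgue"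
  by (auto simp: hcubes_def)

lemma measure_hcubes_pos: "Q \<in> hcubes \<Longrightarrow> 0 < vol Q"
  by (auto simp: hcubes_def measure_hcube)

lemma hcubes_lmeasurable: "Q \<in> hcubes \<Longrightarrow> Q \<in> lmeasurable"
  using measure_hcubes_pos[of Q] hcubes_sets[of Q]
  by (metis enn2real_top fmeasurableI infinity_ennreal_def less_irrefl measure_def top.not_eq_extremum)

section \<open>Weights as measures\<close>

abbreviation wmeas :: "(real ^ 'n \<Rightarrow> real) \<Rightarrow> (real ^ 'n) measure" where
  "wmeas w \<equiv> density lebesgue (\<lambda>x. ennreal (w x))"

text \<open>Real-valued, for the sake of arithmetic. Since \<open>measure\<close> is 0 on sets of
  infinite measure, monotonicity and additivity below ask for bounded sets, on which local
  integrability makes the mass finite.\<close>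

definition mass :: "(real ^ 'n \<Rightarrow> real) \<Rightarrow> (real ^ 'n) set \<Rightarrow> real" where
  "mass w A = measure (wmeas w) A"

lemma weight_nonneg: "weight w \<Longrightarrow> 0 \<le> w x"
  by (simp add: weight_def)

text \<open>Measurability is contained in local integrability: \<open>w\<close> is the pointwise
  limit of its restrictions to growing cubes, which are eventually constant at every point.\<close>

lemma weight_measurable [measurable_dest]:
  fixes w :: "real ^ 'n \<Rightarrow> real"
  assumes "weight w"
  shows "w \<in> borel_measurable lebesgue"
proof -
  have *: "set_integrable lebesgue (cbox (\<chi> i. - real n) (\<chi> i. real n)) w" for n :: nat
    using assms by (auto simp: weight_def)
  have ev: "\<exists>N. \<forall>n\<ge>N. x \<in> cbox (\<chi> i. - real n) (\<chi> i. real n)" for x :: "real ^ 'n"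
  proof -
    obtain N :: nat where N: "norm x \<le> real N"
      using real_arch_simple by blast
    have "x \<in> cbox (\<chi> i. - real n) (\<chi> i. real n)" if "n \<ge> N" for n
    proof -
      have "\<bar>x $ i\<bar> \<le> real n" for i
        using component_le_norm_cart[of x i] N that by simp
      then show ?thesis
        by (auto simp: mem_box_cart abs_le_iff minus_le_iff)
    qed
    then show ?thesis by blast
  qed
  show ?thesis
  proof (rule borel_measurable_LIMSEQ_real)
    show "(\<lambda>x. indicator (cbox (\<chi> i. - real n) (\<chi> i. real n)) x *\<^sub>R w x) \<in> borel_measurable lebesgue" for n
      using * by (simp add: set_integrable_def borel_measurable_integrable)
    show "(\<lambda>n. indicator (cbox (\<chi> i. - real n) (\<chi> i. real n)) x *\<^sub>R w x) \<longlonglongrightarrow> w x" for x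
    proof (rule tendsto_eventually)
      show "\<forall>\<^sub>F n in sequentially. indicator (cbox (\<chi> i. - real n) (\<chi> i. real n)) x *\<^sub>R w x = w x"
        using ev[of x] unfolding eventually_sequentially by (metis indicator_simps(1) scaleR_one)
    qed
  qed
qed

lemma weight_set_integrable:
  assumes "weight w" "bounded A" "A \<in> sets lebesgue"
  shows "set_integrable lebesgue A w"
proof -
  obtain a b where "A \<subseteq> cbox a b"
    using assms(2) bounded_subset_cbox_symmetric by metis
  then show ?thesis
    using assms set_integrable_subset[of lebesgue "cbox a b" w A] by (auto simp: weight_def)
qed

lemma emeasure_mass:
  assumes "weight w" "bounded A" "A \<in> sets lebesgue"
  shows "emeasure (wmeas w) A = ennreal (LINT x:A|lebesgue. w x)"
proof -
  have [measurable]: "w \<in> borel_measurable lebesgue" using assms weight_measurable by blast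
  have "emeasure (wmeas w) A = (\<integral>\<^sup>+x. ennreal (indicator A x *\<^sub>R w x) \<partial>lebesgue)"
    using assms by (subst emeasure_density) (auto intro!: nn_integral_cong split: split_indicator)
  also have "\<dots> = ennreal (LINT x:A|lebesgue. w x)"
    unfolding set_lebesgue_integral_def
    using weight_set_integrable[OF assms] weight_nonneg[OF assms(1)]
    by (intro nn_integral_eq_integral) (auto simp: set_integrable_def)
  finally show ?thesis .
qed

lemma mass_eq_integral:
  assumes "weight w" "bounded A" "A \<in> sets lebesgue"
  shows "mass w A = (LINT x:A|lebesgue. w x)"
  unfolding mass_def measure_def emeasure_mass[OF assms]
  using weight_nonneg[OF assms(1)]
  by (intro enn2real_ennreal) (auto simp: set_lebesgue_integral_def intro!: integral_nonneg_AE)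

lemma fmeasurable_mass:
  assumes "weight w" "bounded A" "A \<in> sets lebesgue"
  shows "A \<in> fmeasurable (wmeas w)"
  using emeasure_mass[OF assms] assms(3) by (intro fmeasurableI) auto

lemma nn_integral_mass:
  assumes "weight w" "bounded A" "A \<in> sets lebesgue"
  shows "(\<integral>\<^sup>+x\<in>A. ennreal (w x) \<partial>lebesgue) = ennreal (mass w A)"
proof -
  have "(\<integral>\<^sup>+x\<in>A. ennreal (w x) \<partial>lebesgue) = emeasure (wmeas w) A"
    using assms weight_measurable[OF assms(1)] by (subst emeasure_density) auto
  then show ?thesis
    using emeasure_mass[OF assms] mass_eq_integral[OF assms] by simp
qed

lemma mass_nonneg [simp]: "0 \<le> mass w A"
  by (simp add: mass_def)

lemma mass_mono:
  assumes "weight w" "bounded B" "A \<in> sets lebesgue" "B \<in> sets lebesgue" "A \<subseteq> B"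
  shows "mass w A \<le> mass w B"
  unfolding mass_def using assms fmeasurable_mass[of w B]
  by (intro measure_mono_fmeasurable) auto

lemma mass_Un_disjoint:
  assumes "weight w" "bounded A" "bounded B" "A \<in> sets lebesgue" "B \<in> sets lebesgue" "A \<inter> B = {}"
  shows "mass w (A \<union> B) = mass w A + mass w B"
  unfolding mass_def using assms fmeasurable_mass[of w A] fmeasurable_mass[of w B]
  by (intro measure_Union) (auto dest: fmeasurableD2)

lemma mass_Un_le:
  assumes "weight w" "bounded A" "bounded B" "A \<in> sets lebesgue" "B \<in> sets lebesgue"
  shows "mass w (A \<union> B) \<le> mass w A + mass w B"
  unfolding mass_def using assms by (intro measure_Un_le) auto

lemma mass_Union_disjoint:
  assumes "weight w" "finite F" "\<And>A. A \<in> F \<Longrightarrow> bounded A" "\<And>A. A \<in> F \<Longrightarrow> A \<in> sets lebesgue" "pairwise disjnt F"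
  shows "mass w (\<Union>F) = (\<Sum>A\<in>F. mass w A)"
  unfolding mass_def using assms fmeasurable_mass[of w]
  by (intro measure_Union') auto

lemma mass_Union_le:
  assumes "finite F" "\<And>A. A \<in> F \<Longrightarrow> f A \<in> sets lebesgue"
  shows "mass w (\<Union>A\<in>F. f A) \<le> (\<Sum>A\<in>F. mass w (f A))"
  unfolding mass_def using assms by (intro measure_UNION_le) auto

lemma mass_null:
  assumes "weight w" "A \<in> null_sets lebesgue"
  shows "mass w A = 0"
proof -
  have "A \<in> null_sets (wmeas w)"
    using assms weight_measurable[OF assms(1)]
    by (subst null_sets_density_iff) (auto simp: null_sets_def intro: AE_I[where N=A])
  then show ?thesis
    by (simp add: mass_def measure_eq_0_null_sets)
qed

text \<open>Lebesgue measure becomes the mass of a weight and can then take either role in the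
  lemmas on two measures.\<close>

lemma weight_one: "weight (\<lambda>x :: real ^ 'n. 1)"
proof -
  have "integrable lebesgue (indicator K :: real ^ 'n \<Rightarrow> real)" if "compact K" for K
    using lmeasurable_compact[OF that] by (intro integrable_real_indicator) (auto simp: fmeasurable_def)
  then show ?thesis
    by (auto simp: weight_def set_integrable_def)
qed

lemma mass_one: "mass (\<lambda>x. 1) A = vol A"
  by (simp add: mass_def density_1)

lemma bounded_hcube [simp]: "bounded (hcube a l)"
  using hcube_subset_cbox bounded_cbox bounded_subset by blast

lemma bounded_hcubes: "Q \<in> hcubes \<Longrightarrow> bounded Q"
  by (auto simp: hcubes_def)

lemma mass_pos:
  assumes "weight w" "A \<in> sets lebesgue" "bounded A" "vol A > 0"
  shows "mass w A > 0"
proof (rule ccontr)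
  assume "\<not> mass w A > 0"
  then have "mass w A = 0" using mass_nonneg[of w A] by linarith
  then have "A \<in> null_sets (wmeas w)"
    using fmeasurable_mass[OF assms(1,3,2)] assms(2)
    by (auto simp: mass_def null_sets_def emeasure_eq_measure2)
  then have "AE x in lebesgue. x \<in> A \<longrightarrow> ennreal (w x) = 0"
    using weight_measurable[OF assms(1)] by (subst (asm) null_sets_density_iff) auto
  moreover have "AE x in lebesgue. 0 < w x"
    using assms(1) by (simp add: weight_def)
  ultimately have "AE x in lebesgue. x \<notin> A"
    by eventually_elim auto
  then have "A \<in> null_sets lebesgue"
    using assms(2) AE_iff_null_sets by blast
  then show False
    using assms(4) by (simp add: measure_eq_0_null_sets)
qed

lemma mass_hcubes_pos: "weight w \<Longrightarrow> Q \<in> hcubes \<Longrightarrow> 0 < mass w Q"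
  using mass_pos[of w Q] by (simp add: hcubes_sets bounded_hcubes measure_hcubes_pos)

lemma mass_le_mass:
  assumes "weight m" "weight n" "bounded A" "A \<in> sets lebesgue" "c \<ge> 0"
    "AE x in lebesgue. x \<in> A \<longrightarrow> m x \<le> c * n x"
  shows "mass m A \<le> c * mass n A"
proof -
  have "mass m A \<le> (LINT x:A|lebesgue. c * n x)"
    unfolding mass_eq_integral[OF assms(1,3,4)]
    using assms weight_set_integrable[OF assms(1,3,4)] weight_set_integrable[OF assms(2,3,4)]
    by (intro set_integral_mono_AE) auto
  then show ?thesis
    by (simp add: mass_eq_integral[OF assms(2,3,4)])
qed

subsection \<open>Differentiation along dyadic cells\<close>

text \<open>Together with finiteness, this is all that the selection of disjoint maximal cubes uses
  of the dyadic structure.\<close>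

definition laminar :: "'a set set \<Rightarrow> bool" where
  "laminar D \<longleftrightarrow> (\<forall>A\<in>D. \<forall>B\<in>D. A \<subseteq> B \<or> B \<subseteq> A \<or> A \<inter> B = {})"

definition maximals :: "'a set set \<Rightarrow> 'a set set" where
  "maximals D = {A\<in>D. \<forall>B\<in>D. A \<subseteq> B \<longrightarrow> A = B}"

lemma maximals_subset: "maximals D \<subseteq> D"
  by (auto simp: maximals_def)

lemma laminar_subset: "laminar D \<Longrightarrow> E \<subseteq> D \<Longrightarrow> laminar E"
  unfolding laminar_def by blast

lemma ex_maximals_superset:
  assumes "finite D" "A \<in> D"
  obtains B where "B \<in> maximals D" "A \<subseteq> B"
proof -
  obtain B where "B \<in> D" "A \<subseteq> B" "\<forall>C\<in>D. B \<subseteq> C \<longrightarrow> B = C"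
    using finite_has_maximal2[OF assms] by blast
  then show ?thesis
    using that by (simp add: maximals_def)
qed

lemma Union_maximals: "finite D \<Longrightarrow> \<Union>(maximals D) = \<Union>D"
  by (intro equalityI Union_mono[OF maximals_subset] Union_least)
     (meson Union_upper ex_maximals_superset order_trans)

lemma disjoint_maximals:
  assumes "laminar D"
  shows "pairwise disjnt (maximals D)"
proof (rule pairwiseI)
  fix A B assume AB: "A \<in> maximals D" "B \<in> maximals D" "A \<noteq> B"
  then have "\<not> A \<subseteq> B" "\<not> B \<subseteq> A" "A \<in> D" "B \<in> D"
    by (auto simp: maximals_def)
  then show "disjnt A B"
    using assms by (auto simp: laminar_def disjnt_def)
qed

section \<open>Dyadic subcells of a cube\<close>

lemma cells_nested:
  assumes "s' = s * 2 ^ d" "cell a s x \<inter> cell a s' y \<noteq> {}"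
  shows "cell a s x \<subseteq> cell a s' y"
proof -
  obtain z where "z \<in> cell a s x" "z \<in> cell a s' y"
    using assms by blast
  then have "cell a s z = cell a s x" "cell a s' z = cell a s' y"
    using cell_eq_of_mem by blast+
  then show ?thesis
    using cell_mono[OF assms(1), of a z] by simp
qed

text \<open>Stopping at generation \<open>j\<close> keeps the family finite, so that every member
  lies in a maximal one; the limit in \<open>j\<close> is taken later by continuity from
  below.\<close>

definition subcells :: "real ^ 'n \<Rightarrow> real \<Rightarrow> nat \<Rightarrow> (real ^ 'n) set set" where
  "subcells a L j = (\<Union>i\<le>j. cell a (L / 2 ^ i) ` hcube a L)"

lemma finite_subcells_upto: "L > 0 \<Longrightarrow> finite (subcells a L j)"
  by (simp add: subcells_def finite_subcells)

lemma divide_power2_le: "i \<le> j \<Longrightarrow> L / 2 ^ i = L / 2 ^ j * 2 ^ (j - i)" for L :: real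
  by (simp add: power_diff)

lemma laminar_subcells: "laminar (subcells a L j)"
proof -
  have *: "cell a (L / 2 ^ i) x \<subseteq> cell a (L / 2 ^ k) y \<or> cell a (L / 2 ^ i) x \<inter> cell a (L / 2 ^ k) y = {}"
    if "k \<le> i" for i k x y
    using cells_nested[OF divide_power2_le[OF that]] by blast
  have **: "cell a (L / 2 ^ i) x \<subseteq> cell a (L / 2 ^ k) y \<or> cell a (L / 2 ^ k) y \<subseteq> cell a (L / 2 ^ i) x
      \<or> cell a (L / 2 ^ i) x \<inter> cell a (L / 2 ^ k) y = {}" for i k x y
    using *[of i k y x] *[of k i x y] by (cases "k \<le> i") auto
  show ?thesis
    unfolding laminar_def subcells_def
  proof (intro ballI)
    fix A B assume "A \<in> (\<Union>i\<le>j. cell a (L / 2 ^ i) ` hcube a L)" "B \<in> (\<Union>i\<le>j. cell a (L / 2 ^ i) ` hcube a L)"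
    then obtain i x k y where "A = cell a (L / 2 ^ i) x" "B = cell a (L / 2 ^ k) y"
      by auto
    then show "A \<subseteq> B \<or> B \<subseteq> A \<or> A \<inter> B = {}"
      using ** by simp
  qed
qed

lemma subcell_subset:
  assumes "L > 0" "x \<in> hcube a L"
  shows "cell a (L / 2 ^ i) x \<subseteq> hcube a L"
  using cell_mono[of L "L / 2 ^ i" i a x] cell_eq_base[OF assms] by simp

lemma subcells_Union_subset: "L > 0 \<Longrightarrow> \<Union>(subcells a L j) \<subseteq> hcube a L"
  unfolding subcells_def using subcell_subset by blast

lemma subcells_hcubes: "L > 0 \<Longrightarrow> R \<in> subcells a L j \<Longrightarrow> R \<in> hcubes"
  by (auto simp: subcells_def cell_hcubes)

lemma cell_shrinks:
  fixes x :: "real ^ 'n"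
  assumes "open U" "x \<in> U" "L > 0"
  shows "\<exists>j. \<forall>i\<ge>j. cell a (L / 2 ^ i) x \<subseteq> U"
proof -
  obtain e where e: "e > 0" "ball x e \<subseteq> U"
    using assms open_contains_ball by blast
  obtain j where j: "real CARD('n) * L / e < 2 ^ j"
    using real_arch_pow[of 2] by auto
  have "cell a (L / 2 ^ i) x \<subseteq> U" if "j \<le> i" for i
  proof
    fix y assume y: "y \<in> cell a (L / 2 ^ i) x"
    have "\<bar>(x - y) $ k\<bar> \<le> L / 2 ^ i" for k
    proof -
      have "\<lfloor>(y $ k - a $ k) / (L / 2 ^ i)\<rfloor> = \<lfloor>(x $ k - a $ k) / (L / 2 ^ i)\<rfloor>"
        using y by (simp add: cell_def)
      then have "\<bar>(x $ k - a $ k) / (L / 2 ^ i) - (y $ k - a $ k) / (L / 2 ^ i)\<bar> \<le> 1"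
        by linarith
      then have "\<bar>(x - y) $ k / (L / 2 ^ i)\<bar> \<le> 1"
        by (simp only: diff_divide_distrib[symmetric]) simp
      then show ?thesis
        using \<open>L > 0\<close> by (simp only: abs_divide) (simp add: pos_divide_le_eq pos_le_divide_eq)
    qed
    then have "(\<Sum>k\<in>UNIV. \<bar>(x - y) $ k\<bar>) \<le> (\<Sum>k\<in>(UNIV::'n set). L / 2 ^ i)"
      by (intro sum_mono) auto
    then have "norm (x - y) \<le> (\<Sum>k\<in>(UNIV::'n set). L / 2 ^ i)"
      using norm_le_l1_cart[of "x - y"] by linarith
    also have "\<dots> = real CARD('n) * L / 2 ^ i"
      by simp
    also have "\<dots> < e"
    proof -
      have "real CARD('n) * L / e < 2 ^ i"
        using j power_increasing[OF that, of "2::real"] by linarith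
      then show ?thesis
        using \<open>e > 0\<close> by (simp add: field_simps)
    qed
    finally show "y \<in> U"
      using e by (auto simp: dist_norm)
  qed
  then show ?thesis
    by blast
qed

text \<open>Outer regularity is transferred from Lebesgue measure to \<open>w dx\<close>: open sets
  exceeding \<open>F\<close> by less than 2^(-k) have an intersection exceeding \<open>F\<close> by
  a Lebesgue null set, which is null for \<open>w dx\<close> too.\<close>

lemma mass_outer_open:
  assumes w: "weight w" and F: "F \<in> sets lebesgue" "F \<subseteq> Q" and Q: "bounded Q" "Q \<in> sets lebesgue" and "e > 0"
  obtains U where "open U" "F \<subseteq> U" "mass w (U \<inter> Q) \<le> mass w F + e"
proof -
  have "\<exists>T. open T \<and> F \<subseteq> T \<and> emeasure lebesgue (T - F) < ennreal ((1/2) ^ k)" for k :: nat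
  proof -
    have "0 < (1/2 :: real) ^ k" by simp
    then show ?thesis
      by (rule sets_lebesgue_outer_open[OF F(1)]) auto
  qed
  then obtain T where T: "\<And>k. open (T k)" "\<And>k. F \<subseteq> T k" "\<And>k::nat. emeasure lebesgue (T k - F) < ennreal ((1/2) ^ k)"
    by metis
  \<comment> \<open>Finite intersections make the open sets decrease, and intersecting with
    \<open>Q\<close> makes their masses finite, as continuity from above requires.\<close>
  define G where "G k = (\<Inter>i\<le>k. T i)" for k
  have Gopen: "open (G k)" and FG: "F \<subseteq> G k" for k
    using T by (auto simp: G_def)
  have Tm[measurable]: "T k \<in> sets lebesgue" for k
    using borel_open[OF T(1)[of k]] by auto
  have [measurable]: "G k \<in> sets lebesgue" "F \<in> sets lebesgue" "Q \<in> sets lebesgue" for k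
    using borel_open[OF Gopen[of k]] F Q by auto
  have lim: "(\<lambda>k. mass w (G k \<inter> Q)) \<longlonglongrightarrow> mass w (\<Inter>k. G k \<inter> Q)"
    unfolding mass_def
  proof (rule Lim_measure_decseq)
    show "range (\<lambda>k. G k \<inter> Q) \<subseteq> sets (wmeas w)"
      by auto
    show "decseq (\<lambda>k. G k \<inter> Q)"
      by (rule decseq_SucI) (auto simp: G_def)
    show "emeasure (wmeas w) (G k \<inter> Q) \<noteq> \<infinity>" for k
    proof -
      have "G k \<inter> Q \<in> fmeasurable (wmeas w)"
        by (rule fmeasurable_mass[OF w bounded_subset[OF Q(1)]]) auto
      then show ?thesis
        by (simp add: fmeasurableD2)
    qed
  qed
  have null: "(\<Inter>k. G k \<inter> Q) - F \<in> null_sets lebesgue"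
  proof -
    have *: "emeasure lebesgue ((\<Inter>k. G k \<inter> Q) - F) \<le> ennreal ((1/2) ^ k)" for k :: nat
    proof -
      have "(\<Inter>k. G k \<inter> Q) \<subseteq> T k"
        by (rule INF_lower2[of k]) (auto simp: G_def)
      then have "emeasure lebesgue ((\<Inter>k. G k \<inter> Q) - F) \<le> emeasure lebesgue (T k - F)"
        by (intro emeasure_mono) auto
      then show ?thesis
        using T(3)[of k] by (meson less_imp_le order_trans)
    qed
    have "(\<lambda>k. ennreal ((1/2) ^ k)) \<longlonglongrightarrow> ennreal 0"
      by (intro tendsto_ennrealI LIMSEQ_power_zero) simp
    then have "emeasure lebesgue ((\<Inter>k. G k \<inter> Q) - F) \<le> ennreal 0"
      by (rule LIMSEQ_le_const) (use * in blast)
    then show ?thesis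
      by (intro null_setsI) auto
  qed
  have "mass w (\<Inter>k. G k \<inter> Q) = mass w F"
  proof -
    have "F \<union> ((\<Inter>k. G k \<inter> Q) - F) = (\<Inter>k. G k \<inter> Q)"
    proof -
      have "F \<subseteq> (\<Inter>k. G k \<inter> Q)"
        using FG F(2) by (intro INT_greatest) auto
      then show ?thesis
        by (simp add: Un_absorb1)
    qed
    moreover have "mass w (F \<union> ((\<Inter>k. G k \<inter> Q) - F)) = mass w F + mass w ((\<Inter>k. G k \<inter> Q) - F)"
    proof (rule mass_Un_disjoint[OF w])
      show "bounded F" "bounded ((\<Inter>k. G k \<inter> Q) - F)"
        using F(2) by (auto intro: bounded_subset[OF Q(1)])
    qed auto
    ultimately show ?thesis
      using mass_null[OF w null] by simp
  qed
  then have "\<forall>\<^sub>F k in sequentially. mass w (G k \<inter> Q) < mass w F + e"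
    using lim \<open>e > 0\<close> by (intro order_tendstoD) auto
  then obtain k where "mass w (G k \<inter> Q) < mass w F + e"
    unfolding eventually_sequentially by auto
  then show ?thesis
    using that[of "G k"] Gopen FG by simp
qed

text \<open>This replaces the Lebesgue differentiation theorem: compare the two masses on the cells contained in an
  open superset of \<open>F\<close> of almost the same \<open>m\<close>-mass.\<close>

lemma mass_le_of_cells:
  assumes m: "weight m" and n: "weight n" and L: "L > 0" and F: "F \<in> sets lebesgue" "F \<subseteq> hcube a L" and "c \<ge> 0"
    and le: "\<And>j x. x \<in> F \<Longrightarrow> mass n (cell a (L / 2 ^ j) x) \<le> c * mass m (cell a (L / 2 ^ j) x)"
  shows "mass n F \<le> c * mass m F"
proof -
  have "mass n F \<le> c * (mass m F + e)" if e: "e > 0" for e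
  proof -
    obtain U where U: "open U" "F \<subseteq> U" "mass m (U \<inter> hcube a L) \<le> mass m F + e"
      by (rule mass_outer_open[OF m F bounded_hcube hcube_sets e])
    define V where "V j = {R \<in> cell a (L / 2 ^ j) ` hcube a L. R \<subseteq> U}" for j :: nat
    define E where "E j = F \<inter> \<Union>(V j)" for j
    have finV: "finite (V j)" for j
      using finite_subcells[OF L, of a j] by (simp add: V_def)
    have Vset: "R \<in> sets lebesgue" if "R \<in> V j" for R j
      using that L by (auto simp: V_def)
    have Vb: "R \<subseteq> hcube a L" if "R \<in> V j" for R j
      using that subcell_subset[OF L] by (auto simp: V_def)
    have VU: "\<Union>(V j) \<in> sets lebesgue" for j
      using finV Vset by (intro sets.finite_Union) auto
    have disj: "pairwise disjnt W" if "W \<subseteq> V j" for W j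
    proof -
      have "pairwise disjnt (V j)"
      proof (rule pairwiseI)
        fix A B assume "A \<in> V j" "B \<in> V j" "A \<noteq> B"
        then obtain x y where *: "A = cell a (L / 2 ^ j) x" "B = cell a (L / 2 ^ j) y" "A \<noteq> B"
          by (auto simp: V_def)
        have False if "z \<in> A" "z \<in> B" for z
          using that * cell_eq_of_mem[of z a "L / 2 ^ j" x] cell_eq_of_mem[of z a "L / 2 ^ j" y] by simp
        then show "disjnt A B"
          by (auto simp: disjnt_def)
      qed
      then show ?thesis using that by (rule pairwise_subset)
    qed
    have Eset: "E j \<in> sets lebesgue" for j
      using VU F by (auto simp: E_def)
    have bound: "mass n (E j) \<le> c * (mass m F + e)" for j
    proof -
      \<comment> \<open>The hypothesis concerns cells through points of \<open>F\<close>, so only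
        the cells that meet \<open>F\<close> are kept.\<close>
      define W where "W = {R \<in> V j. R \<inter> F \<noteq> {}}"
      have WV: "W \<subseteq> V j" by (auto simp: W_def)
      then have finW: "finite W" using finV by (rule finite_subset)
      have Wb: "bounded R" if "R \<in> W" for R
        by (rule bounded_subset[OF bounded_hcube[of a L]]) (use Vb WV that in blast)
      have Ws: "R \<in> sets lebesgue" if "R \<in> W" for R
        using Vset WV that by blast
      have UWs: "\<Union>W \<in> sets lebesgue" using finW Ws by blast
      have UWb: "bounded (\<Union>W)" using finW Wb by blast
      have "mass n (E j) \<le> mass n (\<Union>W)"
        by (rule mass_mono[OF n UWb Eset UWs]) (auto simp: E_def W_def)
      also have "\<dots> = (\<Sum>R\<in>W. mass n R)"
        by (rule mass_Union_disjoint[OF n finW Wb Ws disj[OF WV]])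
      also have "\<dots> \<le> (\<Sum>R\<in>W. c * mass m R)"
      proof (rule sum_mono)
        fix R assume "R \<in> W"
        then obtain x y where "R = cell a (L / 2 ^ j) x" "y \<in> R" "y \<in> F"
          by (auto simp: W_def V_def)
        then show "mass n R \<le> c * mass m R"
          using le[of y j] cell_eq_of_mem[of y a "L / 2 ^ j" x] by simp
      qed
      also have "\<dots> = c * mass m (\<Union>W)"
        by (simp add: sum_distrib_left mass_Union_disjoint[OF m finW Wb Ws disj[OF WV]])
      also have "\<dots> \<le> c * mass m (U \<inter> hcube a L)"
      proof (intro mult_left_mono mass_mono[OF m])
        have "R \<subseteq> U \<inter> hcube a L" if "R \<in> W" for R
          using that WV Vb[of R j] by (auto simp: V_def)
        then show "\<Union>W \<subseteq> U \<inter> hcube a L" by blast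
        show "bounded (U \<inter> hcube a L)" by (simp add: bounded_Int)
        show "U \<inter> hcube a L \<in> sets lebesgue" using borel_open[OF U(1)] by auto
      qed (use UWs \<open>c \<ge> 0\<close> in auto)
      also have "\<dots> \<le> c * (mass m F + e)"
        using U(3) \<open>c \<ge> 0\<close> by (rule mult_left_mono)
      finally show ?thesis .
    qed
    have UE: "(\<Union>j. E j) = F"
    proof
      show "F \<subseteq> (\<Union>j. E j)"
      proof
        fix x assume x: "x \<in> F"
        then have "x \<in> U" using U(2) by blast
        then obtain j where "\<forall>i\<ge>j. cell a (L / 2 ^ i) x \<subseteq> U"
          using cell_shrinks[OF U(1) _ L] by blast
        then have "cell a (L / 2 ^ j) x \<subseteq> U" by simp
        then have "cell a (L / 2 ^ j) x \<in> V j"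
          using x F(2) unfolding V_def by blast
        then have "x \<in> E j"
          using x unfolding E_def by (meson IntI UnionI mem_cell_self)
        then show "x \<in> (\<Union>j. E j)" by blast
      qed
    qed (auto simp: E_def)
    have "incseq E"
    proof (rule incseq_SucI)
      fix j
      show "E j \<subseteq> E (Suc j)"
      proof
        fix x assume x: "x \<in> E j"
        then obtain y where "x \<in> cell a (L / 2 ^ j) y" "cell a (L / 2 ^ j) y \<subseteq> U"
          by (auto simp: E_def V_def)
        then have "cell a (L / 2 ^ j) x \<subseteq> U"
          using cell_eq_of_mem[of x a "L / 2 ^ j" y] by simp
        then have "cell a (L / 2 ^ Suc j) x \<subseteq> U"
          using cell_mono[of "L / 2 ^ j" "L / 2 ^ Suc j" 1 a x] by auto
        moreover have "x \<in> F" using x by (simp add: E_def)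
        ultimately have "cell a (L / 2 ^ Suc j) x \<in> V (Suc j)"
          using F(2) unfolding V_def by blast
        then show "x \<in> E (Suc j)"
          using \<open>x \<in> F\<close> unfolding E_def by (meson IntI UnionI mem_cell_self)
      qed
    qed
    then have "(\<lambda>j. mass n (E j)) \<longlonglongrightarrow> mass n (\<Union>j. E j)"
      unfolding mass_def
      using Eset UE fmeasurable_mass[OF n bounded_subset[OF bounded_hcube F(2)] F(1)]
      by (intro Lim_measure_incseq) (auto simp: fmeasurable_def)
    then show ?thesis
      unfolding UE by (rule LIMSEQ_le_const2) (use bound in blast)
  qed
  note * = this
  have lim: "(\<lambda>k. c * (mass m F + inverse (real (Suc k)))) \<longlonglongrightarrow> c * (mass m F + 0)"
    by (intro tendsto_intros LIMSEQ_inverse_real_of_nat)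
  have "mass n F \<le> c * (mass m F + inverse (real (Suc k)))" for k
    by (rule *) simp
  then have "mass n F \<le> c * (mass m F + 0)"
    by (intro LIMSEQ_le_const[OF lim]) blast
  then show ?thesis
    by simp
qed

subsection \<open>Dyadic stopping and power decay\<close>

lemma sets_Collect_less:
  fixes f g :: "'a::euclidean_space \<Rightarrow> real"
  assumes "Q \<in> sets lebesgue" "f \<in> borel_measurable lebesgue" "g \<in> borel_measurable lebesgue"
  shows "{x \<in> Q. f x < g x} \<in> sets lebesgue"
proof -
  have "{x \<in> space lebesgue. f x < g x} \<in> sets lebesgue"
    using assms(2,3) by measurable
  moreover have "{x \<in> Q. f x < g x} = Q \<inter> {x \<in> space lebesgue. f x < g x}"
    by auto
  ultimately show ?thesis
    using assms(1) by auto
qed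

lemma mass_incseq_le:
  assumes w: "weight w" and "incseq E" and E: "\<And>j. E j \<in> sets lebesgue" "\<And>j. E j \<subseteq> Q"
    and Q: "bounded Q" and le: "\<And>j. mass w (E j) \<le> c"
  shows "mass w (\<Union>j. E j) \<le> c"
proof -
  have "(\<Union>j. E j) \<in> fmeasurable (wmeas w)"
    using E by (intro fmeasurable_mass[OF w bounded_subset[OF Q]]) auto
  then have "(\<lambda>j. mass w (E j)) \<longlonglongrightarrow> mass w (\<Union>j. E j)"
    unfolding mass_def using E \<open>incseq E\<close>
    by (intro Lim_measure_incseq) (auto simp: fmeasurableD2)
  then show ?thesis
    by (rule LIMSEQ_le_const2) (use le in blast)
qed

text \<open>The set where the density of \<nu> = \<open>n dx\<close> relative to \<mu> =
  \<open>m dx\<close> exceeds \<open>T\<close> times the ratio \<nu>(Q) / \<mu>(Q), multiplied out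
  to avoid dividing by \<open>m x\<close>.\<close>

abbreviation above :: "(real ^ 'n \<Rightarrow> real) \<Rightarrow> (real ^ 'n \<Rightarrow> real) \<Rightarrow> real \<Rightarrow> (real ^ 'n) set \<Rightarrow> (real ^ 'n) set" where
  "above m n T Q \<equiv> {x \<in> Q. T * mass n Q * m x < n x * mass m Q}"

text \<open>On a maximal dyadic cube \<open>R\<close> whose ratio \<open>\<nu>(R) / \<mu>(R)\<close> exceeds that of \<open>Q\<close> by \<open>1 / \<theta>\<close>, doubling keeps the
  ratio below \<open>D / \<theta>\<close> times that of \<open>Q\<close>, so the hypothesis at height \<open>T\<close> can be used inside \<open>R\<close>.
  Here \<open>\<mu>\<close> and \<open>\<nu>\<close> have the densities \<open>m\<close> and \<open>n\<close>.\<close>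

lemma stopping_step:
  fixes m n :: "real ^ 'n \<Rightarrow> real"
  assumes m: "weight m" and n: "weight n"
    and dbl: "\<And>a s x. s > 0 \<Longrightarrow> mass m (cell a (2 * s) x) \<le> D * mass m (cell a s x)"
    and ac: "\<And>Q F. Q \<in> hcubes \<Longrightarrow> F \<subseteq> Q \<Longrightarrow> F \<in> sets lebesgue \<Longrightarrow> mass m F \<le> \<theta> * mass m Q \<Longrightarrow> mass n F \<le> \<beta> * mass n Q"
    and hyp: "\<And>Q. Q \<in> hcubes \<Longrightarrow> mass n (above m n T Q) \<le> \<psi> * mass n Q"
    and const: "D \<ge> 1" "0 < \<theta>" "\<theta> < 1" "0 \<le> \<psi>" "T \<ge> 1"
    and Q: "Q \<in> hcubes"
  shows "mass n (above m n (2 * D / \<theta> * T) Q) \<le> \<beta> * \<psi> * mass n Q"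
proof -
  obtain a L where L: "L > 0" and Qeq: "Q = hcube a L"
    using Q by (auto simp: hcubes_def)
  have [measurable]: "m \<in> borel_measurable lebesgue" "n \<in> borel_measurable lebesgue"
    using m n by (auto intro: weight_measurable)
  have pos: "mass m R > 0" "mass n R > 0" if "R \<in> hcubes" for R
    using that mass_hcubes_pos m n by auto
  \<comment> \<open>The stopping threshold for \<nu>(R) / \<mu>(R): it is 1 / \<theta> times the
    ratio of \<open>Q\<close>.\<close>
  define K where "K = mass n Q / mass m Q / \<theta>"
  have K: "K > 0" "K * \<theta> * mass m Q = mass n Q"
    using pos[OF Q] const by (auto simp: K_def)
  define F where "F = (above m n (2 * D / \<theta> * T) Q)"
  have Fset: "F \<in> sets lebesgue"
    unfolding F_def by (rule sets_Collect_less) (use Q hcubes_sets in auto)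
  have FQ: "F \<subseteq> hcube a L"
    by (auto simp: F_def Qeq)
  have FK: "2 * D * T * K * m x < n x" if "x \<in> F" for x
  proof -
    have "(2 * D / \<theta> * T) * mass n Q * m x = 2 * D * T * K * m x * mass m Q"
      using K(2) const(2) by (simp add: field_simps)
    then show ?thesis
      using that pos(1)[OF Q] by (simp add: F_def)
  qed
  define \<R> where "\<R> j = {R \<in> subcells a L j. K * mass m R < mass n R}" for j
  define S where "S j = \<Union>(\<R> j)" for j
  have fin: "finite (\<R> j)" for j
    by (rule finite_subset[OF _ finite_subcells_upto[OF L, of a j]]) (auto simp: \<R>_def)
  have lam: "laminar (\<R> j)" for j
    by (rule laminar_subset[OF laminar_subcells]) (auto simp: \<R>_def)
  have R_hcubes: "R \<in> hcubes" if "R \<in> \<R> j" for R j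
    using that subcells_hcubes[OF L] by (auto simp: \<R>_def)
  have SQ: "S j \<subseteq> hcube a L" for j
    using subcells_Union_subset[OF L, of a j] by (auto simp: S_def \<R>_def)
  have Sset: "S j \<in> sets lebesgue" for j
    unfolding S_def using fin R_hcubes hcubes_sets by (intro sets.finite_Union) auto
  have Smass: "mass w (S j) = (\<Sum>R\<in>maximals (\<R> j). mass w R)" if "weight w" for w j
  proof -
    have "mass w (\<Union>(maximals (\<R> j))) = (\<Sum>R\<in>maximals (\<R> j). mass w R)"
      using maximals_subset[of "\<R> j"] R_hcubes hcubes_sets bounded_hcubes
      by (intro mass_Union_disjoint[OF that] disjoint_maximals[OF lam] finite_subset[OF maximals_subset fin]) blast+
    then show ?thesis
      by (simp add: S_def Union_maximals[OF fin])
  qed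
  have nS: "mass n (S j) \<le> \<beta> * mass n Q" for j
  proof -
    \<comment> \<open>Chebyshev: summing the stopping condition over the disjoint maximal cubes
      shows that they cover at most the fraction \<theta> of the \<mu>-mass of \<open>Q\<close>, as
      \<open>ac\<close> demands.\<close>
    have "K * mass m (S j) \<le> mass n (S j)"
      unfolding Smass[OF m] Smass[OF n] sum_distrib_left
      using maximals_subset[of "\<R> j"] by (intro sum_mono) (auto simp: \<R>_def)
    also have "\<dots> \<le> mass n Q"
      using SQ Sset by (intro mass_mono[OF n]) (auto simp: Qeq)
    also have "\<dots> = K * (\<theta> * mass m Q)"
      using K(2) by simp
    finally have "mass m (S j) \<le> \<theta> * mass m Q"
      using K(1) by simp
    then show ?thesis
      using ac[OF Q, of "S j"] SQ Sset by (simp add: Qeq)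
  qed
  have upper: "mass n R \<le> K * (D * mass m R)" if R: "R \<in> maximals (\<R> j)" for R j
  proof -
    have RR: "R \<in> \<R> j" using R maximals_subset by blast
    obtain i x where x: "x \<in> hcube a L" and i: "i \<le> j" and Req: "R = cell a (L / 2 ^ i) x"
      using RR by (auto simp: \<R>_def subcells_def)
    \<comment> \<open>A maximal cube cannot be \<open>Q\<close>, whose ratio is \<theta> K < K.
      Hence its dyadic parent is in the family and was not selected, and doubling passes the
      parent's bound on.\<close>
    show ?thesis
    proof (cases i)
      case 0
      then have "R = Q" using Req cell_eq_base[OF L x] by (simp add: Qeq)
      then have "K * mass m Q < K * mass m Q * \<theta>"
        using RR K(2) by (simp add: \<R>_def mult.commute mult.left_commute)
      moreover have "K * mass m Q * \<theta> \<le> K * mass m Q * 1"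
        using K(1) const pos[OF Q] by (intro mult_left_mono) auto
      ultimately show ?thesis by simp
    next
      case (Suc k)
      define P where "P = cell a (L / 2 ^ k) x"
      have P: "P \<in> subcells a L j"
        using x i Suc by (auto simp: subcells_def P_def)
      have RP: "R \<subseteq> P"
        unfolding Req P_def by (rule cell_mono[of _ _ 1]) (simp add: Suc)
      have "P \<notin> \<R> j"
      proof
        assume "P \<in> \<R> j"
        then have "R = P" using R RP by (auto simp: maximals_def)
        then have "(L / 2 ^ i) ^ CARD('n) = (L / 2 ^ k) ^ CARD('n)"
          using measure_cell[of "L / 2 ^ i" a x] measure_cell[of "L / 2 ^ k" a x] L by (simp add: Req P_def)
        moreover have "(L / 2 ^ i) ^ CARD('n) < (L / 2 ^ k) ^ CARD('n)"
          using L Suc by (intro power_strict_mono) (auto simp: field_simps)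
        ultimately show False by simp
      qed
      then have "mass n P \<le> K * mass m P"
        using P by (simp add: \<R>_def)
      moreover have "mass n R \<le> mass n P"
        using RP R_hcubes[OF RR] subcells_hcubes[OF L P] by (intro mass_mono[OF n]) (auto simp: bounded_hcubes hcubes_sets)
      moreover have "mass m P \<le> D * mass m R"
        using dbl[of "L / 2 ^ i" a x] L by (simp add: Req P_def Suc)
      then have "K * mass m P \<le> K * (D * mass m R)"
        using K(1) by simp
      ultimately show ?thesis by linarith
    qed
  qed
  have local: "mass n (F \<inter> R) \<le> \<psi> * mass n R" if R: "R \<in> maximals (\<R> j)" for R j
  proof -
    have Rh: "R \<in> hcubes" using R maximals_subset R_hcubes by blast
    have "mass n (F \<inter> R) \<le> mass n (above m n T R)"
    proof (rule mass_mono[OF n])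
      show "F \<inter> R \<subseteq> (above m n T R)"
      proof clarsimp
        fix x assume x: "x \<in> F" "x \<in> R"
        have mx: "0 \<le> m x" using weight_nonneg[OF m] .
        have "T * mass n R * m x \<le> T * (K * (D * mass m R)) * m x"
          using upper[OF R] const mx by (intro mult_right_mono mult_left_mono) auto
        also have "\<dots> \<le> (2 * D * T * K * m x) * mass m R"
          using const mx K(1) by (simp add: mult_nonneg_nonneg)
        also have "\<dots> < n x * mass m R"
          using FK[OF x(1)] pos(1)[OF Rh] by (intro mult_strict_right_mono)
        finally show "T * mass n R * m x < n x * mass m R" .
      qed
      show "(above m n T R) \<in> sets lebesgue"
        by (rule sets_Collect_less) (use Rh hcubes_sets in auto)
      show "bounded (above m n T R)"
        using bounded_hcubes[OF Rh] by (rule bounded_subset) auto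
      show "F \<inter> R \<in> sets lebesgue"
        using Fset hcubes_sets[OF Rh] by auto
    qed
    also have "\<dots> \<le> \<psi> * mass n R"
      by (rule hyp[OF Rh])
    finally show ?thesis .
  qed
  have FS: "mass n (F \<inter> S j) \<le> \<beta> * \<psi> * mass n Q" for j
  proof -
    have "F \<inter> S j = (\<Union>R\<in>maximals (\<R> j). F \<inter> R)"
      using Union_maximals[OF fin[of j]] by (auto simp: S_def)
    moreover have "mass n (\<Union>R\<in>maximals (\<R> j). F \<inter> R) \<le> (\<Sum>R\<in>maximals (\<R> j). mass n (F \<inter> R))"
    proof (rule mass_Union_le)
      show "finite (maximals (\<R> j))" by (rule finite_subset[OF maximals_subset fin])
      show "F \<inter> R \<in> sets lebesgue" if "R \<in> maximals (\<R> j)" for R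
        using that maximals_subset R_hcubes hcubes_sets Fset by blast
    qed
    ultimately have "mass n (F \<inter> S j) \<le> (\<Sum>R\<in>maximals (\<R> j). mass n (F \<inter> R))"
      by simp
    also have "\<dots> \<le> (\<Sum>R\<in>maximals (\<R> j). \<psi> * mass n R)"
      by (intro sum_mono local)
    also have "\<dots> = \<psi> * mass n (S j)"
      by (simp add: Smass[OF n] sum_distrib_left)
    also have "\<dots> \<le> \<psi> * (\<beta> * mass n Q)"
      using nS const by (intro mult_left_mono) auto
    finally show ?thesis by (simp add: mult_ac)
  qed
  \<comment> \<open>No cell through a point of \<open>E\<close> was selected, so \<nu>(E) \<le> K
    \<mu>(E). On \<open>F\<close> the density exceeds 2 K, because D and T are at least 1, so
    \<nu>(E) \<ge> 2 K \<mu>(E). The factor 2 in the new height thus forces \<nu>(E) = 0.\<close>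
  define E where "E = F - (\<Union>j. S j)"
  have Eset: "E \<in> sets lebesgue"
    using Fset Sset by (auto simp: E_def)
  have EQ: "E \<subseteq> hcube a L"
    using FQ by (auto simp: E_def)
  have "mass n E \<le> K * mass m E"
  proof (rule mass_le_of_cells[OF m n L Eset EQ])
    fix j x assume x: "x \<in> E"
    show "mass n (cell a (L / 2 ^ j) x) \<le> K * mass m (cell a (L / 2 ^ j) x)"
    proof (rule ccontr)
      assume "\<not> ?thesis"
      then have "cell a (L / 2 ^ j) x \<in> \<R> j"
        using x EQ by (auto simp: \<R>_def subcells_def)
      then have "x \<in> S j"
        using mem_cell_self[of x a "L / 2 ^ j"] unfolding S_def by blast
      then show False
        using x by (auto simp: E_def)
    qed
  qed (use K in simp)
  moreover have "mass m E \<le> 1 / (2 * K) * mass n E"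
  proof (rule mass_le_mass[OF m n _ Eset])
    have "m x \<le> 1 / (2 * K) * n x" if "x \<in> E" for x
    proof -
      have "1 * 1 \<le> D * T"
        using const by (intro mult_mono) auto
      then have "2 * K * m x * 1 \<le> 2 * K * m x * (D * T)"
        using weight_nonneg[OF m, of x] K(1) by (intro mult_left_mono) auto
      also have "\<dots> < n x"
        using FK[of x] that by (simp add: E_def mult_ac)
      finally show ?thesis
        using K(1) by (simp add: field_simps)
    qed
    then show "AE x in lebesgue. x \<in> E \<longrightarrow> m x \<le> 1 / (2 * K) * n x"
      by simp
  qed (use K EQ bounded_subset[OF bounded_hcube] in auto)
  ultimately have "2 * (K * mass m E) \<le> mass n E" "mass n E \<le> K * mass m E"
    using K(1) by (auto simp: pos_le_divide_eq mult_ac)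
  then have E0: "mass n E = 0"
    using mass_nonneg[of n E] by linarith
  have "mass n (\<Union>j. F \<inter> S j) \<le> \<beta> * \<psi> * mass n Q"
  proof (rule mass_incseq_le[OF n _ _ _ _ FS])
    show "incseq (\<lambda>j. F \<inter> S j)"
    proof (rule incseq_SucI)
      fix j
      have "\<R> j \<subseteq> \<R> (Suc j)" unfolding \<R>_def subcells_def by auto
      then show "F \<inter> S j \<subseteq> F \<inter> S (Suc j)" unfolding S_def by blast
    qed
    show "F \<inter> S j \<subseteq> hcube a L" for j using FQ by blast
  qed (use Fset Sset in auto)
  moreover have "mass n F \<le> mass n E + mass n (\<Union>j. F \<inter> S j)"
  proof -
    have b: "bounded E" "bounded (\<Union>j. F \<inter> S j)"
      by (rule bounded_subset[OF bounded_hcube[of a L]]; use EQ FQ in blast)+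
    have "mass n F \<le> mass n (E \<union> (\<Union>j. F \<inter> S j))"
      using b Eset Fset Sset by (intro mass_mono[OF n]) (auto simp: E_def)
    also have "\<dots> \<le> mass n E + mass n (\<Union>j. F \<inter> S j)"
      using b Eset Fset Sset by (intro mass_Un_le[OF n]) auto
    finally show ?thesis .
  qed
  ultimately show ?thesis
    using E0 by (simp add: F_def)
qed

text \<open>Each multiplication of the height by \<open>\<Lambda>\<close> = 2 D / \<theta> gains a
  factor \<beta>, so the decay is a power with exponent s given by \<beta> = \<Lambda>^(-s).\<close>

lemma stopping_power_decay:
  fixes m n :: "real ^ 'n \<Rightarrow> real"
  assumes m: "weight m" and n: "weight n"
    and dbl: "\<And>a s x. s > 0 \<Longrightarrow> mass m (cell a (2 * s) x) \<le> D * mass m (cell a s x)"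
    and ac: "\<And>Q F. Q \<in> hcubes \<Longrightarrow> F \<subseteq> Q \<Longrightarrow> F \<in> sets lebesgue \<Longrightarrow> mass m F \<le> \<theta> * mass m Q \<Longrightarrow> mass n F \<le> \<beta> * mass n Q"
    and const: "D \<ge> 1" "0 < \<theta>" "\<theta> < 1" "0 < \<beta>" "\<beta> < 1"
  shows "\<exists>C>0. \<exists>s>0. \<forall>Q\<in>hcubes. \<forall>T>0.
    mass n (above m n T Q) \<le> C * T powr (- s) * mass n Q"
proof -
  define \<Lambda> where "\<Lambda> = 2 * D / \<theta>"
  have L: "\<Lambda> > 1"
    using const by (simp add: \<Lambda>_def field_simps)
  have meas: "(above m n T Q) \<in> sets lebesgue" if "Q \<in> hcubes" for Q T
    using weight_measurable[OF m] weight_measurable[OF n] hcubes_sets[OF that]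
    by (intro sets_Collect_less) auto
  have bdd: "bounded {x \<in> Q. P x}" if "Q \<in> hcubes" for Q :: "(real ^ 'n) set" and P
    using bounded_hcubes[OF that] by (rule bounded_subset) auto
  have iter: "mass n (above m n (\<Lambda> ^ k) Q) \<le> \<beta> ^ k * mass n Q" if "Q \<in> hcubes" for Q k
    using that
  proof (induction k arbitrary: Q)
    case 0
    then show ?case
      using meas[OF 0, of 1] bounded_hcubes[OF 0] hcubes_sets[OF 0] by (simp, intro mass_mono[OF n]) auto
  next
    case (Suc k)
    have "mass n {x \<in> Q. (2 * D / \<theta> * \<Lambda> ^ k) * mass n Q * m x < n x * mass m Q} \<le> \<beta> * \<beta> ^ k * mass n Q"
      using const L Suc by (intro stopping_step[OF m n dbl ac]) auto
    then show ?case by (simp add: \<Lambda>_def)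
  qed
  define s where "s = - log \<Lambda> \<beta>"
  have s: "s > 0" using L const by (simp add: s_def)
  have beta: "\<beta> = \<Lambda> powr (- s)"
    using L const by (simp add: s_def)
  have "mass n (above m n T Q) \<le> 1 / \<beta> * T powr (- s) * mass n Q"
    if Q: "Q \<in> hcubes" and T: "T > 0" for Q T
  proof (cases "T < 1")
    \<comment> \<open>Below height 1 the right-hand side is already at least the mass of
      \<open>Q\<close>.\<close>
    case True
    have "1 powr (- s) \<le> T powr (- s)"
      using True T s by (intro powr_mono2') auto
    moreover have "1 \<le> 1 / \<beta>" using const by simp
    ultimately have "1 * 1 \<le> 1 / \<beta> * T powr (- s)"
      using const by (intro mult_mono) auto
    then have "mass n Q \<le> 1 / \<beta> * T powr (- s) * mass n Q"
      using mult_right_mono[of 1 "1 / \<beta> * T powr (- s)" "mass n Q"] by simp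
    moreover have "mass n (above m n T Q) \<le> mass n Q"
      using meas[OF Q] bounded_hcubes[OF Q] hcubes_sets[OF Q] by (intro mass_mono[OF n]) auto
    ultimately show ?thesis by linarith
  next
    case False
    \<comment> \<open>The height is rounded down to a power of \<open>\<Lambda>\<close>; the step
      lost in rounding is the factor 1 / \<beta> in the constant.\<close>
    define k where "k = nat \<lfloor>log \<Lambda> T\<rfloor>"
    have lg: "0 \<le> log \<Lambda> T" using False L by simp
    have k: "real k \<le> log \<Lambda> T" "log \<Lambda> T < real k + 1"
      using lg by (auto simp: k_def)
    have kT: "\<Lambda> ^ k \<le> T" "T \<le> \<Lambda> ^ (k + 1)"
    proof -
      show "\<Lambda> ^ k \<le> T"
        using k(1) L T by (simp add: le_log_iff powr_realpow)
      have "log \<Lambda> T \<le> real (k + 1)" using k(2) by simp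
      then show "T \<le> \<Lambda> ^ (k + 1)"
        using L T by (simp add: log_le_iff powr_realpow del: of_nat_add of_nat_Suc)
    qed
    have "mass n (above m n T Q) \<le> mass n (above m n (\<Lambda> ^ k) Q)"
    proof (rule mass_mono[OF n bdd[OF Q] meas[OF Q] meas[OF Q]])
      have "\<Lambda> ^ k * mass n Q * m x \<le> T * mass n Q * m x" for x
        using kT weight_nonneg[OF m] by (intro mult_right_mono) auto
      then show "(above m n T Q) \<subseteq> (above m n (\<Lambda> ^ k) Q)"
        using le_less_trans by blast
    qed
    also have "\<dots> \<le> \<beta> ^ k * mass n Q"
      by (rule iter[OF Q])
    also have "\<dots> = 1 / \<beta> * \<beta> ^ (k + 1) * mass n Q"
      using const by simp
    also have "\<beta> ^ (k + 1) = (\<Lambda> ^ (k + 1)) powr (- s)"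
    proof -
      have "\<beta> ^ (k + 1) = (\<Lambda> powr (- s)) powr real (k + 1)"
        using beta const by (simp add: powr_realpow del: of_nat_add of_nat_Suc power_Suc)
      also have "\<dots> = (\<Lambda> powr real (k + 1)) powr (- s)"
        by (simp add: powr_powr mult.commute)
      finally show ?thesis using L by (simp add: powr_realpow del: of_nat_add of_nat_Suc power_Suc)
    qed
    also have "1 / \<beta> * (\<Lambda> ^ (k + 1)) powr (- s) * mass n Q \<le> 1 / \<beta> * T powr (- s) * mass n Q"
    proof (intro mult_right_mono mult_left_mono)
      show "(\<Lambda> ^ (k + 1)) powr - s \<le> T powr - s"
        using kT(2) s T by (intro powr_mono2') auto
    qed (use const in auto)
    finally show ?thesis .
  qed
  then show ?thesis
    using s const by (intro exI[of _ "1 / \<beta>"] conjI exI[of _ s]) auto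
qed

subsection \<open>Quantitative absolute continuity\<close>

text \<open>The form in which \<open>A\<^sub>\<infinity>\<close> is used; it holds for \<open>A\<^sub>1\<close> weights as well.\<close>

abbreviation large_subsets :: "(real ^ 'n \<Rightarrow> real) \<Rightarrow> real \<Rightarrow> real \<Rightarrow> bool" where
  "large_subsets w \<eta> c \<equiv>
    \<forall>Q\<in>hcubes. \<forall>G\<in>sets lebesgue. G \<subseteq> Q \<longrightarrow>
    \<eta> * vol Q \<le> vol G \<longrightarrow> c * mass w Q \<le> mass w G"

text \<open>All fractions \<eta> are required: 1/2 feeds the stopping lemma, while 2^(-n) and other
  small fractions give doubling and comparison with larger cubes.\<close>

definition ample :: "(real ^ 'n \<Rightarrow> real) \<Rightarrow> bool" where
  "ample w \<longleftrightarrow> weight w \<and> (\<forall>\<eta>>0. \<exists>c>0. large_subsets w \<eta> c)"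

lemma ample_weight: "ample w \<Longrightarrow> weight w"
  by (simp add: ample_def)

lemma ampleD:
  assumes "ample w" "\<eta> > 0"
  shows "\<exists>c>0. large_subsets w \<eta> c"
  using assms by (simp add: ample_def)

lemma measure_cell_double:
  fixes a :: "real ^ 'n"
  assumes "s > 0"
  shows "vol (cell a (2 * s) x) = 2 ^ CARD('n) * vol (cell a s x)"
  using assms by (simp add: measure_cell power_mult_distrib)

lemma lmeasure_Diff:
  fixes Q :: "(real ^ 'n) set"
  assumes "Q \<in> hcubes" "F \<in> sets lebesgue" "F \<subseteq> Q"
  shows "vol (Q - F) = vol Q - vol F"
  using assms hcubes_lmeasurable[OF assms(1)] by (intro measurable_measure_Diff) auto

lemma mass_Diff:
  fixes Q :: "(real ^ 'n) set"
  assumes "weight w" "Q \<in> hcubes" "F \<in> sets lebesgue" "F \<subseteq> Q"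
  shows "mass w (Q - F) = mass w Q - mass w F"
  unfolding mass_def using assms fmeasurable_mass[of w Q]
  by (intro measurable_measure_Diff) (auto simp: bounded_hcubes hcubes_sets)

abbreviation upper_decay :: "(real ^ 'n \<Rightarrow> real) \<Rightarrow> real \<Rightarrow> real \<Rightarrow> bool" where
  "upper_decay w C s \<equiv> \<forall>Q\<in>hcubes. \<forall>T>0. mass w {x \<in> Q. T * mass w Q < w x * vol Q} \<le> C * T powr (- s) * mass w Q"

text \<open>The stopping lemma with Lebesgue measure as \<mu> and \<open>w dx\<close> as \<nu>.
  Absolute continuity comes from the complement: if F fills at most half of Q, then the rest carries
  at least the fraction c of the mass.\<close>

lemma ample_upper_level:
  fixes w :: "real ^ 'n \<Rightarrow> real"
  assumes w: "ample w"
  shows "\<exists>C>0. \<exists>s>0. upper_decay w C s"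
proof -
  note ww = ample_weight[OF w]
  obtain c where c: "c > 0" "large_subsets w (1/2) c"
    using ampleD[OF w, of "1/2"] by auto
  have "\<exists>C>0. \<exists>s>0. \<forall>Q\<in>hcubes. \<forall>T>0.
    mass w {x \<in> Q. T * mass w Q * 1 < w x * mass (\<lambda>x. 1) Q} \<le> C * T powr (- s) * mass w Q"
  \<comment> \<open>Lebesgue measure doubles with the exact factor 2^n; the maximum with 1/2 secures
    a positive \<beta>.\<close>
  proof (rule stopping_power_decay[OF weight_one ww, where D = "2 ^ CARD('n)" and \<theta> = "1/2" and \<beta> = "max (1 - c) (1/2)"])
    show "mass w F \<le> max (1 - c) (1/2) * mass w Q"
      if Q: "Q \<in> hcubes" and F: "F \<subseteq> Q" "F \<in> sets lebesgue" and le: "mass (\<lambda>x. 1) F \<le> 1/2 * mass (\<lambda>x. 1) Q" for Q F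
    proof -
      have "c * mass w Q \<le> mass w (Q - F)"
        using le F hcubes_sets[OF Q] by (intro c(2)[rule_format, OF Q]) (auto simp: mass_one lmeasure_Diff[OF Q F(2,1)])
      then have "mass w F \<le> (1 - c) * mass w Q"
        by (simp add: mass_Diff[OF ww Q F(2,1)] algebra_simps)
      also have "\<dots> \<le> max (1 - c) (1/2) * mass w Q"
        by (intro mult_right_mono) auto
      finally show ?thesis .
    qed
  qed (use c in \<open>auto simp: mass_one measure_cell_double\<close>)
  then show ?thesis
    by (simp add: mass_one)
qed

text \<open>The same with the two measures exchanged: small values of \<open>w\<close> are large
  values of the density of dx relative to \<open>w dx\<close>. Doubling of \<open>w dx\<close> is
  the subset property for the fraction 2^(-n).\<close>

lemma ample_lower_level:
  fixes w :: "real ^ 'n \<Rightarrow> real"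
  assumes w: "ample w"
  shows "\<exists>C>0. \<exists>s>0. \<forall>Q\<in>hcubes. \<forall>T>0.
    vol {x \<in> Q. T * vol Q * w x < mass w Q} \<le> C * T powr (- s) * vol Q"
proof -
  note ww = ample_weight[OF w]
  obtain c where c: "c > 0" "large_subsets w (1/2) c"
    using ampleD[OF w, of "1/2"] by auto
  obtain d where d: "d > 0" "large_subsets w (1/2 ^ CARD('n)) d"
    using ampleD[OF w, of "1/2 ^ CARD('n)"] by auto
  have "\<exists>C>0. \<exists>s>0. \<forall>Q\<in>hcubes. \<forall>T>0.
    mass (\<lambda>x. 1) {x \<in> Q. T * mass (\<lambda>x. 1) Q * w x < 1 * mass w Q} \<le> C * T powr (- s) * mass (\<lambda>x. 1) Q"
  \<comment> \<open>A set with more than half of the volume has at least the fraction c of the mass,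
    so a mass fraction of c / 2 excludes it.\<close>
  proof (rule stopping_power_decay[OF ww weight_one, where D = "max 1 (1 / d)" and \<theta> = "min (c / 2) (1/2)" and \<beta> = "1/2"])
    show "mass (\<lambda>x. 1) F \<le> 1/2 * mass (\<lambda>x. 1) Q"
      if Q: "Q \<in> hcubes" and F: "F \<subseteq> Q" "F \<in> sets lebesgue" and le: "mass w F \<le> min (c / 2) (1/2) * mass w Q" for Q F
    proof (rule ccontr)
      assume "\<not> ?thesis"
      then have "c * mass w Q \<le> mass w F"
        using F by (intro c(2)[rule_format, OF Q]) (auto simp: mass_one)
      also have "\<dots> \<le> c / 2 * mass w Q"
        by (rule order_trans[OF le], rule mult_right_mono) auto
      finally show False
        using c(1) mass_hcubes_pos[OF ww Q] by simp
    qed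
    show "mass w (cell a (2 * s) x) \<le> max 1 (1 / d) * mass w (cell a s x)" if "s > 0" for a s x
    proof -
      have "cell a s x \<subseteq> cell a (2 * s) x"
        by (rule cell_mono[of _ _ 1]) simp
      then have "d * mass w (cell a (2 * s) x) \<le> mass w (cell a s x)"
        using that by (intro d(2)[rule_format]) (auto simp: cell_hcubes measure_cell_double)
      then have "mass w (cell a (2 * s) x) \<le> 1 / d * mass w (cell a s x)"
        using d(1) by (simp add: field_simps)
      also have "\<dots> \<le> max 1 (1 / d) * mass w (cell a s x)"
        by (intro mult_right_mono) auto
      finally show ?thesis .
    qed
  qed (use c in auto)
  then show ?thesis
    by (simp add: mass_one)
qed

abbreviation power_bounded :: "(real ^ 'n \<Rightarrow> real) \<Rightarrow> real \<Rightarrow> real \<Rightarrow> bool" where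
  "power_bounded w C g \<equiv> \<forall>Q\<in>hcubes. \<forall>F\<in>sets lebesgue. F \<subseteq> Q \<longrightarrow> mass w F \<le> C * (vol F / vol Q) powr g * mass w Q"

text \<open>With x = |F| / |Q|, cut \<open>F\<close> at the height x^(-1/2) times the average of
  \<open>w\<close>. The part below contributes at most x^(1/2) w(Q), the part above at most C
  x^(s/2) w(Q) by the decay of the level sets.\<close>

lemma ample_power:
  fixes w :: "real ^ 'n \<Rightarrow> real"
  assumes w: "ample w"
  shows "\<exists>C>0. \<exists>g>0. power_bounded w C g"
proof -
  note ww = ample_weight[OF w]
  have [measurable]: "w \<in> borel_measurable lebesgue" by (rule weight_measurable[OF ww])
  obtain C s where C: "C > 0" "s > 0" "upper_decay w C s"
    using ample_upper_level[OF w] by auto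
  define g where "g = min 1 s / 2"
  have "mass w F \<le> (1 + C) * (vol F / vol Q) powr g * mass w Q"
    if Q: "Q \<in> hcubes" and F: "F \<in> sets lebesgue" "F \<subseteq> Q" for Q F
  proof (cases "vol F = 0")
    case True
    have "F \<in> lmeasurable" using fmeasurableI2[OF hcubes_lmeasurable[OF Q] F(2,1)] .
    then have "F \<in> null_sets lebesgue"
      using True by (simp add: emeasure_eq_measure2 null_sets_def F(1))
    then have "mass w F = 0" by (rule mass_null[OF ww])
    then show ?thesis using C(1) by simp
  next
    case False
    define x where "x = vol F / vol Q"
    have x: "0 < x" "x \<le> 1"
      using False measure_hcubes_pos[OF Q] measure_mono_fmeasurable[OF F(2,1) hcubes_lmeasurable[OF Q]]
      by (auto simp: x_def zero_less_measure_iff)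
    define T where "T = x powr (- 1/2)"
    have T: "T > 0" using x by (simp add: T_def)
    define A where "A = {y \<in> Q. T * mass w Q < w y * vol Q}"
    have Aset[measurable]: "A \<in> sets lebesgue"
      unfolding A_def using hcubes_sets[OF Q] by (intro sets_Collect_less) auto
    have bd: "bounded B" if "B \<subseteq> Q" for B
      using bounded_subset[OF bounded_hcubes[OF Q] that] .
    have "mass w F \<le> mass w ((F - A) \<union> A)"
      using F Aset by (intro mass_mono[OF ww bd]) (auto simp: A_def)
    also have "\<dots> \<le> mass w (F - A) + mass w A"
      using F Aset by (intro mass_Un_le[OF ww bd bd]) (auto simp: A_def)
    also have "mass w (F - A) \<le> T * mass w Q / vol Q * mass (\<lambda>x. 1) (F - A)"
    proof (rule mass_le_mass[OF ww weight_one bd])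
      show "AE x in lebesgue. x \<in> F - A \<longrightarrow> w x \<le> T * mass w Q / vol Q * 1"
        using F measure_hcubes_pos[OF Q] by (auto simp: A_def field_simps not_less intro!: AE_I2)
    qed (use F Aset T in auto)
    also have "\<dots> \<le> T * mass w Q / vol Q * vol F"
    proof (rule mult_left_mono)
      show "mass (\<lambda>x. 1) (F - A) \<le> vol F"
        unfolding mass_one[symmetric] using F Aset by (intro mass_mono[OF weight_one bd]) auto
    qed (use T in auto)
    also have "T * mass w Q / vol Q * vol F = x powr (1/2) * mass w Q"
    proof -
      have "T * mass w Q / vol Q * vol F = (x powr (-1/2) * x powr 1) * mass w Q"
        using x by (simp add: T_def x_def)
      also have "x powr (-1/2) * x powr 1 = x powr (1/2)"
        unfolding powr_add[symmetric] by simp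
      finally show ?thesis .
    qed
    also have "mass w A \<le> C * T powr (- s) * mass w Q"
      unfolding A_def by (rule C(3)[rule_format, OF Q T])
    also have "T powr (- s) = x powr (s / 2)"
      by (simp add: T_def powr_powr)
    also have "x powr (1/2) * mass w Q + C * x powr (s / 2) * mass w Q \<le> x powr g * mass w Q + C * x powr g * mass w Q"
      using x C(1) by (intro add_mono mult_right_mono mult_left_mono powr_mono') (auto simp: g_def)
    finally show ?thesis
      by (simp add: x_def algebra_simps)
  qed
  then show ?thesis
    using C by (intro exI[of _ "1 + C"] conjI exI[of _ g]) (auto simp: g_def)
qed

lemma dyadic_bracket:
  fixes W t :: real
  assumes "W > 0" "W < t"
  shows "\<exists>i::nat. 2 ^ i * W < t \<and> t \<le> 2 ^ (i + 1) * W"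
proof -
  obtain n :: nat where "t / W < 2 ^ n"
    using real_arch_pow[of 2 "t / W"] by auto
  then have ex: "t \<le> 2 ^ n * W"
    using assms by (simp add: field_simps)
  define k where "k = (LEAST k. t \<le> 2 ^ k * W)"
  have k: "t \<le> 2 ^ k * W"
    unfolding k_def using ex by (rule LeastI)
  have "k \<noteq> 0"
    using k assms by (cases "k = 0") auto
  then obtain i where i: "k = Suc i"
    using not0_implies_Suc by blast
  have "\<not> t \<le> 2 ^ i * W"
    using not_less_Least[of i "\<lambda>k. t \<le> 2 ^ k * W"] i by (simp add: k_def)
  then show ?thesis
    using k i by (intro exI[of _ i]) auto
qed

abbreviation reverse_hoelder :: "(real ^ 'n) set set \<Rightarrow> (real ^ 'n \<Rightarrow> real) \<Rightarrow> real \<Rightarrow> real \<Rightarrow> bool" where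
  "reverse_hoelder F w C e \<equiv> \<forall>Q\<in>F. (\<integral>\<^sup>+x\<in>Q. ennreal (w x powr (1 + e)) \<partial>lebesgue) \<le> ennreal (C * (mass w Q / vol Q) powr (1 + e) * vol Q)"

text \<open>Gehring-type improvement by dyadic layers: the i-th layer above the average W
  contributes at most a constant times (2^i W)^e 2^(-i s) w(Q), and e = s / 2 leaves a geometric
  series of ratio 2^(-e).\<close>

lemma ample_reverse_hoelder:
  fixes w :: "real ^ 'n \<Rightarrow> real"
  assumes w: "ample w"
  shows "\<exists>C>0. \<exists>e>0. reverse_hoelder hcubes w C e"
proof -
  note ww = ample_weight[OF w]
  have [measurable]: "w \<in> borel_measurable lebesgue" by (rule weight_measurable[OF ww])
  obtain C s where C: "C > 0" "s > 0" "upper_decay w C s"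
    using ample_upper_level[OF w] by auto
  define e where "e = s / 2"
  have e: "e > 0" using C by (simp add: e_def)
  define q where "q = (2::real) powr (- e)"
  have q: "0 < q" "q < 1"
    using e by (auto simp: q_def powr_less_one)
  define C' where "C' = 1 + C * 2 powr e / (1 - q)"
  have C': "C' > 0"
    using C q by (auto simp: C'_def intro!: add_pos_pos)
  have "(\<integral>\<^sup>+x\<in>Q. ennreal (w x powr (1 + e)) \<partial>lebesgue) \<le>
    ennreal (C' * (mass w Q / vol Q) powr (1 + e) * vol Q)" if Q: "Q \<in> hcubes" for Q
  proof -
    note Qs[measurable] = hcubes_sets[OF Q]
    define W where "W = mass w Q / vol Q"
    have W: "W > 0"
      using mass_hcubes_pos[OF ww Q] measure_hcubes_pos[OF Q] by (simp add: W_def)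
    define A where "A i = {x \<in> Q. 2 ^ i * mass w Q < w x * vol Q}" for i :: nat
    have A[measurable]: "A i \<in> sets lebesgue" for i
      unfolding A_def by (rule sets_Collect_less) auto
    have A_iff: "x \<in> A i \<longleftrightarrow> x \<in> Q \<and> 2 ^ i * W < w x" for x i
      using measure_hcubes_pos[OF Q] by (simp add: A_def W_def field_simps)
    define d where "d i = (2 ^ (i + 1) * W) powr e" for i :: nat
    \<comment> \<open>The layers are replaced by the full superlevel sets \<open>A i\<close>: for a
      point in the i-th layer the i-th term of the series alone is large enough.\<close>
    have pt: "ennreal (w x powr (1 + e)) * indicator Q x \<le>
        ennreal (W powr e) * (ennreal (w x) * indicator Q x) + (\<Sum>i. ennreal (d i) * (ennreal (w x) * indicator (A i) x))" for x
    proof (cases "x \<in> Q")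
      case True
      have wx: "0 \<le> w x" by (rule weight_nonneg[OF ww])
      show ?thesis
      proof (cases "w x \<le> W")
        case le: True
        have "w x powr (1 + e) \<le> W powr e * w x"
        proof (cases "w x = 0")
          case False
          then have "w x powr (1 + e) = w x powr e * w x"
            using wx by (simp add: powr_add)
          also have "\<dots> \<le> W powr e * w x"
            using wx le e by (intro mult_right_mono powr_mono2) auto
          finally show ?thesis .
        qed simp
        then have "ennreal (w x powr (1 + e)) \<le> ennreal (W powr e) * ennreal (w x)"
          using wx by (simp add: ennreal_mult'[symmetric] ennreal_leI)
        then show ?thesis
          using True by (simp add: add_increasing2)
      next
        case False
        then obtain i where i: "2 ^ i * W < w x" "w x \<le> 2 ^ (i + 1) * W"
          using dyadic_bracket[OF W, of "w x"] by auto
        have "w x powr (1 + e) = w x powr e * w x"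
          using False W by (simp add: powr_add)
        also have "\<dots> \<le> d i * w x"
          unfolding d_def using wx i(2) e by (intro mult_right_mono powr_mono2) auto
        finally have "ennreal (w x powr (1 + e)) \<le> ennreal (d i) * ennreal (w x)"
          using wx by (simp add: ennreal_mult'[symmetric] ennreal_leI d_def)
        also have "\<dots> = ennreal (d i) * (ennreal (w x) * indicator (A i) x)"
          using True i by (simp add: A_iff)
        also have "\<dots> = (\<Sum>j\<in>{i}. ennreal (d j) * (ennreal (w x) * indicator (A j) x))"
          by simp
        also have "\<dots> \<le> (\<Sum>j. ennreal (d j) * (ennreal (w x) * indicator (A j) x))"
          by (rule sum_le_suminf) auto
        finally show ?thesis
          using True by (simp add: add_increasing)
      qed
    qed simp
    have "(\<integral>\<^sup>+x\<in>Q. ennreal (w x powr (1 + e)) \<partial>lebesgue) \<le>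
      (\<integral>\<^sup>+x. ennreal (W powr e) * (ennreal (w x) * indicator Q x) + (\<Sum>i. ennreal (d i) * (ennreal (w x) * indicator (A i) x)) \<partial>lebesgue)"
      by (rule nn_integral_mono) (rule pt)
    also have "\<dots> = ennreal (W powr e) * (\<integral>\<^sup>+x\<in>Q. ennreal (w x) \<partial>lebesgue) + (\<Sum>i. ennreal (d i) * (\<integral>\<^sup>+x\<in>A i. ennreal (w x) \<partial>lebesgue))"
      by (subst nn_integral_add) (auto simp: nn_integral_cmult nn_integral_suminf)
    also have "\<dots> = ennreal (W powr e * mass w Q) + (\<Sum>i. ennreal (d i * mass w (A i)))"
    proof -
      have "bounded (A i)" for i
        using bounded_hcubes[OF Q] by (rule bounded_subset) (auto simp: A_def)
      then show ?thesis
        using bounded_hcubes[OF Q] by (simp add: nn_integral_mass[OF ww] ennreal_mult d_def)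
    qed
    also have "\<dots> \<le> ennreal (W powr e * mass w Q) + (\<Sum>i. ennreal ((C * 2 powr e * W powr e * mass w Q) * q ^ i))"
    proof (intro add_left_mono suminf_le ennreal_leI)
      fix i :: nat
      have "mass w (A i) \<le> C * (2 ^ i) powr (- s) * mass w Q"
        unfolding A_def by (rule C(3)[rule_format, OF Q]) simp
      then have "d i * mass w (A i) \<le> d i * (C * (2 ^ i) powr (- s) * mass w Q)"
        by (intro mult_left_mono) (auto simp: d_def)
      also have "\<dots> = (C * 2 powr e * W powr e * mass w Q) * q ^ i"
      proof -
        have "(2 ^ (i + 1)) powr e * (2 ^ i) powr (- s) = 2 powr e * (2 powr (- e)) powr (real i)"
          unfolding powr_realpow[symmetric, OF zero_less_numeral] powr_powr powr_add[symmetric]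
          by (simp add: e_def algebra_simps diff_divide_distrib)
        then show ?thesis
          using W by (simp add: d_def powr_mult q_def powr_realpow mult_ac)
      qed
      finally show "d i * mass w (A i) \<le> (C * 2 powr e * W powr e * mass w Q) * q ^ i" .
    qed auto
    also have "(\<Sum>i. ennreal ((C * 2 powr e * W powr e * mass w Q) * q ^ i)) = ennreal ((C * 2 powr e * W powr e * mass w Q) * (1 / (1 - q)))"
    proof (rule suminf_ennreal_eq)
      show "(\<lambda>i. (C * 2 powr e * W powr e * mass w Q) * q ^ i) sums ((C * 2 powr e * W powr e * mass w Q) * (1 / (1 - q)))"
        using q by (intro sums_mult geometric_sums) auto
    qed (use C q in auto)
    also have "ennreal (W powr e * mass w Q) + \<dots> = ennreal (W powr e * mass w Q + (C * 2 powr e * W powr e * mass w Q) * (1 / (1 - q)))"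
      using C q by (intro ennreal_plus[symmetric]) auto
    also have "W powr e * mass w Q + (C * 2 powr e * W powr e * mass w Q) * (1 / (1 - q)) = C' * W powr (1 + e) * vol Q"
    proof -
      have "mass w Q = W * vol Q"
        using measure_hcubes_pos[OF Q] by (simp add: W_def)
      then show ?thesis
        using W by (simp add: C'_def powr_add algebra_simps)
    qed
    finally show ?thesis
      by (simp add: W_def)
  qed
  then show ?thesis
    using C' e by blast
qed

section \<open>From the weight classes to ample weights\<close>

lemma hcube_of_cube:
  assumes "0 < d" and R: "R = cbox a (\<chi> i. a $ i + d)"
  shows "hcube a d \<in> hcubes" "hcube a d \<subseteq> R" "R - hcube a d \<in> null_sets lebesgue" "vol R = vol (hcube a d)"
proof -
  show "hcube a d \<in> hcubes" using assms(1) by (rule hcubesI)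
  show sub: "hcube a d \<subseteq> R" unfolding R by (rule hcube_subset_cbox)
  show null: "R - hcube a d \<in> null_sets lebesgue"
    using cbox_hcube_negligible[of a d] by (simp add: R negligible_iff_null_sets)
  have "R - (R - hcube a d) = hcube a d" using sub by blast
  then show "vol R = vol (hcube a d)"
    using measure_Diff_null_set[OF _ null, of R] by (simp add: R)
qed

text \<open>The weight classes are stated for closed cubes and the dyadic argument uses half-open
  ones; their conditions are carried over through the closure.\<close>

lemma cubes_of_hcubes:
  fixes Q :: "(real ^ 'n) set"
  assumes "Q \<in> hcubes"
  obtains R where "R \<in> cubes" "Q \<subseteq> R" "R - Q \<in> null_sets lebesgue" "R \<in> sets lebesgue" "bounded R" "vol R = vol Q"
proof -
  obtain a l where l: "0 < l" "Q = hcube a l"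
    using assms by (auto simp: hcubes_def)
  then show ?thesis
    using that[of "cbox a (\<chi> i. a $ i + l)"] hcube_of_cube[OF l(1) refl, of a] by (auto simp: cubes_def)
qed

text \<open>On a cube 1 is at most C w divided by the average of w; integration over G bounds |G| by
  the mass of G.\<close>

lemma ample_A_1:
  assumes "w \<in> A_1"
  shows "ample w"
  unfolding ample_def
proof (intro conjI allI impI)
  show ww: "weight w" using assms by (simp add: A_1_def)
  obtain C where C: "C > 0" "\<forall>Q\<in>cubes. AE x in lebesgue. x \<in> Q \<longrightarrow> average Q w \<le> C * w x"
    using assms by (auto simp: A_1_def)
  fix \<eta> :: real assume \<eta>: "\<eta> > 0"
  have "\<eta> / C * mass w Q \<le> mass w G"
    if Q: "Q \<in> hcubes" and G: "G \<in> sets lebesgue" "G \<subseteq> Q" "\<eta> * vol Q \<le> vol G" for Q G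
  proof -
    obtain R where R: "R \<in> cubes" "Q \<subseteq> R" "R \<in> sets lebesgue" "bounded R" "vol R = vol Q"
      using cubes_of_hcubes[OF Q] by metis
    have av: "average R w * vol Q = mass w R"
      using mass_eq_integral[OF ww R(4,3)] measure_hcubes_pos[OF Q] R(5) by (simp add: average_def)
    have bG: "bounded G" using bounded_subset[OF bounded_hcubes[OF Q] G(2)] .
    have apos: "average R w \<ge> 0"
      using mass_eq_integral[OF ww R(4,3)] mass_nonneg[of w R] by (simp add: average_def)
    show ?thesis
    proof (cases "average R w = 0")
      case True
      then show ?thesis
        using av mass_mono[OF ww R(4) hcubes_sets[OF Q] R(3,2)] mass_nonneg[of w Q] mass_nonneg[of w G] by simp
    next
      case False
      then have apos': "average R w > 0" using apos by simp
      have "mass (\<lambda>x. 1) G \<le> C / average R w * mass w G"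
      proof (rule mass_le_mass[OF weight_one ww bG G(1)])
        have "AE x in lebesgue. x \<in> R \<longrightarrow> average R w \<le> C * w x"
          using C R by blast
        then show "AE x in lebesgue. x \<in> G \<longrightarrow> 1 \<le> C / average R w * w x"
          by eventually_elim (use G R apos' in \<open>auto simp: field_simps\<close>)
      qed (use C apos' in auto)
      then have "average R w * vol G \<le> C * mass w G"
        using apos' by (simp add: mass_one field_simps)
      moreover have "average R w * (\<eta> * vol Q) \<le> average R w * vol G"
        using G(3) apos by (rule mult_left_mono)
      moreover have "\<eta> * mass w Q \<le> \<eta> * mass w R"
        using \<eta> mass_mono[OF ww R(4) hcubes_sets[OF Q] R(3,2)] by simp
      ultimately have "\<eta> * mass w Q \<le> C * mass w G"
        using av by (simp add: mult_ac)
      then show ?thesis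
        using C by (simp add: field_simps)
    qed
  qed
  then show "\<exists>c>0. large_subsets w \<eta> c"
    using \<eta> C by (intro exI[of _ "\<eta> / C"]) auto
qed

text \<open>Let W be the average of w over R. The function - ln(w / W) + w / W is positive, and its
  average is at most ln C + 1 by the hypothesis. It is at least K where w \<le> exp(-K) W, so by
  Chebyshev this set fills at most half of the fraction \<eta>, and the rest of G carries enough
  mass.\<close>

lemma ample_A_infinity:
  fixes w :: "real ^ 'n \<Rightarrow> real"
  assumes "w \<in> A_infinity"
  shows "ample w"
  unfolding ample_def
proof (intro conjI allI impI)
  show ww: "weight w" using assms by (simp add: A_infinity_def)
  have [measurable]: "w \<in> borel_measurable lebesgue" by (rule weight_measurable[OF ww])
  obtain C0 where C0: "\<And>Q. Q \<in> cubes \<Longrightarrow> set_integrable lebesgue Q (\<lambda>x. ln (1 / w x))"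
    "\<And>Q. Q \<in> cubes \<Longrightarrow> average Q w * exp (average Q (\<lambda>x. ln (1 / w x))) \<le> C0"
    using assms by (auto simp: A_infinity_def)
  \<comment> \<open>Makes \<open>ln C\<close> nonnegative, hence \<open>K\<close> below
    positive.\<close>
  define C where "C = max C0 1"
  fix \<eta> :: real assume \<eta>: "\<eta> > 0"
  define K where "K = 2 * (ln C + 1) / \<eta>"
  have K: "K > 0"
    using \<eta> by (auto simp: K_def C_def intro!: divide_pos_pos add_nonneg_pos)
  define \<alpha> where "\<alpha> = exp (- K)"
  have "\<alpha> * \<eta> / 2 * mass w Q \<le> mass w G"
    if Q: "Q \<in> hcubes" and G: "G \<in> sets lebesgue" "G \<subseteq> Q" "\<eta> * vol Q \<le> vol G" for Q G
  proof -
    obtain R where R: "R \<in> cubes" "Q \<subseteq> R" "R \<in> sets lebesgue" "bounded R" "vol R = vol Q"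
      using cubes_of_hcubes[OF Q] by metis
    note [measurable] = R(3) G(1)
    have mpos: "vol Q > 0" by (rule measure_hcubes_pos[OF Q])
    have QR: "mass w Q \<le> mass w R"
      by (rule mass_mono[OF ww R(4) hcubes_sets[OF Q] R(3,2)])
    have Rpos: "mass w R > 0"
      using QR mass_hcubes_pos[OF ww Q] by simp
    define W where "W = mass w R / vol Q"
    have W: "W > 0" using Rpos mpos by (simp add: W_def)
    have avW: "average R w = W"
      by (simp add: average_def W_def mass_eq_integral[OF ww R(4,3)] R(5))
    define l where "l = average R (\<lambda>x. ln (1 / w x))"
    have l: "ln W + l \<le> ln C"
    proof -
      have "W * exp l \<le> C"
        using C0(2)[OF R(1)] by (simp add: avW l_def C_def)
      then have "ln (W * exp l) \<le> ln C"
        using W by (intro ln_mono) (auto simp: C_def)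
      then show ?thesis
        using W by (simp add: ln_mult)
    qed
    define B where "B = {x \<in> R. w x \<le> \<alpha> * W}"
    have Bset[measurable]: "B \<in> sets lebesgue"
    proof -
      have "B = R - {x \<in> R. \<alpha> * W < w x}" by (auto simp: B_def)
      moreover have "{x \<in> R. \<alpha> * W < w x} \<in> sets lebesgue"
        by (rule sets_Collect_less) auto
      ultimately show ?thesis by auto
    qed
    have BR: "B \<subseteq> R" by (auto simp: B_def)
    have intB: "set_integrable lebesgue R (indicator B :: _ \<Rightarrow> real)"
      and mB: "vol B = (LINT x:R|lebesgue. indicator B x)"
    proof -
      have "set_integrable lebesgue R (\<lambda>x. 1 :: real)"
        by (rule weight_set_integrable[OF weight_one R(4,3)])
      then have "set_integrable lebesgue B (\<lambda>x. 1 :: real)"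
        by (rule set_integrable_subset) (use BR Bset in auto)
      then show "set_integrable lebesgue R (indicator B :: _ \<Rightarrow> real)"
        using BR by (simp add: set_integrable_def indicator_inter_arith[symmetric] inf.absorb2)
      have "mass (\<lambda>x. 1) B = (LINT x:B|lebesgue. 1)"
        by (rule mass_eq_integral[OF weight_one bounded_subset[OF R(4) BR] Bset])
      also have "\<dots> = (LINT x:R|lebesgue. indicator B x)"
        using BR by (simp add: set_lebesgue_integral_def indicator_inter_arith[symmetric] inf.absorb2)
      finally show "vol B = (LINT x:R|lebesgue. indicator B x)"
        by (simp add: mass_one)
    qed
    have int1: "set_integrable lebesgue R (\<lambda>x. ln W)"
      using weight_set_integrable[OF weight_one R(4,3)] set_integrable_mult_right[of "ln W" lebesgue R "\<lambda>x. 1"] by simp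
    have intw: "set_integrable lebesgue R (\<lambda>x. w x / W)"
      using weight_set_integrable[OF ww R(4,3)] by (simp add: set_integrable_divide)
    \<comment> \<open>Adding \<open>w x / W\<close> to the logarithm makes the integrand nonnegative
      by ln p \<le> p - 1, at the cost of 1 in the average.\<close>
    have "(LINT x:R|lebesgue. K * indicator B x) \<le> (LINT x:R|lebesgue. (ln W + ln (1 / w x)) + w x / W)"
    proof (rule set_integral_mono_AE)
      show "set_integrable lebesgue R (\<lambda>x. K * indicator B x)"
        using intB by (rule set_integrable_mult_right)
      show "set_integrable lebesgue R (\<lambda>x. (ln W + ln (1 / w x)) + w x / W)"
        using int1 C0(1)[OF R(1)] intw by (intro set_integral_add)
      have "AE x in lebesgue. 0 < w x" using ww by (simp add: weight_def)
      then show "AE x\<in>R in lebesgue. K * indicator B x \<le> (ln W + ln (1 / w x)) + w x / W"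
      proof (eventually_elim, intro impI)
        fix x assume wx: "0 < w x" "x \<in> R"
        have eq: "ln W + ln (1 / w x) = - ln (w x / W)"
          using wx W by (simp add: ln_div)
        have p: "w x / W > 0" using wx W by simp
        show "K * indicator B x \<le> (ln W + ln (1 / w x)) + w x / W"
        proof (cases "x \<in> B")
          case True
          then have "w x / W \<le> \<alpha>" using W by (simp add: B_def field_simps)
          then have "ln (w x / W) \<le> ln \<alpha>" using p by (intro ln_mono) (auto simp: \<alpha>_def)
          then have "ln (w x / W) \<le> - K" by (simp add: \<alpha>_def)
          then show ?thesis using eq p True by simp
        next
          case False
          then show ?thesis using eq ln_le_minus_one[OF p] by simp
        qed
      qed
    qed
    also have "(LINT x:R|lebesgue. (ln W + ln (1 / w x)) + w x / W) = (ln W + l + 1) * vol Q"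
    proof -
      have "(LINT x:R|lebesgue. (ln W + ln (1 / w x)) + w x / W)
        = (LINT x:R|lebesgue. ln W) + (LINT x:R|lebesgue. ln (1 / w x)) + (LINT x:R|lebesgue. w x / W)"
        using int1 C0(1)[OF R(1)] intw by (simp add: set_integral_add)
      also have "(LINT x:R|lebesgue. ln W) = ln W * vol Q"
        using mass_eq_integral[OF weight_one R(4,3)] set_integral_mult_right[where A = R and M = lebesgue and a = "ln W" and f = "\<lambda>x. 1"]
        by (simp add: mass_one R(5))
      also have "(LINT x:R|lebesgue. ln (1 / w x)) = l * vol Q"
        using mpos by (simp add: l_def average_def R(5))
      also have "(LINT x:R|lebesgue. w x / W) = vol Q"
        using W mpos Rpos by (simp add: mass_eq_integral[OF ww R(4,3), symmetric] W_def)
      finally show ?thesis by (simp add: algebra_simps)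
    qed
    also have "\<dots> \<le> (ln C + 1) * vol Q"
      using l mpos by (intro mult_right_mono) auto
    also have "(LINT x:R|lebesgue. K * indicator B x) = K * vol B"
      by (simp add: mB)
    also have "ln C + 1 = K * (\<eta> / 2)"
      using \<eta> by (simp add: K_def)
    finally have "K * vol B \<le> K * (\<eta> / 2 * vol Q)"
      by (simp only: mult.assoc)
    then have B: "vol B \<le> \<eta> / 2 * vol Q"
      using K by simp
    have bd: "bounded X" if "X \<subseteq> R" for X using bounded_subset[OF R(4) that] .
    have "vol G \<le> vol (G - B) + vol B"
    proof -
      have "mass (\<lambda>x. 1) G \<le> mass (\<lambda>x. 1) ((G - B) \<union> B)"
        using G R BR by (intro mass_mono[OF weight_one bd]) auto
      also have "\<dots> \<le> mass (\<lambda>x. 1) (G - B) + mass (\<lambda>x. 1) B"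
        using G R BR by (intro mass_Un_le[OF weight_one bd bd]) auto
      finally show ?thesis by (simp add: mass_one)
    qed
    then have GB: "\<eta> / 2 * vol Q \<le> vol (G - B)"
      using B G(3) by simp
    have "mass (\<lambda>x. 1) (G - B) \<le> 1 / (\<alpha> * W) * mass w (G - B)"
    proof (rule mass_le_mass[OF weight_one ww bd])
      have "1 \<le> 1 / (\<alpha> * W) * w x" if "x \<in> G - B" for x
        using that G R W by (auto simp: B_def \<alpha>_def field_simps)
      then show "AE x in lebesgue. x \<in> G - B \<longrightarrow> 1 \<le> 1 / (\<alpha> * W) * w x" by simp
    qed (use G R W in \<open>auto simp: \<alpha>_def\<close>)
    then have "\<alpha> * W * vol (G - B) \<le> mass w (G - B)"
      using W by (simp add: mass_one \<alpha>_def field_simps)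
    also have "\<dots> \<le> mass w G"
      using G R by (intro mass_mono[OF ww bd]) auto
    finally have 1: "\<alpha> * W * vol (G - B) \<le> mass w G" .
    have "\<alpha> * \<eta> / 2 * mass w Q \<le> \<alpha> * \<eta> / 2 * mass w R"
      using QR \<eta> by (intro mult_left_mono) (auto simp: \<alpha>_def)
    also have "\<dots> = \<alpha> * W * (\<eta> / 2 * vol Q)"
      using mpos by (simp add: W_def)
    also have "\<dots> \<le> \<alpha> * W * vol (G - B)"
      using GB W by (intro mult_left_mono) (auto simp: \<alpha>_def)
    finally show ?thesis using 1 by linarith
  qed
  then show "\<exists>c>0. large_subsets w \<eta> c"
    using \<eta> by (intro exI[of _ "\<alpha> * \<eta> / 2"]) (auto simp: \<alpha>_def)
qed

subsection \<open>Packing of dyadic families\<close>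

lemma sum_power_le_geometric:
  fixes q :: real
  assumes "0 < q" "q < 1" "finite N"
  shows "(\<Sum>k\<in>N. q ^ k) \<le> 1 / (1 - q)"
proof -
  have "(\<Sum>k\<in>N. q ^ k) \<le> (\<Sum>k. q ^ k)"
    using assms by (intro sum_le_suminf summable_geometric) auto
  then show ?thesis
    using assms by (simp add: suminf_geometric)
qed

lemma sum_int_geometric:
  fixes q :: real and M :: "int set"
  assumes q: "0 < q" "q < 1" and M: "finite M"
  shows "(\<Sum>m\<in>M. q ^ nat \<bar>m - p\<bar>) \<le> 2 / (1 - q)"
proof -
  have half: "(\<Sum>m\<in>A. q ^ nat \<bar>m - p\<bar>) \<le> 1 / (1 - q)" if A: "finite A" "inj_on (\<lambda>m. nat \<bar>m - p\<bar>) A" for A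
    using sum_power_le_geometric[OF q finite_imageI[OF A(1), of "\<lambda>m. nat \<bar>m - p\<bar>"]] sum.reindex[OF A(2), of "\<lambda>k. q ^ k"]
    by simp
  have "(\<Sum>m\<in>M. q ^ nat \<bar>m - p\<bar>) = (\<Sum>m\<in>{m\<in>M. m \<ge> p}. q ^ nat \<bar>m - p\<bar>) + (\<Sum>m\<in>{m\<in>M. m < p}. q ^ nat \<bar>m - p\<bar>)"
    using M by (subst sum.union_disjoint[symmetric]) (auto intro!: sum.cong)
  also have "\<dots> \<le> 1 / (1 - q) + 1 / (1 - q)"
    using M by (intro add_mono half) (auto intro!: inj_onI)
  finally show ?thesis by simp
qed

definition level :: "(real ^ 'n \<Rightarrow> real) \<Rightarrow> (real ^ 'n) set \<Rightarrow> int" where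
  "level w Q = \<lfloor>log 2 (mass w Q / vol Q)\<rfloor>"

lemma floor_log2_bounds:
  assumes "t > 0"
  shows "2 powr \<lfloor>log 2 t\<rfloor> \<le> t" "t < 2 powr (\<lfloor>log 2 t\<rfloor> + 1)"
  using assms by (auto simp: le_log_iff[symmetric] log_less_iff[symmetric] less_log_iff powr_le_iff)

lemma level_bounds:
  assumes "weight w" "Q \<in> hcubes"
  shows "2 powr level w Q * vol Q \<le> mass w Q"
    "mass w Q < 2 powr (level w Q + 1) * vol Q"
  using floor_log2_bounds[of "mass w Q / vol Q"] mass_hcubes_pos[OF assms] measure_hcubes_pos[OF assms(2)]
  by (auto simp: level_def field_simps)

abbreviation separated :: "(real ^ 'n \<Rightarrow> real) \<Rightarrow> (real ^ 'n) set set \<Rightarrow> bool" where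
  "separated w S \<equiv> \<forall>A\<in>S. \<forall>B\<in>S. A \<noteq> B \<longrightarrow> level w A = level w B \<longrightarrow> A \<inter> B = {}"

text \<open>The Carleson condition for the measure \<open>w dx\<close>.\<close>

abbreviation packing :: "(real ^ 'n \<Rightarrow> real) \<Rightarrow> real \<Rightarrow> bool" where
  "packing w C \<equiv>
    \<forall>S P. finite S \<longrightarrow> S \<subseteq> hcubes \<longrightarrow> separated w S \<longrightarrow>
    P \<in> hcubes \<longrightarrow> (\<forall>Q\<in>S. Q \<subseteq> P) \<longrightarrow>
    (\<Sum>Q\<in>S. mass w Q) \<le> C * mass w P"

text \<open>The cubes of one level m inside P are disjoint. If m is below the level p of P, they
  have little mass because their averages are small. If m is above p, their large averages force
  small total volume, and \<open>power_bounded\<close> turns this into small mass. Both cases decay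
  geometrically in |m - p|.\<close>

lemma carleson_packing:
  fixes w :: "real ^ 'n \<Rightarrow> real"
  assumes w: "ample w"
  shows "\<exists>C>0. packing w C"
proof -
  note ww = ample_weight[OF w]
  obtain C g where C: "C > 0" "g > 0" "power_bounded w C g"
    using ample_power[OF w] by auto
  \<comment> \<open>One rate for both cases: low levels decay with exponent 1, high levels with
    exponent \<open>g\<close>.\<close>
  define g' where "g' = min 1 g"
  have g': "g' > 0" "g' \<le> 1" "g' \<le> g" using C by (auto simp: g'_def)
  define q where "q = (2::real) powr (- g')"
  have q: "0 < q" "q < 1" using g' by (auto simp: q_def powr_less_one)
  define C0 where "C0 = 2 + C * 2 powr g"
  have C0: "C0 > 0" using C by (auto simp: C0_def intro!: add_pos_pos)
  have "(\<Sum>Q\<in>S. mass w Q) \<le> C0 * (2 / (1 - q)) * mass w P"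
    if S: "finite S" "S \<subseteq> hcubes" and disj: "separated w S"
      and P: "P \<in> hcubes" and SP: "\<forall>Q\<in>S. Q \<subseteq> P" for S and P :: "(real ^ 'n) set"
  proof -
    define p where "p = level w P"
    have mP: "vol P > 0" by (rule measure_hcubes_pos[OF P])
    have main: "(\<Sum>Q\<in>{Q\<in>S. level w Q = m}. mass w Q) \<le> C0 * q ^ nat \<bar>m - p\<bar> * mass w P" for m
    proof -
      define T where "T = {Q\<in>S. level w Q = m}"
      have T: "finite T" "T \<subseteq> S" using S by (auto simp: T_def)
      have Tb: "bounded A" "A \<in> sets lebesgue" if "A \<in> T" for A
        using that T S by (auto intro: bounded_hcubes hcubes_sets)
      have Td: "pairwise disjnt T"
        using disj by (auto simp: T_def pairwise_def disjnt_def)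
      have Ts: "\<Union>T \<in> sets lebesgue" using T(1) Tb by blast
      have TP: "\<Union>T \<subseteq> P" using T SP by blast
      have sum_w: "(\<Sum>Q\<in>T. mass w Q) = mass w (\<Union>T)"
        by (rule mass_Union_disjoint[OF ww T(1) Tb Td, symmetric])
      have sum_1: "(\<Sum>Q\<in>T. vol Q) = vol (\<Union>T)"
        using mass_Union_disjoint[OF weight_one T(1) Tb Td] by (simp add: mass_one)
      have lT: "2 powr m * vol Q \<le> mass w Q" "mass w Q \<le> 2 powr (m + 1) * vol Q" if "Q \<in> T" for Q
        using level_bounds[OF ww, of Q] that S by (auto simp: T_def intro: less_imp_le)
      have TP1: "vol (\<Union>T) \<le> vol P"
        using TP Ts by (intro measure_mono_fmeasurable hcubes_lmeasurable[OF P])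
      have TPw: "mass w (\<Union>T) \<le> mass w P"
        using TP Ts hcubes_sets[OF P] by (intro mass_mono[OF ww bounded_hcubes[OF P]])
      have pow: "q ^ nat \<bar>m - p\<bar> = 2 powr (- g' * \<bar>m - p\<bar>)"
        by (simp add: q_def powr_realpow[symmetric] powr_powr del: powr_realpow)
      have "mass w (\<Union>T) \<le> C0 * q ^ nat \<bar>m - p\<bar> * mass w P"
      proof (cases "m \<le> p")
        case True
        have "mass w (\<Union>T) \<le> 2 powr (m + 1) * vol (\<Union>T)"
          unfolding sum_w[symmetric] sum_1[symmetric] sum_distrib_left using lT by (intro sum_mono) auto
        also have "\<dots> \<le> 2 powr (m + 1) * vol P"
          using TP1 by (intro mult_left_mono) auto
        also have "\<dots> = 2 * 2 powr (- \<bar>m - p\<bar>) * (2 powr p * vol P)"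
          using True by (simp add: powr_add powr_diff powr_minus field_simps)
        also have "\<dots> \<le> 2 * 2 powr (- \<bar>m - p\<bar>) * mass w P"
          using level_bounds(1)[OF ww P] by (intro mult_left_mono) (auto simp: p_def)
        also have "\<dots> \<le> C0 * q ^ nat \<bar>m - p\<bar> * mass w P"
        proof (intro mult_right_mono mult_mono)
          show "2 powr (- \<bar>m - p\<bar>) \<le> q ^ nat \<bar>m - p\<bar>"
            unfolding pow using g' mult_right_mono[of g' 1 "real_of_int \<bar>m - p\<bar>"] by (intro powr_mono) auto
        qed (use C in \<open>auto simp: C0_def\<close>)
        finally show ?thesis .
      next
        case False
        have "2 powr m * vol (\<Union>T) \<le> mass w (\<Union>T)"
          unfolding sum_w[symmetric] sum_1[symmetric] sum_distrib_left using lT by (intro sum_mono) auto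
        also have "\<dots> \<le> 2 powr (p + 1) * vol P"
          using TPw level_bounds(2)[OF ww P] by (simp add: p_def)
        finally have "vol (\<Union>T) / vol P \<le> 2 powr (p + 1) / 2 powr m"
          using mP by (simp add: field_simps)
        also have "\<dots> = 2 powr (1 - \<bar>m - p\<bar>)"
          using False by (simp add: powr_diff powr_add)
        finally have r: "vol (\<Union>T) / vol P \<le> 2 powr (1 - \<bar>m - p\<bar>)" .
        have "mass w (\<Union>T) \<le> C * (vol (\<Union>T) / vol P) powr g * mass w P"
          using C(3) P Ts TP by blast
        also have "\<dots> \<le> C * (2 powr (1 - \<bar>m - p\<bar>)) powr g * mass w P"
          using r C by (intro mult_right_mono mult_left_mono powr_mono2) auto
        also have "((2::real) powr (1 - \<bar>m - p\<bar>)) powr g = 2 powr g * 2 powr (- g * \<bar>m - p\<bar>)"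
          by (simp add: powr_powr powr_add[symmetric] algebra_simps)
        also have "C * (2 powr g * 2 powr (- g * \<bar>m - p\<bar>)) * mass w P \<le> C0 * q ^ nat \<bar>m - p\<bar> * mass w P"
        proof -
          have "2 powr (- g * \<bar>m - p\<bar>) \<le> q ^ nat \<bar>m - p\<bar>"
            unfolding pow using g' mult_right_mono[of g' g "real_of_int \<bar>m - p\<bar>"] by (intro powr_mono) auto
          then have "(C * 2 powr g) * 2 powr (- g * \<bar>m - p\<bar>) \<le> C0 * q ^ nat \<bar>m - p\<bar>"
            using C by (intro mult_mono) (auto simp: C0_def)
          then show ?thesis
            by (intro mult_right_mono) (auto simp: mult_ac)
        qed
        finally show ?thesis .
      qed
      then show ?thesis
        using sum_w by (simp add: T_def)
    qed
    have "(\<Sum>Q\<in>S. mass w Q) = (\<Sum>m\<in>level w ` S. \<Sum>Q\<in>{Q\<in>S. level w Q = m}. mass w Q)"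
      using S by (intro sum.image_gen)
    also have "\<dots> \<le> (\<Sum>m\<in>level w ` S. C0 * q ^ nat \<bar>m - p\<bar> * mass w P)"
      by (intro sum_mono main)
    also have "\<dots> = C0 * (\<Sum>m\<in>level w ` S. q ^ nat \<bar>m - p\<bar>) * mass w P"
      by (simp add: sum_distrib_left sum_distrib_right)
    also have "\<dots> \<le> C0 * (2 / (1 - q)) * mass w P"
      using sum_int_geometric[OF q, of "level w ` S" p] S C0 by (intro mult_right_mono mult_left_mono) auto
    finally show ?thesis .
  qed
  then show ?thesis
    using C0 q by (intro exI[of _ "C0 * (2 / (1 - q))"]) auto
qed

text \<open>Layer-cake summation; the induction peels off the smallest positive value of \<open>c\<close>.\<close>

lemma layer_cake_finite:
  fixes c a :: "'a set \<Rightarrow> real" and g :: "'a \<Rightarrow> real"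
  assumes S: "finite S" "S \<subseteq> sets M" and a: "\<And>Q. Q \<in> S \<Longrightarrow> 0 \<le> a Q"
    and le: "\<And>T. T \<subseteq> S \<Longrightarrow> ennreal (\<Sum>Q\<in>T. a Q) \<le> emeasure M (\<Union>T)"
    and c: "\<And>Q. Q \<in> S \<Longrightarrow> 0 \<le> c Q"
    and g: "g \<in> borel_measurable M" "AE x in M. \<forall>Q\<in>S. x \<in> Q \<longrightarrow> c Q \<le> g x"
  shows "ennreal (\<Sum>Q\<in>S. c Q * a Q) \<le> (\<integral>\<^sup>+x. ennreal (g x) \<partial>M)"
  using c g
proof (induction "card {Q\<in>S. 0 < c Q}" arbitrary: c g rule: less_induct)
  case less
  define T where "T = {Q\<in>S. 0 < c Q}"
  have T: "finite T" "T \<subseteq> S" using S by (auto simp: T_def)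
  have sumT: "(\<Sum>Q\<in>S. c Q * a Q) = (\<Sum>Q\<in>T. c Q * a Q)"
    using S less.prems(1) by (intro sum.mono_neutral_right) (auto simp: T_def less_le)
  show ?case
  proof (cases "T = {}")
    case True
    then show ?thesis using sumT by simp
  next
    case False
    define v where "v = Min (c ` T)"
    have vle: "v \<le> c Q" if "Q \<in> T" for Q
      using T that by (simp add: v_def)
    have "v \<in> c ` T"
      unfolding v_def using False T by (intro Min_in) auto
    then obtain Q0 where Q0: "Q0 \<in> T" "c Q0 = v" by auto
    have v: "v > 0" using Q0 by (auto simp: T_def)
    \<comment> \<open>Lowering \<open>c\<close> by \<open>v\<close> on \<open>T\<close> and
      \<open>g\<close> by \<open>v\<close> on \<open>\<Union>T\<close> preserves the domination and
      makes \<open>c\<close> vanish where it was minimal. The two sides drop by quantities that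
      \<open>le\<close> compares.\<close>
    define c' where "c' Q = (if Q \<in> T then c Q - v else 0)" for Q
    define g' where "g' x = g x - v * indicator (\<Union>T) x" for x
    have UT: "\<Union>T \<in> sets M" using T S by blast
    note [measurable] = UT less.prems(2)
    have g'm: "g' \<in> borel_measurable M"
      unfolding g'_def by measurable
    have "ennreal (\<Sum>Q\<in>S. c' Q * a Q) \<le> (\<integral>\<^sup>+x. ennreal (g' x) \<partial>M)"
    proof (rule less.hyps)
      have "{Q\<in>S. 0 < c' Q} \<subseteq> T - {Q0}"
        using Q0 by (auto simp: c'_def split: if_splits)
      then show "card {Q\<in>S. 0 < c' Q} < card {Q\<in>S. 0 < c Q}"
        unfolding T_def[symmetric] using T(1) Q0(1)
        by (intro psubset_card_mono) auto
      show "0 \<le> c' Q" for Q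
        using vle by (auto simp: c'_def)
      show "g' \<in> borel_measurable M" by (rule g'm)
      show "AE x in M. \<forall>Q\<in>S. x \<in> Q \<longrightarrow> c' Q \<le> g' x"
        using less.prems(3)
      proof (eventually_elim, intro ballI impI)
        fix x Q assume x: "\<forall>Q\<in>S. x \<in> Q \<longrightarrow> c Q \<le> g x" "Q \<in> S" "x \<in> Q"
        show "c' Q \<le> g' x"
        proof (cases "x \<in> \<Union>T")
          case True
          then obtain R where R: "R \<in> T" "x \<in> R" by blast
          then have "v \<le> g x" using vle[OF R(1)] x(1) T(2) by force
          then show ?thesis using True x by (auto simp: c'_def g'_def)
        next
          case False
          then have "Q \<notin> T" using x by blast
          then show ?thesis using False x less.prems(1)[of Q] by (force simp: c'_def g'_def)
        qed
      qed
    qed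
    moreover have "ennreal v * ennreal (\<Sum>Q\<in>T. a Q) \<le> ennreal v * emeasure M (\<Union>T)"
      by (intro mult_left_mono le T(2)) auto
    ultimately have "ennreal (\<Sum>Q\<in>S. c' Q * a Q) + ennreal v * ennreal (\<Sum>Q\<in>T. a Q)
        \<le> (\<integral>\<^sup>+x. ennreal (g' x) \<partial>M) + ennreal v * emeasure M (\<Union>T)"
      by (rule add_mono)
    also have "(\<integral>\<^sup>+x. ennreal (g' x) \<partial>M) + ennreal v * emeasure M (\<Union>T) = (\<integral>\<^sup>+x. ennreal (g' x) + ennreal v * indicator (\<Union>T) x \<partial>M)"
      using g'm UT by (subst nn_integral_add) (auto simp: nn_integral_cmult_indicator)
    also have "\<dots> = (\<integral>\<^sup>+x. ennreal (g x) \<partial>M)"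
    proof (rule nn_integral_cong_AE)
      show "AE x in M. ennreal (g' x) + ennreal v * indicator (\<Union>T) x = ennreal (g x)"
        using less.prems(3)
      proof eventually_elim
        fix x assume x: "\<forall>Q\<in>S. x \<in> Q \<longrightarrow> c Q \<le> g x"
        show "ennreal (g' x) + ennreal v * indicator (\<Union>T) x = ennreal (g x)"
        proof (cases "x \<in> \<Union>T")
          case True
          then obtain R where R: "R \<in> T" "x \<in> R" by blast
          then have "v \<le> g x" using vle[OF R(1)] x(1) T(2) by force
          then show ?thesis using True v by (simp add: g'_def ennreal_plus[symmetric] del: ennreal_plus)
        qed (simp add: g'_def)
      qed
    qed
    also have "ennreal (\<Sum>Q\<in>S. c' Q * a Q) + ennreal v * ennreal (\<Sum>Q\<in>T. a Q) = ennreal (\<Sum>Q\<in>S. c Q * a Q)"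
    proof -
      have "(\<Sum>Q\<in>S. c' Q * a Q) = (\<Sum>Q\<in>T. (c Q - v) * a Q)"
        using T S by (intro sum.mono_neutral_cong_right) (auto simp: c'_def)
      also have "\<dots> = (\<Sum>Q\<in>S. c Q * a Q) - v * (\<Sum>Q\<in>T. a Q)"
        by (simp add: sumT left_diff_distrib sum_subtractf sum_distrib_left)
      finally have eq: "(\<Sum>Q\<in>S. c' Q * a Q) + v * (\<Sum>Q\<in>T. a Q) = (\<Sum>Q\<in>S. c Q * a Q)" by simp
      have n1: "0 \<le> (\<Sum>Q\<in>S. c' Q * a Q)"
        using a vle by (intro sum_nonneg mult_nonneg_nonneg) (auto simp: c'_def)
      have n2: "0 \<le> (\<Sum>Q\<in>T. a Q)"
        using a T by (intro sum_nonneg) auto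
      show ?thesis
        using n1 n2 v by (simp add: ennreal_mult[symmetric] ennreal_plus[symmetric] eq del: ennreal_plus)
    qed
    finally show ?thesis .
  qed
qed

lemma A_1_hcubes:
  assumes "u \<in> A_1"
  shows "\<exists>C>0. \<forall>Q\<in>hcubes. AE x in lebesgue. x \<in> Q \<longrightarrow> mass u Q / vol Q \<le> C * u x"
proof -
  have uw: "weight u" using assms by (simp add: A_1_def)
  obtain C where C: "C > 0" "\<forall>Q\<in>cubes. AE x in lebesgue. x \<in> Q \<longrightarrow> average Q u \<le> C * u x"
    using assms by (auto simp: A_1_def)
  have "AE x in lebesgue. x \<in> Q \<longrightarrow> mass u Q / vol Q \<le> C * u x" if Q: "Q \<in> hcubes" for Q
  proof -
    obtain R where R: "R \<in> cubes" "Q \<subseteq> R" "R \<in> sets lebesgue" "bounded R" "vol R = vol Q"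
      using cubes_of_hcubes[OF Q] by metis
    have "mass u Q \<le> mass u R"
      by (rule mass_mono[OF uw R(4) hcubes_sets[OF Q] R(3,2)])
    then have "mass u Q / vol Q \<le> average R u"
      using measure_hcubes_pos[OF Q] R(5) by (simp add: average_def mass_eq_integral[OF uw R(4,3)] divide_right_mono)
    moreover have "AE x in lebesgue. x \<in> R \<longrightarrow> average R u \<le> C * u x" using C R by blast
    ultimately show ?thesis
      using R(2) by (auto elim!: eventually_mono)
  qed
  then show ?thesis using C by blast
qed

abbreviation nnint :: "(real ^ 'n) set \<Rightarrow> (real ^ 'n \<Rightarrow> ennreal) \<Rightarrow> ennreal" where
  "nnint A H \<equiv> \<integral>\<^sup>+x\<in>A. H x \<partial>lebesgue"

abbreviation pairing :: "(real ^ 'n \<Rightarrow> real) \<Rightarrow> (real ^ 'n \<Rightarrow> ennreal) \<Rightarrow> ennreal" where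
  "pairing u H \<equiv> \<integral>\<^sup>+x. ennreal (u x) * H x \<partial>lebesgue"

abbreviation stopping_sums :: "(real ^ 'n \<Rightarrow> real) \<Rightarrow> (real ^ 'n \<Rightarrow> real) \<Rightarrow> real \<Rightarrow> bool" where
  "stopping_sums u w C \<equiv>
    \<forall>S H \<rho>. finite S \<longrightarrow> S \<subseteq> hcubes \<longrightarrow> laminar S \<longrightarrow>
    separated w S \<longrightarrow> H \<in> borel_measurable lebesgue \<longrightarrow> \<rho> > 0 \<longrightarrow>
    (\<forall>Q\<in>S. ennreal (\<rho> * mass w Q) \<le> (nnint Q H)) \<longrightarrow>
    ennreal (\<Sum>Q\<in>S. mass u Q / vol Q * mass w Q) \<le> ennreal (C / \<rho>) * pairing u H"

text \<open>Let M have density (C3 / \<rho>) H. The hypothesis reads C3 w(P) \<le> M(P), so packing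
  inside the disjoint maximal cubes bounds the total w-mass of every subfamily by the M-measure of
  its union. Layer-cake summation applies with the averages of u as heights, which
  \<open>A_1\<close> bounds by a multiple of u(x).\<close>

lemma stopping_family_bound:
  fixes u w :: "real ^ 'n \<Rightarrow> real"
  assumes u: "u \<in> A_1" and w: "ample w"
  shows "\<exists>C>0. stopping_sums u w C"
proof -
  note ww = ample_weight[OF w]
  have uw: "weight u" using u by (simp add: A_1_def)
  have [measurable]: "u \<in> borel_measurable lebesgue" by (rule weight_measurable[OF uw])
  obtain C2 where C2: "C2 > 0" "\<forall>Q\<in>hcubes. AE x in lebesgue. x \<in> Q \<longrightarrow> mass u Q / vol Q \<le> C2 * u x"
    using A_1_hcubes[OF u] by auto
  obtain C3 where C3: "C3 > 0" "packing w C3"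
    using carleson_packing[OF w] by auto
  have "ennreal (\<Sum>Q\<in>S. mass u Q / vol Q * mass w Q) \<le> ennreal (C2 * C3 / \<rho>) * pairing u H"
    if S: "finite S" "S \<subseteq> hcubes" "laminar S"
      and disj: "separated w S"
      and H[measurable]: "H \<in> borel_measurable lebesgue" and rho: "\<rho> > 0"
      and ge: "\<forall>Q\<in>S. ennreal (\<rho> * mass w Q) \<le> (nnint Q H)" for S H \<rho>
  proof -
    define M where "M = density lebesgue (\<lambda>x. ennreal (C3 / \<rho>) * H x)"
    have setsM: "sets M = sets lebesgue" by (simp add: M_def)
    have emM: "ennreal (C3 * mass w P) \<le> emeasure M P" if "P \<in> S" for P
    proof -
      have Ps: "P \<in> sets lebesgue" using that S hcubes_sets by blast
      have "ennreal (C3 * mass w P) = ennreal (C3 / \<rho>) * ennreal (\<rho> * mass w P)"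
        using C3 rho by (simp add: ennreal_mult[symmetric])
      also have "\<dots> \<le> ennreal (C3 / \<rho>) * (nnint P H)"
        using ge that by (intro mult_left_mono) auto
      also have "\<dots> = emeasure M P"
        unfolding M_def using Ps by (subst emeasure_density) (auto simp: nn_integral_cmult[symmetric] mult.assoc)
      finally show ?thesis .
    qed
    have "ennreal (\<Sum>Q\<in>S. mass u Q / vol Q * mass w Q) \<le> (\<integral>\<^sup>+x. ennreal (C2 * u x) \<partial>M)"
    proof (rule layer_cake_finite)
      show "S \<subseteq> sets M" using S hcubes_sets setsM by blast
      show "ennreal (\<Sum>Q\<in>T. mass w Q) \<le> emeasure M (\<Union>T)" if TS: "T \<subseteq> S" for T
      proof -
        have T: "finite T" "laminar T" using TS S finite_subset laminar_subset by blast+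
        have Ms: "maximals T \<subseteq> S" "finite (maximals T)" using maximals_subset[of T] TS T finite_subset by blast+
        \<comment> \<open>Attaching each cube to one maximal cube above it splits the sum into
          families to which packing applies separately.\<close>
        have "\<forall>Q\<in>T. \<exists>P\<in>maximals T. Q \<subseteq> P"
          using ex_maximals_superset[OF T(1)] by metis
        then obtain top where top: "\<And>Q. Q \<in> T \<Longrightarrow> top Q \<in> maximals T" "\<And>Q. Q \<in> T \<Longrightarrow> Q \<subseteq> top Q"
          by metis
        have "(\<Sum>Q\<in>T. mass w Q) = (\<Sum>P\<in>maximals T. \<Sum>Q\<in>{Q\<in>T. top Q = P}. mass w Q)"
          using T(1) Ms(2) top(1) by (intro sum.group[symmetric]) auto
        also have "\<dots> \<le> (\<Sum>P\<in>maximals T. C3 * mass w P)"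
        proof (rule sum_mono)
          fix P assume P: "P \<in> maximals T"
          have "{Q\<in>T. top Q = P} \<subseteq> S" using TS by blast
          then show "(\<Sum>Q\<in>{Q\<in>T. top Q = P}. mass w Q) \<le> C3 * mass w P"
          proof (intro C3(2)[rule_format])
            show "{Q\<in>T. top Q = P} \<subseteq> hcubes" "P \<in> hcubes"
              using P Ms TS S(2) by blast+
            show "A \<inter> B = {}"
              if "A \<in> {Q\<in>T. top Q = P}" "B \<in> {Q\<in>T. top Q = P}" "A \<noteq> B" "level w A = level w B" for A B
              using that TS disj by blast
            show "Q \<subseteq> P" if "Q \<in> {Q\<in>T. top Q = P}" for Q
              using that top(2) by auto
          qed (use T in auto)
        qed
        finally have "ennreal (\<Sum>Q\<in>T. mass w Q) \<le> ennreal (\<Sum>P\<in>maximals T. C3 * mass w P)"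
          by (rule ennreal_leI)
        also have "\<dots> = (\<Sum>P\<in>maximals T. ennreal (C3 * mass w P))"
          using C3(1) by (subst sum_ennreal) auto
        also have "\<dots> \<le> (\<Sum>P\<in>maximals T. emeasure M P)"
          using Ms emM by (intro sum_mono) blast
        also have "\<dots> = emeasure M (\<Union>P\<in>maximals T. P)"
        proof (rule sum_emeasure)
          show "(\<lambda>P. P) ` maximals T \<subseteq> sets M" using Ms S hcubes_sets setsM by auto
          show "disjoint_family_on (\<lambda>P. P) (maximals T)"
            using disjoint_maximals[OF T(2)] by (auto simp: disjoint_family_on_def pairwise_def disjnt_def)
        qed (rule Ms)
        also have "(\<Union>P\<in>maximals T. P) = \<Union>T"
          using Union_maximals[OF T(1)] by simp
        finally show ?thesis .
      qed
      show "(\<lambda>x. C2 * u x) \<in> borel_measurable M"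
        by (simp add: M_def)
      have "AE x in lebesgue. \<forall>Q\<in>S. x \<in> Q \<longrightarrow> mass u Q / vol Q \<le> C2 * u x"
        using S C2(2) by (intro AE_finite_allI) auto
      then show "AE x in M. \<forall>Q\<in>S. x \<in> Q \<longrightarrow> mass u Q / vol Q \<le> C2 * u x"
        unfolding M_def by (subst AE_density) (auto elim!: eventually_mono)
    qed (use S in auto)
    also have "\<dots> = (\<integral>\<^sup>+x. ennreal (C3 / \<rho>) * H x * ennreal (C2 * u x) \<partial>lebesgue)"
      unfolding M_def by (subst nn_integral_density) auto
    also have "\<dots> = (\<integral>\<^sup>+x. ennreal (C2 * C3 / \<rho>) * (ennreal (u x) * H x) \<partial>lebesgue)"
    proof (rule nn_integral_cong)
      fix x
      have "ennreal (C2 * u x) = ennreal C2 * ennreal (u x)" "ennreal (C2 * C3 / \<rho>) = ennreal (C3 / \<rho>) * ennreal C2"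
        using C2(1) C3(1) rho weight_nonneg[OF uw, of x] by (auto simp: ennreal_mult[symmetric])
      then show "ennreal (C3 / \<rho>) * H x * ennreal (C2 * u x) = ennreal (C2 * C3 / \<rho>) * (ennreal (u x) * H x)"
        by (simp add: mult_ac)
    qed
    also have "\<dots> = ennreal (C2 * C3 / \<rho>) * pairing u H"
      by (rule nn_integral_cmult) auto
    finally show ?thesis .
  qed
  then show ?thesis
    using C2(1) C3(1) by (intro exI[of _ "C2 * C3"]) auto
qed

section \<open>The part of a cube on which the weight has a prescribed dyadic size\<close>

definition slab :: "(real ^ 'n \<Rightarrow> real) \<Rightarrow> int \<Rightarrow> (real ^ 'n) set" where
  "slab w k = {x. 2 powr k \<le> w x \<and> w x < 2 powr (k + 1)}"

lemma slab_sets: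
  fixes Q :: "(real ^ 'n) set"
  assumes "weight w" "Q \<in> sets lebesgue"
  shows "Q \<inter> slab w k \<in> sets lebesgue"
proof -
  have [measurable]: "w \<in> borel_measurable lebesgue" by (rule weight_measurable[OF assms(1)])
  have "w -` {2 powr k ..< 2 powr (k + 1)} \<inter> space lebesgue \<in> sets lebesgue"
    by (rule measurable_sets[OF weight_measurable[OF assms(1)]]) auto
  moreover have "slab w k = w -` {2 powr k ..< 2 powr (k + 1)}"
    by (auto simp: slab_def)
  ultimately show ?thesis
    using assms(2) by (simp add: sets.Int)
qed

abbreviation superset_bounded :: "(real ^ 'n \<Rightarrow> real) \<Rightarrow> real \<Rightarrow> real \<Rightarrow> bool" where
  "superset_bounded w b c \<equiv> \<forall>Q\<in>hcubes. \<forall>R\<in>hcubes. Q \<subseteq> R \<longrightarrow> vol R \<le> b * vol Q \<longrightarrow> mass w R \<le> c * mass w Q"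

lemma ample_superset:
  fixes w :: "real ^ 'n \<Rightarrow> real"
  assumes w: "ample w" and "b > 0"
  shows "\<exists>c>0. superset_bounded w b c"
proof -
  obtain c where c: "c > 0" "large_subsets w (1 / b) c"
    using ampleD[OF w, of "1 / b"] assms(2) by auto
  have "mass w R \<le> 1 / c * mass w Q" if "Q \<in> hcubes" "R \<in> hcubes" "Q \<subseteq> R" "vol R \<le> b * vol Q" for Q R
  proof -
    have "c * mass w R \<le> mass w Q"
      using that assms(2) by (intro c(2)[rule_format]) (auto simp: hcubes_sets field_simps)
    then show ?thesis using c(1) by (simp add: field_simps)
  qed
  then show ?thesis using c(1) by (intro exI[of _ "1 / c"]) auto
qed

text \<open>For l \<ge> 0 the weight is small on the slab and the decay of the lower level sets
  applies. For l < 0 it is large, and Chebyshev gives 2^(-|l|). The size is measured against the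
  average over \<open>Q\<close> although the points lie in \<open>R\<close>, which costs constants
  depending on \<open>b\<close>.\<close>

lemma slab_small:
  fixes w :: "real ^ 'n \<Rightarrow> real"
  assumes w: "ample w" and b: "b > 0"
  shows "\<exists>C>0. \<exists>s>0::real. \<forall>Q\<in>hcubes. \<forall>R\<in>hcubes. \<forall>l. Q \<subseteq> R \<longrightarrow> vol R \<le> b * vol Q \<longrightarrow>
    vol (R \<inter> slab w (level w Q - l)) \<le> C * 2 powr (- s * \<bar>l\<bar>) * vol R"
proof -
  note ww = ample_weight[OF w]
  obtain C s where C: "C > 0" "s > 0" "\<forall>Q\<in>hcubes. \<forall>T>0.
    vol {x \<in> Q. T * vol Q * w x < mass w Q} \<le> C * T powr (- s) * vol Q"
    using ample_lower_level[OF w] by auto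
  obtain c where c: "c > 0" "superset_bounded w b c"
    using ample_superset[OF w b] by auto
  define s' where "s' = min 1 s"
  define C' where "C' = C * (2 * b) powr s + 2 * c"
  have s': "0 < s'" "s' \<le> 1" "s' \<le> s" using C by (auto simp: s'_def)
  have C': "C' > 0" using C b c by (auto simp: C'_def intro!: add_pos_pos)
  have "vol (R \<inter> slab w (level w Q - l)) \<le> C' * 2 powr (- s' * \<bar>l\<bar>) * vol R"
    if Q: "Q \<in> hcubes" and R: "R \<in> hcubes" and QR: "Q \<subseteq> R" and le: "vol R \<le> b * vol Q" for Q R l
  proof -
    define m where "m = level w Q"
    define F where "F = R \<inter> slab w (m - l)"
    have Fset: "F \<in> sets lebesgue" unfolding F_def by (rule slab_sets[OF ww hcubes_sets[OF R]])
    have FR: "F \<subseteq> R" by (auto simp: F_def)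
    have bF: "bounded F" by (rule bounded_subset[OF bounded_hcubes[OF R] FR])
    have mQ: "vol Q > 0" and mR: "vol R > 0"
      using measure_hcubes_pos Q R by auto
    have QleR: "vol Q \<le> vol R" "mass w Q \<le> mass w R"
      using measure_mono_fmeasurable[OF QR hcubes_sets[OF Q] hcubes_lmeasurable[OF R]]
        mass_mono[OF ww bounded_hcubes[OF R] hcubes_sets[OF Q] hcubes_sets[OF R] QR] by auto
    have "vol F \<le> C' * 2 powr (- s' * \<bar>l\<bar>) * vol R"
    proof (cases "l \<ge> 0")
      case True
      \<comment> \<open>Chosen so that T |R| 2^(m-l+1) \<le> 2^m |Q| \<le> w(Q): one factor 2 is the
        width of the slab, and \<open>b\<close> accounts for |R| / |Q|.\<close>
      define T where "T = 2 powr (l - 1) / b"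
      have T: "T > 0" using b by (simp add: T_def)
      have "F \<subseteq> {x \<in> R. T * vol R * w x < mass w R}"
      proof
        fix x assume x: "x \<in> F"
        then have wx: "w x < 2 powr (m - l + 1)" by (auto simp: F_def slab_def)
        have "T * vol R * w x < T * vol R * 2 powr (m - l + 1)"
          using T mR wx by (intro mult_strict_left_mono) auto
        also have "\<dots> \<le> T * (b * vol Q) * 2 powr (m - l + 1)"
          using T le by (intro mult_right_mono mult_left_mono) auto
        also have "\<dots> = 2 powr m * vol Q"
          using b by (simp add: T_def powr_add powr_diff)
        also have "\<dots> \<le> mass w R"
          using level_bounds(1)[OF ww Q] QleR by (simp add: m_def)
        finally show "x \<in> {x \<in> R. T * vol R * w x < mass w R}"
          using x FR by auto
      qed
      then have "vol F \<le> vol {x \<in> R. T * vol R * w x < mass w R}"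
      proof (rule measure_mono_fmeasurable[OF _ Fset])
        have "{x \<in> R. T * vol R * w x < mass w R} \<in> sets lebesgue"
          using hcubes_sets[OF R] weight_measurable[OF ww] by (intro sets_Collect_less) auto
        then show "{x \<in> R. T * vol R * w x < mass w R} \<in> lmeasurable"
          by (rule fmeasurableI2[OF hcubes_lmeasurable[OF R], rotated]) auto
      qed
      also have "\<dots> \<le> C * T powr (- s) * vol R"
        using C(3) R T by blast
      also have "T powr (- s) = (2 * b) powr s * 2 powr (- s * \<bar>l\<bar>)"
      proof -
        have "T = 2 powr l * inverse (2 * b)" by (simp add: T_def powr_diff divide_simps)
        then have "T powr (- s) = (2 powr l) powr (- s) * (inverse (2 * b)) powr (- s)"
          by (simp only: powr_mult)
        also have "(inverse (2 * b)) powr (- s) = (2 * b) powr s"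
          using b by (simp only: powr_minus inverse_powr[of "2 * b"] inverse_inverse_eq)
        finally show ?thesis using True by (simp add: powr_powr mult_ac)
      qed
      also have "C * ((2 * b) powr s * 2 powr (- s * \<bar>l\<bar>)) * vol R \<le> C' * 2 powr (- s' * \<bar>l\<bar>) * vol R"
      proof (rule mult_right_mono)
        have "(C * (2 * b) powr s) * 2 powr (- s * \<bar>l\<bar>) \<le> C' * 2 powr (- s' * \<bar>l\<bar>)"
        proof (rule mult_mono)
          show "2 powr (- s * \<bar>l\<bar>) \<le> 2 powr (- s' * \<bar>l\<bar>)"
            using s' by (intro powr_mono mult_right_mono) auto
        qed (use c C C' in \<open>auto simp: C'_def\<close>)
        then show "C * ((2 * b) powr s * 2 powr (- s * \<bar>l\<bar>)) \<le> C' * 2 powr (- s' * \<bar>l\<bar>)"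
          by (simp only: mult.assoc)
      qed simp
      finally show ?thesis .
    next
      case False
      have "mass (\<lambda>x. 1) F \<le> 1 / 2 powr (m - l) * mass w F"
      proof (rule mass_le_mass[OF weight_one ww bF Fset])
        show "AE x in lebesgue. x \<in> F \<longrightarrow> 1 \<le> 1 / 2 powr (m - l) * w x"
          by (auto simp: F_def slab_def field_simps)
      qed simp
      also have "\<dots> \<le> 1 / 2 powr (m - l) * (c * (2 powr (m + 1) * vol R))"
      proof (rule mult_left_mono)
        have "mass w F \<le> mass w R"
          by (rule mass_mono[OF ww bounded_hcubes[OF R] Fset hcubes_sets[OF R] FR])
        also have "\<dots> \<le> c * mass w Q" using c(2) Q R QR le by blast
        also have "\<dots> \<le> c * (2 powr (m + 1) * vol Q)"
          using level_bounds(2)[OF ww Q] c(1) by (simp add: m_def)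
        also have "\<dots> \<le> c * (2 powr (m + 1) * vol R)"
          using QleR c(1) by simp
        finally show "mass w F \<le> c * (2 powr (m + 1) * vol R)" .
      qed simp
      also have "\<dots> = 2 * c * 2 powr (- 1 * \<bar>l\<bar>) * vol R"
        using False by (simp add: powr_add powr_diff)
      also have "\<dots> \<le> C' * 2 powr (- s' * \<bar>l\<bar>) * vol R"
      proof (intro mult_right_mono mult_mono)
        show "2 powr (- 1 * \<bar>l\<bar>) \<le> 2 powr (- s' * \<bar>l\<bar>)"
          using s' mult_right_mono[of s' 1 "\<bar>real_of_int l\<bar>"] by (intro powr_mono) auto
      qed (use c C C' b in \<open>auto simp: C'_def\<close>)
      finally show ?thesis by (simp add: mass_one)
    qed
    then show ?thesis by (simp add: F_def m_def)
  qed
  then show ?thesis using C' s' by blast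
qed

abbreviation slab_decay :: "(real ^ 'n \<Rightarrow> real) \<Rightarrow> (real ^ 'n \<Rightarrow> real) \<Rightarrow> real \<Rightarrow> real \<Rightarrow> real \<Rightarrow> bool" where
  "slab_decay u w b g C \<equiv>
    \<forall>Q\<in>hcubes. \<forall>R\<in>hcubes. \<forall>l. Q \<subseteq> R \<longrightarrow>
    vol R \<le> b * vol Q \<longrightarrow>
    (\<integral>\<^sup>+x\<in>R \<inter> slab w (level w Q - l). ennreal (u x * w x) \<partial>lebesgue) \<le> ennreal (C * 2 powr (- l - g * \<bar>l\<bar>) * (mass u Q / vol Q * mass w Q))"

text \<open>The power bound for u converts the volume decay of slabs into decay of u-mass, with the
  product of the exponents. On the slab w is about 2^(-l) times its average over Q, which supplies
  the factor 2^(-l).\<close>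

lemma slab_weighted_bound:
  fixes u w :: "real ^ 'n \<Rightarrow> real"
  assumes u: "ample u" and w: "ample w" and b: "b > 0"
  shows "\<exists>C>0. \<exists>g>0::real. slab_decay u w b g C"
proof -
  note ww = ample_weight[OF w] and uw = ample_weight[OF u]
  have [measurable]: "w \<in> borel_measurable lebesgue" "u \<in> borel_measurable lebesgue"
    using ww uw by (auto intro: weight_measurable)
  obtain C1 s :: real where C1: "C1 > 0" "s > 0" "\<forall>Q\<in>hcubes. \<forall>R\<in>hcubes. \<forall>l. Q \<subseteq> R \<longrightarrow> vol R \<le> b * vol Q \<longrightarrow>
    vol (R \<inter> slab w (level w Q - l)) \<le> C1 * 2 powr (- s * \<bar>l\<bar>) * vol R"
    using slab_small[OF w b] by auto
  obtain C2 g where C2: "C2 > 0" "g > 0" "power_bounded u C2 g"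
    using ample_power[OF u] by auto
  obtain c where c: "c > 0" "superset_bounded u b c"
    using ample_superset[OF u b] by auto
  define C where "C = 2 * (C2 * C1 powr g * c)"
  have C: "C > 0" using C1 C2 c by (simp add: C_def)
  have "(\<integral>\<^sup>+x\<in>R \<inter> slab w (level w Q - l). ennreal (u x * w x) \<partial>lebesgue)
      \<le> ennreal (C * 2 powr (- l - (s * g) * \<bar>l\<bar>) * (mass u Q / vol Q * mass w Q))"
    if Q: "Q \<in> hcubes" and R: "R \<in> hcubes" and QR: "Q \<subseteq> R" and le: "vol R \<le> b * vol Q" for Q R l
  proof -
    define m where "m = level w Q"
    define F where "F = R \<inter> slab w (m - l)"
    have Fset[measurable]: "F \<in> sets lebesgue" unfolding F_def by (rule slab_sets[OF ww hcubes_sets[OF R]])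
    have FR: "F \<subseteq> R" by (auto simp: F_def)
    have bF: "bounded F" by (rule bounded_subset[OF bounded_hcubes[OF R] FR])
    have mQ: "vol Q > 0" and mR: "vol R > 0"
      using measure_hcubes_pos Q R by auto
    have "vol F \<le> C1 * 2 powr (- s * \<bar>l\<bar>) * vol R"
      unfolding F_def m_def by (rule C1(3)[rule_format, OF Q R QR le])
    then have r: "vol F / vol R \<le> C1 * 2 powr (- s * \<bar>l\<bar>)"
      using mR by (simp add: field_simps)
    have "mass u F \<le> C2 * (vol F / vol R) powr g * mass u R"
      by (rule C2(3)[rule_format, OF R Fset FR])
    also have "\<dots> \<le> C2 * (C1 * 2 powr (- s * \<bar>l\<bar>)) powr g * (c * mass u Q)"
      using r C2 c(1) c(2)[rule_format, OF Q R QR le] by (intro mult_mono powr_mono2) auto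
    also have "\<dots> = C2 * C1 powr g * c * 2 powr (- (s * g) * \<bar>l\<bar>) * mass u Q"
      using C1 by (simp add: powr_mult powr_powr mult_ac)
    finally have uF: "mass u F \<le> C2 * C1 powr g * c * 2 powr (- (s * g) * \<bar>l\<bar>) * mass u Q" .
    have "(\<integral>\<^sup>+x\<in>F. ennreal (u x * w x) \<partial>lebesgue) \<le> (\<integral>\<^sup>+x. ennreal (2 powr (m - l + 1)) * (ennreal (u x) * indicator F x) \<partial>lebesgue)"
    proof (rule nn_integral_mono)
      fix x
      show "ennreal (u x * w x) * indicator F x \<le> ennreal (2 powr (m - l + 1)) * (ennreal (u x) * indicator F x)"
      proof (cases "x \<in> F")
        case True
        then have "w x \<le> 2 powr (m - l + 1)" by (auto simp: F_def slab_def)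
        then have "u x * w x \<le> 2 powr (m - l + 1) * u x"
          using weight_nonneg[OF uw, of x] by (subst mult.commute) (rule mult_right_mono)
        then have "ennreal (u x * w x) \<le> ennreal (2 powr (m - l + 1)) * ennreal (u x)"
          using weight_nonneg[OF uw, of x] by (simp add: ennreal_mult[symmetric] ennreal_leI)
        then show ?thesis using True by simp
      qed simp
    qed
    also have "\<dots> = ennreal (2 powr (m - l + 1)) * (\<integral>\<^sup>+x\<in>F. ennreal (u x) \<partial>lebesgue)"
      by (rule nn_integral_cmult) auto
    also have "\<dots> = ennreal (2 powr (m - l + 1) * mass u F)"
      by (simp add: nn_integral_mass[OF uw bF Fset] ennreal_mult)
    also have "\<dots> \<le> ennreal (C * 2 powr (- l - (s * g) * \<bar>l\<bar>) * (mass u Q / vol Q * mass w Q))"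
    proof (rule ennreal_leI)
      have "2 powr (m - l + 1) * mass u F \<le> 2 powr (m - l + 1) * (C2 * C1 powr g * c * 2 powr (- (s * g) * \<bar>l\<bar>) * mass u Q)"
        using uF by (intro mult_left_mono) auto
      also have "\<dots> = C * 2 powr (- l - (s * g) * \<bar>l\<bar>) * (mass u Q * 2 powr m)"
      proof -
        have "(2::real) powr (m - l + 1) * 2 powr (- (s * g) * \<bar>l\<bar>) = 2 * 2 powr (- l - (s * g) * \<bar>l\<bar>) * 2 powr m"
        proof -
          have "(2::real) powr (m - l + 1) * 2 powr (- (s * g) * \<bar>l\<bar>) = 2 powr (1 + (- l - (s * g) * \<bar>l\<bar>) + m)"
            unfolding powr_add[symmetric] by (simp add: algebra_simps)
          then show ?thesis
            by (simp only: powr_add powr_one zero_le_numeral)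
        qed
        then show ?thesis by (simp add: C_def mult_ac)
      qed
      also have "\<dots> \<le> C * 2 powr (- l - (s * g) * \<bar>l\<bar>) * (mass u Q * (mass w Q / vol Q))"
      proof (intro mult_left_mono)
        show "2 powr m \<le> mass w Q / vol Q"
          using level_bounds(1)[OF ww Q] mQ by (simp add: m_def field_simps)
      qed (use C in auto)
      finally show "2 powr (m - l + 1) * mass u F \<le> C * 2 powr (- l - (s * g) * \<bar>l\<bar>) * (mass u Q / vol Q * mass w Q)"
        by simp
    qed
    finally show ?thesis by (simp add: F_def m_def)
  qed
  then show ?thesis using C C1 C2 by (intro exI[of _ C] conjI exI[of _ "s * g"]) auto
qed

subsection \<open>The estimate for dyadic families\<close>

text \<open>\<open>R\<close> will be the threefold dilation of the dyadic cube \<open>Q\<close>: a cube is covered by boundedly many dyadic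
  cubes of comparable size, but a given point of it need not lie in the best of them.\<close>

definition exceed :: "(real ^ 'n \<Rightarrow> real) \<Rightarrow> (real ^ 'n \<Rightarrow> ennreal) \<Rightarrow> real \<Rightarrow> real \<Rightarrow> (real ^ 'n) set \<Rightarrow> (real ^ 'n) set \<Rightarrow> (real ^ 'n) set" where
  "exceed w H \<kappa> K R Q = {x \<in> R. 0 < w x \<and> ennreal (w x) \<le>
     ennreal (K * max 1 (mass w Q / vol Q / w x) powr \<kappa> / vol Q) * (nnint Q H)}"

lemma exceed_sets:
  assumes "weight w" "R \<in> sets lebesgue"
  shows "exceed w H \<kappa> K R Q \<in> sets lebesgue"
proof -
  have [measurable]: "w \<in> borel_measurable lebesgue" by (rule weight_measurable[OF assms(1)])
  have "{x \<in> space lebesgue. 0 < w x \<and> ennreal (w x) \<le>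
     ennreal (K * max 1 (mass w Q / vol Q / w x) powr \<kappa> / vol Q) * (nnint Q H)} \<in> sets lebesgue"
    by measurable
  moreover have "exceed w H \<kappa> K R Q = R \<inter> {x \<in> space lebesgue. 0 < w x \<and> ennreal (w x) \<le>
     ennreal (K * max 1 (mass w Q / vol Q / w x) powr \<kappa> / vol Q) * (nnint Q H)}"
    unfolding exceed_def
    by (rule set_eqI) (simp only: mem_Collect_eq Int_iff space_completion space_lborel space_borel UNIV_I simp_thms)
  ultimately show ?thesis
    using assms(2) by (simp only: sets.Int)
qed

text \<open>Within a slab the ratio of the average to w(x) is at most 2^(|l|+1), so one exceptional
  point yields a lower bound for the integral of H that no longer depends on the point.\<close>

lemma exceed_slab_lower_bound:
  fixes w :: "real ^ 'n \<Rightarrow> real"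
  assumes w: "weight w" and Q: "Q \<in> hcubes" and \<kappa>: "\<kappa> > 0" and K: "K > 0"
    and x: "x \<in> exceed w H \<kappa> K R Q" "x \<in> slab w (level w Q - l)"
  shows "ennreal (1 / (K * 2 powr (\<kappa> + 1)) * 2 powr (- l - \<kappa> * \<bar>l\<bar>) * mass w Q) \<le> (nnint Q H)"
proof -
  define m where "m = level w Q"
  define I where "I = (nnint Q H)"
  have mQ: "vol Q > 0" by (rule measure_hcubes_pos[OF Q])
  have wx: "2 powr (m - l) \<le> w x" using x(2) by (simp add: slab_def m_def)
  have wpos: "0 < w x" using less_le_trans[OF _ wx] by simp
  have "mass w Q / vol Q < 2 powr (m + 1)"
    using level_bounds(2)[OF w Q] mQ by (simp add: m_def field_simps)
  then have "mass w Q / vol Q / w x \<le> 2 powr (m + 1) / 2 powr (m - l)"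
    using wx by (intro frac_le) auto
  also have "\<dots> = 2 powr (l + 1)"
    unfolding powr_diff[symmetric] by (simp add: add.commute)
  also have "\<dots> \<le> 2 powr (\<bar>l\<bar> + 1)"
    by (intro powr_mono) auto
  finally have "max 1 (mass w Q / vol Q / w x) \<le> 2 powr (\<bar>l\<bar> + 1)"
    by (simp add: ge_one_powr_ge_zero)
  then have "max 1 (mass w Q / vol Q / w x) powr \<kappa> \<le> (2 powr (\<bar>l\<bar> + 1)) powr \<kappa>"
    using \<kappa> by (intro powr_mono2) auto
  then have pw: "max 1 (mass w Q / vol Q / w x) powr \<kappa> \<le> 2 powr (\<kappa> * \<bar>l\<bar> + \<kappa>)"
    by (simp add: powr_powr algebra_simps)
  define B where "B = K * 2 powr (\<kappa> * \<bar>l\<bar> + \<kappa>) / vol Q"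
  have B: "B > 0" using K mQ by (simp add: B_def)
  have "ennreal (w x) \<le> ennreal (K * max 1 (mass w Q / vol Q / w x) powr \<kappa> / vol Q) * I"
    using x(1) by (simp add: exceed_def I_def)
  also have "\<dots> \<le> ennreal B * I"
    using pw K mQ by (intro mult_right_mono ennreal_leI) (auto simp: B_def divide_right_mono)
  finally have "ennreal (1 / B) * ennreal (w x) \<le> ennreal (1 / B) * (ennreal B * I)"
    by (rule mult_left_mono) simp
  also have "\<dots> = I"
    using B by (simp add: mult.assoc[symmetric] ennreal_mult[symmetric])
  also have "ennreal (1 / B) * ennreal (w x) = ennreal (w x / B)"
    using B wpos by (simp add: ennreal_mult[symmetric])
  finally have 1: "ennreal (w x / B) \<le> I" .
  have 2: "1 / (K * 2 powr (\<kappa> + 1)) * 2 powr (- l - \<kappa> * \<bar>l\<bar>) * mass w Q \<le> w x / B"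
  proof -
    have "1 / (K * 2 powr (\<kappa> + 1)) * 2 powr (- l - \<kappa> * \<bar>l\<bar>) * mass w Q
        \<le> 1 / (K * 2 powr (\<kappa> + 1)) * 2 powr (- l - \<kappa> * \<bar>l\<bar>) * (2 powr (m + 1) * vol Q)"
      using level_bounds(2)[OF w Q] K by (intro mult_left_mono) (auto simp: m_def)
    also have "\<dots> = 2 powr (m - l) / B"
    proof -
      have "(2::real) powr (- l - \<kappa> * \<bar>l\<bar>) * 2 powr (m + 1) * 2 powr (\<kappa> * \<bar>l\<bar> + \<kappa>) = 2 powr (m - l) * 2 powr (\<kappa> + 1)"
        unfolding powr_add[symmetric] by (simp add: algebra_simps)
      then show ?thesis
        using K mQ by (simp add: B_def field_simps)
    qed
    also have "\<dots> \<le> w x / B"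
      using wx B by (simp add: divide_right_mono)
    finally show ?thesis .
  qed
  show ?thesis
    using order_trans[OF ennreal_leI[OF 2] 1] unfolding I_def of_int_minus of_int_abs .
qed

text \<open>Monotonicity allows a point of \<open>star Q\<close> to be kept when \<open>Q\<close> is
  replaced by a larger cube of the family.\<close>

definition star_map :: "real \<Rightarrow> (real ^ 'n) set set \<Rightarrow> ((real ^ 'n) set \<Rightarrow> (real ^ 'n) set) \<Rightarrow> bool" where
  "star_map b D star \<longleftrightarrow> (\<forall>Q\<in>D. star Q \<in> hcubes \<and> Q \<subseteq> star Q \<and> vol (star Q) \<le> b * vol Q) \<and>
     (\<forall>A\<in>D. \<forall>B\<in>D. A \<subseteq> B \<longrightarrow> star A \<subseteq> star B)"

abbreviation family_bound ::
  "((real ^ 'n) set set \<Rightarrow> bool) \<Rightarrow> real \<Rightarrow> (real ^ 'n) measure \<Rightarrow> real \<Rightarrow> (real ^ 'n \<Rightarrow> real) \<Rightarrow> (real ^ 'n \<Rightarrow> real) \<Rightarrow> real \<Rightarrow> real \<Rightarrow> bool" where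
  "family_bound P b M K u w \<kappa> C \<equiv>
    \<forall>D star H. P D \<longrightarrow> D \<subseteq> hcubes \<longrightarrow> laminar D \<longrightarrow>
    star_map b D star \<longrightarrow> H \<in> borel_measurable lebesgue \<longrightarrow>
    emeasure M (\<Union>Q\<in>D. exceed w H \<kappa> K (star Q) Q) \<le> ennreal C * pairing u H"

lemma finite_family_bound:
  fixes u w :: "real ^ 'n \<Rightarrow> real"
  assumes u: "u \<in> A_1" and w: "ample w" and b: "b > 0"
  shows "\<exists>\<kappa>0>0. \<forall>\<kappa> K. 0 < \<kappa> \<longrightarrow> \<kappa> < \<kappa>0 \<longrightarrow> 0 < K \<longrightarrow> (\<exists>C>0. family_bound finite b (density lebesgue (\<lambda>x. ennreal (u x * w x))) K u w \<kappa> C)"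
proof -
  note ww = ample_weight[OF w]
  have au: "ample u" by (rule ample_A_1[OF u])
  note uw = ample_weight[OF au]
  have [measurable]: "w \<in> borel_measurable lebesgue" "u \<in> borel_measurable lebesgue"
    using ww uw by (auto intro: weight_measurable)
  obtain C1 g :: real where C1: "C1 > 0" "g > 0" "slab_decay u w b g C1"
    using slab_weighted_bound[OF au w b] by auto
  obtain C2 where C2: "C2 > 0" "stopping_sums u w C2"
    using stopping_family_bound[OF u w] by auto
  define M where "M = density lebesgue (\<lambda>x. ennreal (u x * w x))"
  have setsM: "sets M = sets lebesgue" by (simp add: M_def)
  have emM: "emeasure M A = (\<integral>\<^sup>+x\<in>A. ennreal (u x * w x) \<partial>lebesgue)" if "A \<in> sets lebesgue" for A
    unfolding M_def using that by (subst emeasure_density) auto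
  have "\<exists>C>0. family_bound finite b M K u w \<kappa> C"
    if \<kappa>: "0 < \<kappa>" "\<kappa> < g" and K: "0 < K" for \<kappa> K
  proof -
    define \<rho> where "\<rho> l = 1 / (K * 2 powr (\<kappa> + 1)) * 2 powr (- l - \<kappa> * \<bar>l\<bar>)" for l :: int
    have rho: "\<rho> l > 0" for l using K by (simp add: \<rho>_def)
    define q where "q = (2::real) powr (- (g - \<kappa>))"
    have q: "0 < q" "q < 1" using \<kappa> by (auto simp: q_def powr_less_one)
    define C' where "C' = C1 * C2 * (K * 2 powr (\<kappa> + 1))"
    have C': "C' > 0" using C1 C2 K by (simp add: C'_def)
    have "emeasure M (\<Union>Q\<in>D. exceed w H \<kappa> K (star Q) Q) \<le> ennreal (2 * (C' * (1 / (1 - q)))) * pairing u H"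
      if D: "finite D" "D \<subseteq> hcubes" "laminar D" and star: "star_map b D star" and H: "H \<in> borel_measurable lebesgue" for D star H
    proof -
      define J where "J = pairing u H"
      define P where "P l Q \<longleftrightarrow> ennreal (\<rho> l * mass w Q) \<le> (nnint Q H)" for l Q
      \<comment> \<open>Maximality is imposed within each level separately, so cubes of equal level
        become disjoint while different levels may overlap.\<close>
      define S where "S l = {Q\<in>D. P l Q \<and> (\<forall>Q'\<in>D. P l Q' \<longrightarrow> level w Q' = level w Q \<longrightarrow> Q \<subseteq> Q' \<longrightarrow> Q = Q')}" for l
      define F where "F l Q = star Q \<inter> slab w (level w Q - l)" for l Q
      define G where "G l = (\<Union>Q\<in>S l. F l Q)" for l
      have SD: "S l \<subseteq> D" for l by (auto simp: S_def)
      have finS: "finite (S l)" for l using finite_subset[OF SD D(1)] .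
      have starD: "star Q \<in> hcubes" "Q \<subseteq> star Q" "vol (star Q) \<le> b * vol Q" if "Q \<in> D" for Q
        using star that by (auto simp: star_map_def)
      have Fset: "F l Q \<in> sets lebesgue" if "Q \<in> D" for l Q
        unfolding F_def by (rule slab_sets[OF ww hcubes_sets[OF starD(1)[OF that]]])
      have Gset: "G l \<in> sets lebesgue" for l
      proof -
        have "F l Q \<in> sets lebesgue" if "Q \<in> S l" for Q using that SD Fset by blast
        then show ?thesis unfolding G_def by (intro sets.finite_UN finS)
      qed
      have Gbound: "emeasure M (G l) \<le> ennreal (C' * q ^ nat \<bar>l\<bar>) * J" for l
      proof -
        have "emeasure M (G l) \<le> (\<Sum>Q\<in>S l. emeasure M (F l Q))"
        proof -
          have "F l ` S l \<subseteq> sets M" using SD Fset setsM by blast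
          then show ?thesis unfolding G_def by (intro emeasure_subadditive_finite finS)
        qed
        also have "\<dots> \<le> (\<Sum>Q\<in>S l. ennreal (C1 * 2 powr (- l - g * \<bar>l\<bar>) * (mass u Q / vol Q * mass w Q)))"
        proof (rule sum_mono)
          fix Q assume "Q \<in> S l"
          then have Q: "Q \<in> D" using SD by blast
          then have Qh: "Q \<in> hcubes" using D(2) by blast
          show "emeasure M (F l Q) \<le> ennreal (C1 * 2 powr (- l - g * \<bar>l\<bar>) * (mass u Q / vol Q * mass w Q))"
            unfolding emM[OF Fset[OF Q]] unfolding F_def
            using C1(3)[rule_format, OF Qh starD[OF Q], of l] by simp
        qed
        also have "\<dots> = ennreal (C1 * 2 powr (- l - g * \<bar>l\<bar>)) * ennreal (\<Sum>Q\<in>S l. mass u Q / vol Q * mass w Q)"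
        proof -
          have "(\<Sum>Q\<in>S l. ennreal (C1 * 2 powr (- l - g * \<bar>l\<bar>) * (mass u Q / vol Q * mass w Q)))
            = ennreal (\<Sum>Q\<in>S l. C1 * 2 powr (- l - g * \<bar>l\<bar>) * (mass u Q / vol Q * mass w Q))"
            using C1(1) by (intro sum_ennreal) auto
          also have "\<dots> = ennreal (C1 * 2 powr (- l - g * \<bar>l\<bar>) * (\<Sum>Q\<in>S l. mass u Q / vol Q * mass w Q))"
            by (simp only: sum_distrib_left)
          also have "\<dots> = ennreal (C1 * 2 powr (- l - g * \<bar>l\<bar>)) * ennreal (\<Sum>Q\<in>S l. mass u Q / vol Q * mass w Q)"
            using C1(1) by (intro ennreal_mult) (auto intro!: sum_nonneg)
          finally show ?thesis .
        qed
        also have "\<dots> \<le> ennreal (C1 * 2 powr (- l - g * \<bar>l\<bar>)) * (ennreal (C2 / \<rho> l) * J)"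
        proof (rule mult_left_mono)
          show "ennreal (\<Sum>Q\<in>S l. mass u Q / vol Q * mass w Q) \<le> ennreal (C2 / \<rho> l) * J"
            unfolding J_def
          proof (intro C2(2)[rule_format])
            show "laminar (S l)" by (rule laminar_subset[OF D(3) SD])
            show "S l \<subseteq> hcubes" using SD D(2) by blast
            show "A \<inter> B = {}" if "A \<in> S l" "B \<in> S l" "A \<noteq> B" "level w A = level w B" for A B
            proof -
              have AB: "A \<in> D" "B \<in> D" "P l A" "P l B" using that by (auto simp: S_def)
              have "\<not> A \<subseteq> B"
                using that(1,3,4) AB unfolding S_def by force
              moreover have "\<not> B \<subseteq> A"
                using that(2,3,4) AB unfolding S_def by force
              ultimately show ?thesis using D(3) AB unfolding laminar_def by blast
            qed
            show "ennreal (\<rho> l * mass w Q) \<le> (nnint Q H)" if "Q \<in> S l" for Q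
              using that by (simp add: S_def P_def)
          qed (use finS H rho in auto)
        qed simp
        also have "\<dots> = ennreal (C1 * 2 powr (- l - g * \<bar>l\<bar>) * (C2 / \<rho> l)) * J"
          using C1(1) C2(1) rho[of l] ennreal_mult[of "C1 * 2 powr (- l - g * \<bar>l\<bar>)" "C2 / \<rho> l"]
          by (simp only: mult.assoc) (simp add: mult.assoc)
        \<comment> \<open>The factors 2^(-l) of the slab bound and of \<open>\<rho> l\<close>
          cancel; what remains is the gain g minus the loss \<kappa>.\<close>
        also have "C1 * 2 powr (- l - g * \<bar>l\<bar>) * (C2 / \<rho> l) = C' * q ^ nat \<bar>l\<bar>"
        proof -
          have e: "(2::real) powr (- l - g * \<bar>l\<bar>) = 2 powr (- (g - \<kappa>) * \<bar>l\<bar>) * 2 powr (- l - \<kappa> * \<bar>l\<bar>)"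
            unfolding powr_add[symmetric] by (simp add: algebra_simps)
          have "q ^ nat \<bar>l\<bar> = 2 powr (- (g - \<kappa>) * \<bar>l\<bar>)"
            by (simp add: q_def powr_realpow[symmetric] powr_powr)
          then show ?thesis
            unfolding e using K by (simp add: C'_def \<rho>_def field_simps)
        qed
        finally show ?thesis .
      qed
      \<comment> \<open>Used for l = i and for l = -i; l = 0 is counted twice.\<close>
      have half: "emeasure M (\<Union>i. G (f i)) \<le> ennreal (C' * (1 / (1 - q))) * J" if f: "\<And>i::nat. \<bar>f i\<bar> = int i" for f
      proof -
        have "emeasure M (\<Union>i. G (f i)) \<le> (\<Sum>i. emeasure M (G (f i)))"
          using Gset setsM by (intro emeasure_subadditive_countably) auto
        also have "\<dots> \<le> (\<Sum>i. ennreal (C' * q ^ i) * J)"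
        proof (rule suminf_le)
          show "emeasure M (G (f i)) \<le> ennreal (C' * q ^ i) * J" for i
            using Gbound[of "f i"] f[of i] by simp
        qed auto
        also have "\<dots> = (\<Sum>i. ennreal (C' * q ^ i)) * J"
          by (rule ennreal_suminf_multc)
        also have "(\<Sum>i. ennreal (C' * q ^ i)) = ennreal (C' * (1 / (1 - q)))"
        proof (rule suminf_ennreal_eq)
          show "(\<lambda>i. C' * q ^ i) sums (C' * (1 / (1 - q)))"
            using q by (intro sums_mult geometric_sums) auto
        qed (use C' q in auto)
        finally show ?thesis .
      qed
      have cover: "(\<Union>Q\<in>D. exceed w H \<kappa> K (star Q) Q) \<subseteq> (\<Union>i::nat. G (int i)) \<union> (\<Union>i::nat. G (- int i))"
      proof
        fix x assume "x \<in> (\<Union>Q\<in>D. exceed w H \<kappa> K (star Q) Q)"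
        then obtain Q where Q: "Q \<in> D" "x \<in> exceed w H \<kappa> K (star Q) Q" by blast
        have wx: "0 < w x" and xs: "x \<in> star Q" using Q(2) by (auto simp: exceed_def)
        define l where "l = level w Q - \<lfloor>log 2 (w x)\<rfloor>"
        have xl: "x \<in> slab w (level w Q - l)"
          using floor_log2_bounds[OF wx] by (simp add: slab_def l_def)
        have PQ: "P l Q"
          using exceed_slab_lower_bound[OF ww subsetD[OF D(2) Q(1)] \<kappa>(1) K Q(2) xl]
          unfolding P_def \<rho>_def of_int_minus of_int_abs .
        \<comment> \<open>The slab depends on a cube only through its level, so replacing
          \<open>Q\<close> by a maximal cube of the same level keeps \<open>x\<close> in the
          slab.\<close>
        define E where "E = {Q'\<in>D. P l Q' \<and> level w Q' = level w Q}"
        have E: "finite E" "Q \<in> E" using D(1) Q(1) PQ by (auto simp: E_def)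
        obtain Q1 where Q1: "Q1 \<in> E" "Q \<subseteq> Q1" "\<forall>A\<in>E. Q1 \<subseteq> A \<longrightarrow> Q1 = A"
          using finite_has_maximal2[OF E] by blast
        have Q1D: "Q1 \<in> D" using Q1(1) by (simp add: E_def)
        have "Q1 \<in> S l"
          using Q1 unfolding S_def E_def by auto
        moreover have "x \<in> F l Q1"
        proof -
          have "star Q \<subseteq> star Q1" using star Q(1) Q1D Q1(2) by (auto simp: star_map_def)
          then show ?thesis using xs xl Q1(1) by (auto simp: F_def E_def)
        qed
        ultimately have "x \<in> G l" by (auto simp: G_def)
        moreover have "l = int (nat l) \<or> l = - int (nat (- l))" by auto
        ultimately show "x \<in> (\<Union>i::nat. G (int i)) \<union> (\<Union>i::nat. G (- int i))" by (metis UN_I UNIV_I UnI1 UnI2)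
      qed
      have Us: "(\<Union>i::nat. G (int i)) \<in> sets M" "(\<Union>i::nat. G (- int i)) \<in> sets M"
        using Gset setsM by auto
      have "emeasure M (\<Union>Q\<in>D. exceed w H \<kappa> K (star Q) Q) \<le> emeasure M ((\<Union>i::nat. G (int i)) \<union> (\<Union>i::nat. G (- int i)))"
        using Us by (intro emeasure_mono[OF cover]) auto
      also have "\<dots> \<le> emeasure M (\<Union>i::nat. G (int i)) + emeasure M (\<Union>i::nat. G (- int i))"
        by (rule emeasure_subadditive[OF Us])
      also have "\<dots> \<le> ennreal (C' * (1 / (1 - q))) * J + ennreal (C' * (1 / (1 - q))) * J"
        by (intro add_mono half) auto
      also have "\<dots> = ennreal (2 * (C' * (1 / (1 - q)))) * J"
        using C' q by (simp add: distrib_right[symmetric] ennreal_plus[symmetric] del: ennreal_plus)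
      finally show ?thesis by (simp only: J_def)
    qed
    then show ?thesis
      using C' q by (intro exI[of _ "2 * (C' * (1 / (1 - q)))"]) auto
  qed
  then show ?thesis
    unfolding M_def using C1(2) by blast
qed

text \<open>Continuity from below, available because the constant does not depend on the finite
  family.\<close>

lemma countable_family_bound:
  fixes u w :: "real ^ 'n \<Rightarrow> real"
  assumes u: "u \<in> A_1" and w: "ample w" and b: "b > 0"
  shows "\<exists>\<kappa>0>0. \<forall>\<kappa> K. 0 < \<kappa> \<longrightarrow> \<kappa> < \<kappa>0 \<longrightarrow> 0 < K \<longrightarrow> (\<exists>C>0. family_bound countable b (density lebesgue (\<lambda>x. ennreal (u x * w x))) K u w \<kappa> C)"
proof -
  define M where "M = density lebesgue (\<lambda>x. ennreal (u x * w x))"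
  have setsM: "sets M = sets lebesgue" by (simp add: M_def)
  have step: "emeasure M (\<Union>Q\<in>D. exceed w H \<kappa> K (star Q) Q) \<le> X"
    if fin: "\<And>E. finite E \<Longrightarrow> E \<subseteq> D \<Longrightarrow> emeasure M (\<Union>Q\<in>E. exceed w H \<kappa> K (star Q) Q) \<le> X"
      and D: "countable D" and star: "star_map b D star" for D star H X \<kappa> K
  proof (cases "D = {}")
    case False
    define f where "f = from_nat_into D"
    have f: "range f = D" unfolding f_def using range_from_nat_into[OF False D] .
    define A where "A n = (\<Union>Q\<in>f ` {..<n}. exceed w H \<kappa> K (star Q) Q)" for n :: nat
    have A: "A n \<in> sets M" for n
    proof -
      have "exceed w H \<kappa> K (star Q) Q \<in> sets M" if "Q \<in> f ` {..<n}" for Q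
      proof -
        have "Q \<in> D" using that f by blast
        then show ?thesis
          using star unfolding setsM star_map_def by (intro exceed_sets ample_weight[OF w] hcubes_sets) auto
      qed
      then show ?thesis unfolding A_def by (intro sets.finite_UN) auto
    qed
    have "(\<Union>Q\<in>D. exceed w H \<kappa> K (star Q) Q) = (\<Union>n. A n)"
      unfolding A_def f[symmetric] by auto
    also have "emeasure M (\<Union>n. A n) = (SUP n. emeasure M (A n))"
    proof (rule SUP_emeasure_incseq[symmetric])
      show "incseq A" by (rule incseq_SucI) (auto simp: A_def lessThan_Suc)
    qed (use A in auto)
    also have "\<dots> \<le> X"
    proof (rule SUP_least)
      fix n
      show "emeasure M (A n) \<le> X"
        unfolding A_def by (rule fin) (use f in auto)
    qed
    finally show ?thesis .
  qed simp
  obtain \<kappa>0 where k0: "\<kappa>0 > 0" "\<forall>\<kappa> K. 0 < \<kappa> \<longrightarrow> \<kappa> < \<kappa>0 \<longrightarrow> 0 < K \<longrightarrow> (\<exists>C>0. family_bound finite b M K u w \<kappa> C)"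
    using finite_family_bound[OF u w b] unfolding M_def by auto
  show ?thesis
    unfolding M_def[symmetric]
  proof (rule exI[of _ \<kappa>0], intro conjI k0(1) allI impI)
    fix \<kappa> K :: real assume *: "0 < \<kappa>" "\<kappa> < \<kappa>0" "0 < K"
    obtain C where C: "C > 0" "family_bound finite b M K u w \<kappa> C"
      using k0(2)[THEN spec, THEN spec, THEN mp, THEN mp, THEN mp, OF *] by blast
    have "emeasure M (\<Union>Q\<in>D. exceed w H \<kappa> K (star Q) Q) \<le> ennreal C * pairing u H"
      if D: "countable D" "D \<subseteq> hcubes" "laminar D" "star_map b D star" "H \<in> borel_measurable lebesgue" for D star H
    proof (rule step[OF _ D(1,4)])
      fix E assume E: "finite E" "E \<subseteq> D"
      have "star_map b E star"
        using D(4) subsetD[OF E(2)] by (simp add: star_map_def)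
      then show "emeasure M (\<Union>Q\<in>E. exceed w H \<kappa> K (star Q) Q) \<le> ennreal C * pairing u H"
        by (rule C(2)[rule_format, OF E(1) order_trans[OF E(2) D(2)] laminar_subset[OF D(3) E(2)] _ D(5)])
    qed
    then show "\<exists>C>0. family_bound countable b M K u w \<kappa> C"
      using C(1) by (intro exI[of _ C] conjI allI impI)
  qed
qed

subsection \<open>From cubes to dyadic cells\<close>

definition dyadic_cells :: "(real ^ 'n) set set" where
  "dyadic_cells = (\<Union>j::int. range (cell 0 (2 powr j)))"

lemma countable_dyadic_cells: "countable dyadic_cells"
  unfolding dyadic_cells_def by (intro countable_UN countable_cells) auto

lemma dyadic_cells_hcubes: "dyadic_cells \<subseteq> hcubes"
  by (auto simp: dyadic_cells_def intro: cell_hcubes)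

lemma laminar_dyadic_cells: "laminar dyadic_cells"
proof -
  have *: "cell 0 (2 powr i) x \<subseteq> cell 0 (2 powr j) y \<or> cell 0 (2 powr i) x \<inter> cell 0 (2 powr j) y = {}"
    if "i \<le> j" for i j :: int and x y :: "real ^ 'n"
  proof -
    have "(2::real) powr j = 2 powr i * 2 ^ nat (j - i)"
      using that by (simp add: powr_realpow[symmetric] powr_add[symmetric])
    then show ?thesis
      using cells_nested by blast
  qed
  show ?thesis
    unfolding laminar_def dyadic_cells_def
  proof (intro ballI)
    fix A B :: "(real ^ 'n) set"
    assume "A \<in> (\<Union>j::int. range (cell 0 (2 powr j)))" "B \<in> (\<Union>j::int. range (cell 0 (2 powr j)))"
    then obtain i j :: int and x y where AB: "A = cell 0 (2 powr i) x" "B = cell 0 (2 powr j) y"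
      by auto
    show "A \<subseteq> B \<or> B \<subseteq> A \<or> A \<inter> B = {}"
      using *[of i j x y] *[of j i y x] unfolding AB by (cases "i \<le> j") auto
  qed
qed

lemma hcube_subset_hcube:
  assumes s: "0 < s" "0 < s'" and sub: "hcube b s \<subseteq> hcube b' s'"
  shows "b' $ i \<le> b $ i" "b $ i + s \<le> b' $ i + s'"
proof -
  have "b \<in> hcube b s" using s by (simp add: hcube_def)
  then have b: "b' $ i \<le> b $ i" "b $ i < b' $ i + s'" for i using sub by (auto simp: hcube_def)
  show "b' $ i \<le> b $ i" by (rule b)
  show "b $ i + s \<le> b' $ i + s'"
  proof (rule ccontr)
    assume n: "\<not> ?thesis"
    \<comment> \<open>A test point: if the smaller cube stuck out in direction \<open>i\<close>, it
      would contain a point on the excluded upper face of the larger one.\<close>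
    define y where "y = (\<chi> k. if k = i then b' $ i + s' else b $ k)"
    have "y \<in> hcube b s" using s b[of i] n by (auto simp: hcube_def y_def)
    then have "y \<in> hcube b' s'" using sub by blast
    then show False by (auto simp: hcube_def y_def dest!: spec[of _ i])
  qed
qed

text \<open>Concentric threefold dilation. A half-open cube determines its corner and side, so the
  existential has one witness, as \<open>star_hcube\<close> shows; other sets are sent to the empty
  set.\<close>

definition star :: "(real ^ 'n) set \<Rightarrow> (real ^ 'n) set" where
  "star Q = {y. \<exists>b s. 0 < s \<and> Q = hcube b s \<and> y \<in> hcube (b - (\<chi> i. s)) (3 * s)}"

lemma star_hcube:
  assumes "0 < s"
  shows "star (hcube b s) = hcube (b - (\<chi> i. s)) (3 * s)"
proof -
  have "b' = b \<and> s' = s" if "0 < s'" "hcube b s = hcube b' s'" for b' s'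
  proof -
    have "b $ i = b' $ i \<and> s = s'" for i
      using hcube_subset_hcube[OF assms that(1), of b b' i] hcube_subset_hcube[OF that(1) assms, of b' b i] that(2) by auto
    then show ?thesis by (auto simp: vec_eq_iff)
  qed
  then show ?thesis
    unfolding star_def using assms by blast
qed

lemma star_map_star: "star_map (3 ^ CARD('n)) (hcubes :: (real ^ 'n) set set) star"
  unfolding star_map_def
proof (intro conjI ballI impI)
  fix Q :: "(real ^ 'n) set" assume "Q \<in> hcubes"
  then obtain b s where Q: "0 < s" "Q = hcube b s" by (auto simp: hcubes_def)
  show "star Q \<in> hcubes" using Q by (simp add: star_hcube hcubesI)
  show "vol (star Q) \<le> 3 ^ CARD('n) * vol Q"
    using Q by (simp add: star_hcube measure_hcube power_mult_distrib)
  show "Q \<subseteq> star Q"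
    unfolding Q(2) star_hcube[OF Q(1)]
  proof
    fix y assume y: "y \<in> hcube b s"
    have "b $ i - s \<le> y $ i \<and> y $ i < b $ i - s + 3 * s" for i
    proof -
      have "b $ i \<le> y $ i" "y $ i < b $ i + s" using y by (auto simp: hcube_def)
      then show ?thesis using Q(1) by linarith
    qed
    then show "y \<in> hcube (b - (\<chi> i. s)) (3 * s)" by (simp add: hcube_def)
  qed
next
  fix A B :: "(real ^ 'n) set" assume "A \<in> hcubes" "B \<in> hcubes" and sub: "A \<subseteq> B"
  then obtain b s b' s' where A: "0 < s" "A = hcube b s" and B: "0 < s'" "B = hcube b' s'"
    by (auto simp: hcubes_def)
  note * = hcube_subset_hcube[OF A(1) B(1) sub[unfolded A(2) B(2)]]
  show "star A \<subseteq> star B"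
    unfolding A(2) B(2) star_hcube[OF A(1)] star_hcube[OF B(1)]
  proof
    fix y assume y: "y \<in> hcube (b - (\<chi> i. s)) (3 * s)"
    have "b' $ i - s' \<le> y $ i \<and> y $ i < b' $ i - s' + 3 * s'" for i
    proof -
      have "b $ i - s \<le> y $ i" "y $ i < b $ i - s + 3 * s" using y by (auto simp: hcube_def)
      then show ?thesis using *[of i] by linarith
    qed
    then show "y \<in> hcube (b' - (\<chi> i. s')) (3 * s')" by (simp add: hcube_def)
  qed
qed

lemma star_map_subset:
  assumes "star_map b D s" "E \<subseteq> D"
  shows "star_map b E s"
  using assms(1) subsetD[OF assms(2)] by (simp add: star_map_def)

text \<open>Round the side of R up to a power of two. In each coordinate R then meets at most two
  consecutive grid intervals, so 2^n mutually adjacent cells cover it. The cell with the largest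
  integral of H is taken, and R lies in its threefold dilation.\<close>

lemma cube_dyadic_cell:
  fixes R :: "(real ^ 'n) set" and H :: "real ^ 'n \<Rightarrow> ennreal"
  assumes R: "R \<in> cubes" and H: "H \<in> borel_measurable lebesgue"
  shows "\<exists>Q\<in>dyadic_cells. R \<subseteq> star Q \<and> (nnint R H) \<le> ennreal (2 ^ CARD('n)) * (nnint Q H) \<and>
    vol Q \<le> 2 ^ CARD('n) * vol R"
proof -
  note [measurable] = H
  obtain a d where d: "0 < d" and Req: "R = cbox a (\<chi> i. a $ i + d)"
    using R by (auto simp: cubes_def)
  define j where "j = \<lceil>log 2 d\<rceil>"
  define s where "s = (2::real) powr j"
  have s: "s > 0" by (simp add: s_def)
  have ds: "d \<le> s"
  proof -
    have "log 2 d \<le> j" by (simp add: j_def)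
    then show ?thesis using d by (simp add: s_def log_le_iff)
  qed
  have s2: "s < 2 * d"
  proof -
    have "real_of_int j - 1 < log 2 d" unfolding j_def by linarith
    then have "2 powr (real_of_int j - 1) < d" using d by (simp add: less_log_iff)
    then show ?thesis by (simp add: s_def powr_diff)
  qed
  \<comment> \<open>The subset \<open>T\<close> records the coordinates in which the cell is one
    step above the cell of the corner \<open>a\<close>.\<close>
  define c where "c T = (\<chi> i. a $ i + (if i \<in> T then s else 0))" for T :: "'n set"
  have fl: "\<lfloor>c T $ i / s\<rfloor> = \<lfloor>a $ i / s\<rfloor> + (if i \<in> T then 1 else 0)" for T i
    using s by (simp add: c_def add_divide_distrib)
  have Rfl: "\<lfloor>y $ i / s\<rfloor> = \<lfloor>a $ i / s\<rfloor> \<or> \<lfloor>y $ i / s\<rfloor> = \<lfloor>a $ i / s\<rfloor> + 1" if "y \<in> R" for y i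
  proof -
    have "a $ i \<le> y $ i" "y $ i \<le> a $ i + s"
      using that ds by (auto simp: Req mem_box_cart intro: order_trans)
    then have "a $ i / s \<le> y $ i / s" "y $ i / s \<le> a $ i / s + 1"
      using s by (auto simp: field_simps)
    then show ?thesis by linarith
  qed
  have cover: "R \<subseteq> (\<Union>T\<in>UNIV. cell 0 s (c T))"
  proof
    fix y assume y: "y \<in> R"
    define T where "T = {i. \<lfloor>y $ i / s\<rfloor> \<noteq> \<lfloor>a $ i / s\<rfloor>}"
    have "\<lfloor>y $ i / s\<rfloor> = \<lfloor>c T $ i / s\<rfloor>" for i
      unfolding fl using Rfl[OF y, of i] by (auto simp: T_def)
    then have "y \<in> cell 0 s (c T)" by (simp add: cell_def)
    then show "y \<in> (\<Union>T\<in>UNIV. cell 0 s (c T))" by blast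
  qed
  define I where "I T = (\<integral>\<^sup>+x\<in>cell 0 s (c T). H x \<partial>lebesgue)" for T
  have [measurable]: "cell 0 s (c T) \<in> sets lebesgue" for T using s by simp
  obtain T where T: "\<And>T'. I T' \<le> I T"
  proof -
    have "Max (range I) \<in> range I" by (intro Max_in) auto
    then obtain T where "I T = Max (range I)" by (metis rangeE)
    then show ?thesis using that[of T] by simp
  qed
  define Q where "Q = cell 0 s (c T)"
  have "(nnint R H) \<le> (\<integral>\<^sup>+x. (\<Sum>T\<in>UNIV. H x * indicator (cell 0 s (c T)) x) \<partial>lebesgue)"
  proof (rule nn_integral_mono)
    fix x
    show "H x * indicator R x \<le> (\<Sum>T\<in>UNIV. H x * indicator (cell 0 s (c T)) x)"
    proof (cases "x \<in> R")
      case True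
      then obtain T' where "x \<in> cell 0 s (c T')" using cover by blast
      then have "H x * indicator R x = H x * indicator (cell 0 s (c T')) x" using True by simp
      also have "\<dots> \<le> (\<Sum>T\<in>UNIV. H x * indicator (cell 0 s (c T)) x)"
        by (rule member_le_sum) auto
      finally show ?thesis .
    qed simp
  qed
  also have "\<dots> = (\<Sum>T\<in>UNIV. I T)"
    unfolding I_def by (rule nn_integral_sum) auto
  also have "\<dots> \<le> (\<Sum>T'\<in>(UNIV :: 'n set set). I T)"
    by (intro sum_mono T)
  also have "\<dots> = ennreal (2 ^ CARD('n)) * I T"
    by (simp add: card_UNIV_set ennreal_of_nat_eq_real_of_nat)
  finally have i: "(nnint R H) \<le> ennreal (2 ^ CARD('n)) * (nnint Q H)"
    by (simp add: I_def Q_def)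
  have mR: "vol R = d ^ CARD('n)"
    using hcube_of_cube(4)[OF d Req] measure_hcube[OF d, of a] by simp
  have m: "vol Q \<le> 2 ^ CARD('n) * vol R"
  proof -
    have "s ^ CARD('n) \<le> (2 * d) ^ CARD('n)" using s s2 by (intro power_mono) auto
    then show ?thesis using s by (simp add: Q_def measure_cell mR power_mult_distrib)
  qed
  have "R \<subseteq> star Q"
  proof
    fix y assume y: "y \<in> R"
    have Qh: "Q = hcube (\<chi> i. s * \<lfloor>c T $ i / s\<rfloor>) s"
      unfolding Q_def using cell_eq_hcube[OF s, of 0 "c T"] by simp
    have "s * \<lfloor>c T $ i / s\<rfloor> - s \<le> y $ i \<and> y $ i < s * \<lfloor>c T $ i / s\<rfloor> - s + 3 * s" for i
    proof -
      have b: "\<lfloor>y $ i / s\<rfloor> \<le> y $ i / s" "y $ i / s < \<lfloor>y $ i / s\<rfloor> + 1" by linarith+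
      have "\<lfloor>c T $ i / s\<rfloor> - 1 \<le> \<lfloor>y $ i / s\<rfloor>" "\<lfloor>y $ i / s\<rfloor> \<le> \<lfloor>c T $ i / s\<rfloor> + 1"
        unfolding fl using Rfl[OF y, of i] by auto
      then have "\<lfloor>c T $ i / s\<rfloor> - 1 \<le> y $ i / s" "y $ i / s < \<lfloor>c T $ i / s\<rfloor> + 2" using b by linarith+
      then show ?thesis using s by (simp add: field_simps)
    qed
    then show "y \<in> star Q" unfolding Qh star_hcube[OF s] by (simp add: hcube_def)
  qed
  moreover have "Q \<in> dyadic_cells"
    unfolding dyadic_cells_def Q_def s_def by blast
  ultimately show ?thesis using i m by blast
qed

lemma cubes_props:
  assumes "R \<in> cubes"
  shows "R \<in> sets lebesgue" "bounded R" "vol R > 0"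
proof -
  obtain a d where d: "0 < d" and Req: "R = cbox a (\<chi> i. a $ i + d)"
    using assms by (auto simp: cubes_def)
  show "R \<in> sets lebesgue" "bounded R" by (auto simp: Req)
  show "vol R > 0"
    using hcube_of_cube[OF d Req] measure_hcubes_pos by simp
qed

abbreviation locally_dominated ::
  "(real ^ 'n \<Rightarrow> real) \<Rightarrow> (real ^ 'n \<Rightarrow> ennreal) \<Rightarrow> real \<Rightarrow> real \<Rightarrow> (real ^ 'n) set \<Rightarrow> bool" where
  "locally_dominated w H \<kappa> K E \<equiv>
    \<forall>x\<in>E. 0 < w x \<and> (\<exists>R\<in>cubes. x \<in> R \<and> ennreal (w x) \<le> ennreal (K * max 1 (mass w R / vol R / w x) powr \<kappa> / vol R) * (nnint R H))"

abbreviation weak_bound :: "(real ^ 'n \<Rightarrow> real) \<Rightarrow> (real ^ 'n \<Rightarrow> real) \<Rightarrow> real \<Rightarrow> real \<Rightarrow> real \<Rightarrow> bool" where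
  "weak_bound u w \<kappa> K C \<equiv>
    \<forall>H\<in>borel_measurable lebesgue. \<forall>E. locally_dominated w H \<kappa> K E \<longrightarrow>
    (\<integral>\<^sup>+x\<in>E. ennreal (u x * w x) \<partial>lebesgue) \<le> ennreal C * pairing u H"

text \<open>\<open>E\<close> is an arbitrary set. It is covered by a countable union of measurable
  exceptional sets, and the integral is monotone, so measurability of the level set never has to be
  shown.\<close>

lemma mixed_weak_bound:
  fixes u w :: "real ^ 'n \<Rightarrow> real"
  assumes u: "u \<in> A_1" and w: "ample w"
  shows "\<exists>\<kappa>>0. \<forall>K>0. \<exists>C>0. weak_bound u w \<kappa> K C"
proof -
  note ww = ample_weight[OF w]
  define N where "N = CARD('n)"
  obtain c where c: "c > 0" "superset_bounded w (3 ^ N) c"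
    using ample_superset[OF w, of "3 ^ N"] by auto
  obtain \<kappa>0 where k0: "\<kappa>0 > 0" "\<forall>\<kappa> K. 0 < \<kappa> \<longrightarrow> \<kappa> < \<kappa>0 \<longrightarrow> 0 < K \<longrightarrow> (\<exists>C>0. family_bound countable (3 ^ N) (density lebesgue (\<lambda>x. ennreal (u x * w x))) K u w \<kappa> C)"
    using countable_family_bound[OF u w, of "3 ^ N"] by auto
  define \<kappa> where "\<kappa> = \<kappa>0 / 2"
  have \<kappa>: "0 < \<kappa>" "\<kappa> < \<kappa>0" using k0(1) by (auto simp: \<kappa>_def)
  have star3: "star_map (3 ^ N) (dyadic_cells :: (real ^ 'n) set set) star"
    unfolding N_def by (rule star_map_subset[OF star_map_star dyadic_cells_hcubes])
  have [measurable]: "w \<in> borel_measurable lebesgue" "u \<in> borel_measurable lebesgue"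
    using ww u by (auto intro: weight_measurable simp: A_1_def)
  \<comment> \<open>\<open>B\<close> compares averages of w: R lies in \<open>star Q\<close>, whose
    mass is at most c w(Q), and |Q| \<le> 2^n |R|.\<close>
  define B where "B = max 1 (2 ^ N * c)"
  have B: "B \<ge> 1" by (simp add: B_def)
  show ?thesis
  proof (rule exI[of _ \<kappa>], intro conjI \<kappa>(1) allI impI)
    fix K :: real assume K: "K > 0"
    \<comment> \<open>\<open>B powr \<kappa>\<close> pays for the change of averages, and 4^n for
      the choice of one cell among 2^n and for the ratio of volumes.\<close>
    define K' where "K' = K * B powr \<kappa> * 4 ^ N"
    have K': "K' > 0" using K B by (simp add: K'_def)
    obtain C where C: "C > 0" "family_bound countable (3 ^ N) (density lebesgue (\<lambda>x. ennreal (u x * w x))) K' u w \<kappa> C"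
      using k0(2)[THEN spec, THEN spec, THEN mp, THEN mp, THEN mp, OF \<kappa> K'] by blast
    have main: "(\<integral>\<^sup>+x\<in>E. ennreal (u x * w x) \<partial>lebesgue) \<le> ennreal C * pairing u H"
      if H: "H \<in> borel_measurable lebesgue" and E: "locally_dominated w H \<kappa> K E" for H E
    proof -
      define X where "X = (\<Union>Q\<in>dyadic_cells. exceed w H \<kappa> K' (star Q) Q)"
      have "E \<subseteq> X"
      proof
        fix x assume x: "x \<in> E"
        then have wx: "0 < w x" using E by blast
        obtain R where R: "R \<in> cubes" "x \<in> R" and le: "ennreal (w x) \<le>
          ennreal (K * max 1 (mass w R / vol R / w x) powr \<kappa> / vol R) * (nnint R H)"
          using E x by blast
        obtain Q where Q: "Q \<in> dyadic_cells" "R \<subseteq> star Q" "(nnint R H) \<le> ennreal (2 ^ N) * (nnint Q H)"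
          "vol Q \<le> 2 ^ N * vol R"
          using cube_dyadic_cell[OF R(1) H] unfolding N_def by blast
        have Qh: "Q \<in> hcubes" using Q(1) dyadic_cells_hcubes by blast
        note mR = cubes_props[OF R(1)]
        have mQ: "vol Q > 0" by (rule measure_hcubes_pos[OF Qh])
        have sQ: "star Q \<in> hcubes" "Q \<subseteq> star Q" "vol (star Q) \<le> 3 ^ N * vol Q"
          using star3 Q(1) by (auto simp: star_map_def)
        have "mass w R \<le> mass w (star Q)"
          by (rule mass_mono[OF ww bounded_hcubes[OF sQ(1)] mR(1) hcubes_sets[OF sQ(1)] Q(2)])
        also have "\<dots> \<le> c * mass w Q" by (rule c(2)[rule_format, OF Qh sQ])
        finally have "mass w R / vol R \<le> c * mass w Q / (vol Q / 2 ^ N)"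
          using Q(4) mQ mR c(1) by (intro frac_le) (auto simp: field_simps)
        also have "\<dots> = 2 ^ N * c * (mass w Q / vol Q)" by simp
        also have "\<dots> \<le> B * (mass w Q / vol Q)"
          by (intro mult_right_mono) (auto simp: B_def)
        finally have "mass w R / vol R / w x \<le> B * (mass w Q / vol Q) / w x"
          using wx by (intro divide_right_mono) auto
        also have "\<dots> \<le> B * max 1 (mass w Q / vol Q / w x)"
        proof -
          have "B * (mass w Q / vol Q / w x) \<le> B * max 1 (mass w Q / vol Q / w x)"
            using B by (intro mult_left_mono) auto
          then show ?thesis by simp
        qed
        finally have "max 1 (mass w R / vol R / w x) \<le> B * max 1 (mass w Q / vol Q / w x)"
          using B mult_mono[of 1 B 1 "max 1 (mass w Q / vol Q / w x)"] by simp
        then have "max 1 (mass w R / vol R / w x) powr \<kappa> \<le> (B * max 1 (mass w Q / vol Q / w x)) powr \<kappa>"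
          using \<kappa> by (intro powr_mono2) auto
        also have "\<dots> = B powr \<kappa> * max 1 (mass w Q / vol Q / w x) powr \<kappa>"
          by (rule powr_mult)
        finally have p: "max 1 (mass w R / vol R / w x) powr \<kappa> \<le> B powr \<kappa> * max 1 (mass w Q / vol Q / w x) powr \<kappa>" .
        define Y where "Y = max 1 (mass w Q / vol Q / w x) powr \<kappa>"
        have "K * max 1 (mass w R / vol R / w x) powr \<kappa> / vol R \<le> K * (B powr \<kappa> * Y) / (vol Q / 2 ^ N)"
          using p Q(4) mQ mR K by (intro frac_le mult_left_mono) (auto simp: field_simps Y_def)
        then have "ennreal (w x) \<le> ennreal (K * (B powr \<kappa> * Y) / (vol Q / 2 ^ N)) * (ennreal (2 ^ N) * (nnint Q H))"
          by (intro order_trans[OF le] mult_mono ennreal_leI Q(3)) auto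
        also have "\<dots> = ennreal (K * (B powr \<kappa> * Y) / (vol Q / 2 ^ N) * 2 ^ N) * (nnint Q H)"
          using K mQ by (subst ennreal_mult) (auto simp: Y_def mult.assoc)
        also have "K * (B powr \<kappa> * Y) / (vol Q / 2 ^ N) * 2 ^ N = K' * Y / vol Q"
        proof -
          have "(4::real) ^ N = 2 ^ N * 2 ^ N" by (simp add: power_mult_distrib[symmetric])
          then show ?thesis by (simp add: K'_def)
        qed
        finally have "x \<in> exceed w H \<kappa> K' (star Q) Q"
          using wx R(2) Q(2) by (auto simp: exceed_def Y_def)
        then show "x \<in> X" using Q(1) by (auto simp: X_def)
      qed
      have Xs: "X \<in> sets lebesgue"
      proof -
        have "exceed w H \<kappa> K' (star Q) Q \<in> sets lebesgue" if "Q \<in> dyadic_cells" for Q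
        proof -
          have "star Q \<in> hcubes" using star3 that by (simp add: star_map_def)
          then show ?thesis
            by (intro exceed_sets[OF ww] hcubes_sets)
        qed
        then show ?thesis
          unfolding X_def by (intro sets.countable_UN'' countable_dyadic_cells)
      qed
      have "(\<integral>\<^sup>+x\<in>E. ennreal (u x * w x) \<partial>lebesgue) \<le> (\<integral>\<^sup>+x\<in>X. ennreal (u x * w x) \<partial>lebesgue)"
        using \<open>E \<subseteq> X\<close> by (intro nn_integral_mono) (auto simp: indicator_def)
      also have "\<dots> = emeasure (density lebesgue (\<lambda>x. ennreal (u x * w x))) X"
        using Xs by (subst emeasure_density) auto
      also have "\<dots> \<le> ennreal C * pairing u H"
        unfolding X_def
        by (rule C(2)[rule_format, OF countable_dyadic_cells dyadic_cells_hcubes laminar_dyadic_cells star3 H])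
      finally show ?thesis .
    qed
    show "\<exists>C>0. weak_bound u w \<kappa> K C"
      using C(1) main by (intro exI[of _ C] conjI ballI allI impI)
  qed
qed

subsection \<open>Luxemburg averages\<close>

lemma one_plus_ln_powr_bound:
  fixes \<delta> a :: real
  assumes "\<delta> \<ge> 0" "a > 0"
  shows "\<exists>C\<ge>1. \<forall>y\<ge>1. (1 + ln y) powr \<delta> \<le> C * y powr a"
proof -
  \<comment> \<open>Then p \<delta> \<le> a; the summand 1 covers \<delta> = 0.\<close>
  define p where "p = a / (\<delta> + 1)"
  have p: "p > 0" "p * \<delta> \<le> a"
    using assms by (auto simp: p_def field_simps)
  define C where "C = (1 + 1 / p) powr \<delta>"
  have C: "C \<ge> 1" using p assms by (auto simp: C_def ge_one_powr_ge_zero)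
  have "(1 + ln y) powr \<delta> \<le> C * y powr a" if y: "y \<ge> 1" for y
  proof -
    have "1 + ln y \<le> y powr p + y powr p / p"
      using ln_powr_bound[OF y p(1)] ge_one_powr_ge_zero[OF y, of p] p(1) by linarith
    then have "1 + ln y \<le> (1 + 1 / p) * y powr p"
      by (simp add: algebra_simps)
    then have "(1 + ln y) powr \<delta> \<le> ((1 + 1 / p) * y powr p) powr \<delta>"
      using y assms by (intro powr_mono2) auto
    also have "\<dots> = C * y powr (p * \<delta>)"
      by (simp add: C_def powr_mult powr_powr)
    also have "\<dots> \<le> C * y powr a"
      using y p C by (intro mult_left_mono powr_mono) auto
    finally show ?thesis .
  qed
  then show ?thesis using C by blast
qed

abbreviation log_split :: "real \<Rightarrow> real \<Rightarrow> real \<Rightarrow> real \<Rightarrow> bool" where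
  "log_split \<delta> \<kappa> e C \<equiv> \<forall>c z B. 0 < c \<longrightarrow> c \<le> 1 \<longrightarrow> 0 \<le> z \<longrightarrow> 1 \<le> B \<longrightarrow>
    z * (1 + ln B) powr \<delta> \<le> C * c powr (- \<kappa>) * (z * (1 + log_plus z) powr \<delta>) + c * B powr e"

text \<open>A substitute for Young's inequality between \<open>L log L\<close> and exponential growth; \<open>c\<close> is kept as a
  parameter because it has to absorb powers of the ratio of an average of \<open>w\<close> to a value of \<open>w\<close>.\<close>

lemma log_weight_split:
  fixes \<delta> e \<kappa> :: real
  assumes "\<delta> \<ge> 0" "e > 0" "\<kappa> > 0"
  shows "\<exists>C\<ge>1. log_split \<delta> \<kappa> e C"
proof -
  obtain C1 where C1: "C1 \<ge> 1" "\<forall>y\<ge>1. (1 + ln y) powr \<delta> \<le> C1 * y powr (e / 2)"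
    using one_plus_ln_powr_bound[OF assms(1), of "e / 2"] assms by auto
  obtain C2 where C2: "C2 \<ge> 1" "\<forall>y\<ge>1. (1 + ln y) powr \<delta> \<le> C2 * y powr \<kappa>"
    using one_plus_ln_powr_bound[OF assms(1,3)] by auto
  define A where "A = 1 + 2 / e * (ln C1 + 1)"
  have lC1: "ln C1 \<ge> 0" using C1(1) by simp
  have A: "A \<ge> 1" using lC1 assms by (simp add: A_def)
  define C where "C = A powr \<delta> * C2"
  have A1: "A powr \<delta> \<ge> 1" using A assms by (simp add: ge_one_powr_ge_zero)
  have C: "C \<ge> 1" using mult_mono[OF A1 C2(1)] by (simp add: C_def)
  have "z * (1 + ln B) powr \<delta> \<le> C * c powr (- \<kappa>) * (z * (1 + log_plus z) powr \<delta>) + c * B powr e"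
    if c: "0 < c" "c \<le> 1" and z: "0 \<le> z" and B: "1 \<le> B" for c z B
  proof (cases "z \<le> c / C1 * B powr (e / 2)")
    \<comment> \<open>When z is small compared with a power of B, half of the exponent e absorbs the
      logarithm and the other half bounds z.\<close>
    case True
    have "z * (1 + ln B) powr \<delta> \<le> (c / C1 * B powr (e / 2)) * (C1 * B powr (e / 2))"
      using True z C1 B c by (intro mult_mono) auto
    also have "\<dots> = c * (B powr (e / 2) * B powr (e / 2))"
      using C1(1) by simp
    also have "\<dots> = c * B powr e"
      unfolding powr_add[symmetric] by simp
    finally show ?thesis
      using C c z by (intro add_increasing) auto
  next
    case False
    \<comment> \<open>Otherwise B is at most a power of z / c, so ln B is controlled by ln z and
      ln(1 / c); the power of the latter is at most a multiple of c^(-\<kappa>).\<close>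
    define q where "q = ln (1 / c)"
    have q: "q \<ge> 0" using c by (simp add: q_def)
    have lp: "log_plus z \<ge> 0" "ln z \<le> log_plus z" by (auto simp: log_plus_def)
    have Bz: "B powr (e / 2) < C1 * z / c"
      using False c C1(1) by (simp add: field_simps)
    have zpos: "z > 0"
    proof (rule ccontr)
      assume "\<not> z > 0"
      then have "z = 0" using z by simp
      then show False using Bz by simp
    qed
    have "ln (B powr (e / 2)) < ln (C1 * z / c)"
      using Bz B C1(1) c zpos by (subst ln_less_cancel_iff) auto
    then have "e / 2 * ln B < ln C1 + ln z + q"
      using B C1(1) c zpos by (simp add: ln_powr ln_mult ln_div q_def)
    then have "ln B \<le> 2 / e * (ln C1 + log_plus z + q)"
      using assms(2) lp by (simp add: field_simps)
    also have "\<dots> \<le> 2 / e * ((ln C1 + 1) * (1 + log_plus z + q))"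
    proof (rule mult_left_mono)
      have "0 \<le> ln C1 * (log_plus z + q)" using lC1 lp q by simp
      then show "ln C1 + log_plus z + q \<le> (ln C1 + 1) * (1 + log_plus z + q)"
        by (simp add: algebra_simps)
    qed (use assms in simp)
    also have "\<dots> = (A - 1) * (1 + log_plus z + q)"
      by (simp add: A_def)
    finally have "1 + ln B \<le> A * (1 + log_plus z + q)"
      using lp q by (simp add: algebra_simps)
    also have "\<dots> \<le> A * ((1 + log_plus z) * (1 + q))"
      using A lp q by (intro mult_left_mono) (auto simp: algebra_simps)
    finally have "(1 + ln B) powr \<delta> \<le> (A * ((1 + log_plus z) * (1 + q))) powr \<delta>"
      using B assms by (intro powr_mono2) auto
    also have "\<dots> = A powr \<delta> * ((1 + log_plus z) powr \<delta> * (1 + q) powr \<delta>)"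
      by (simp add: powr_mult)
    also have "\<dots> \<le> A powr \<delta> * ((1 + log_plus z) powr \<delta> * (C2 * c powr (- \<kappa>)))"
    proof (intro mult_left_mono)
      have "(1 + ln (1 / c)) powr \<delta> \<le> C2 * (1 / c) powr \<kappa>"
        using C2(2) c by simp
      then show "(1 + q) powr \<delta> \<le> C2 * c powr (- \<kappa>)"
        using c by (simp add: q_def powr_divide powr_minus_divide)
    qed auto
    finally have "z * (1 + ln B) powr \<delta> \<le> z * (A powr \<delta> * ((1 + log_plus z) powr \<delta> * (C2 * c powr (- \<kappa>))))"
      using z by (rule mult_left_mono)
    also have "\<dots> = C * c powr (- \<kappa>) * (z * (1 + log_plus z) powr \<delta>)"
      by (simp add: C_def mult_ac)
    finally show ?thesis using c by (intro add_increasing2) auto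
  qed
  then show ?thesis using C by blast
qed

lemma young_function_mono: "young_function \<Phi> \<Longrightarrow> 0 \<le> s \<Longrightarrow> s \<le> t \<Longrightarrow> \<Phi> s \<le> \<Phi> t"
  unfolding young_function_def by (elim conjE, erule mono_onD) auto

text \<open>With \<open>1 + ln b\<close> instead of \<open>ln b\<close> the bound extends down to b
  = 1, since both powers are then at least 1 and \<open>\<Phi> t0\<close> can go into the
  constant.\<close>

lemma young_class_growth:
  assumes "\<Phi> \<in> young_class r \<delta>" "\<delta> \<ge> 0" "r \<ge> 1"
  shows "\<exists>C>0. \<forall>b\<ge>1. \<Phi> b \<le> C * b powr r * (1 + ln b) powr \<delta>"
proof -
  have Y: "young_function \<Phi>" using assms by (simp add: young_class_def)
  obtain C0 t0 where C0: "C0 > 0" "t0 \<ge> 1" "\<forall>t\<ge>t0. \<Phi> t / t powr r \<le> C0 * ln t powr \<delta>"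
    using assms by (auto simp: young_class_def)
  have p0: "\<Phi> t0 \<ge> 0" using Y C0 by (simp add: young_function_def)
  have "\<Phi> b \<le> (C0 + \<Phi> t0) * b powr r * (1 + ln b) powr \<delta>" if b: "b \<ge> 1" for b
  proof (cases "b \<ge> t0")
    case True
    have "\<Phi> b \<le> C0 * ln b powr \<delta> * b powr r"
      using C0(3) True b by (simp add: divide_le_eq)
    also have "\<dots> \<le> (C0 + \<Phi> t0) * (1 + ln b) powr \<delta> * b powr r"
      using C0 p0 b assms by (intro mult_right_mono mult_mono powr_mono2) auto
    finally show ?thesis by (simp add: mult_ac)
  next
    case False
    have "\<Phi> b \<le> \<Phi> t0"
      using False b by (intro young_function_mono[OF Y]) auto
    also have "\<dots> \<le> (C0 + \<Phi> t0) * (1 * 1)" using C0 by simp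
    also have "\<dots> \<le> (C0 + \<Phi> t0) * (b powr r * (1 + ln b) powr \<delta>)"
      using C0 p0 b assms by (intro mult_left_mono mult_mono ge_one_powr_ge_zero) auto
    finally show ?thesis by (simp add: mult_ac)
  qed
  then show ?thesis using C0 p0 by (intro exI[of _ "C0 + \<Phi> t0"]) auto
qed

text \<open>For \<epsilon> \<le> 1 the exponent \<delta> / \<epsilon> is at least the \<delta> that
  the growth bound produces.\<close>

lemma eta_lower_bounds:
  assumes "0 < \<epsilon>" "\<epsilon> \<le> 1" "\<delta> \<ge> 0" "z \<ge> 0"
  shows "z * (1 + log_plus z) powr \<delta> \<le> eta \<delta> \<epsilon> z" "z \<le> eta \<delta> \<epsilon> z"
proof -
  have l: "1 + log_plus z \<ge> 1" by (simp add: log_plus_def)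
  have d: "\<delta> \<le> \<delta> / \<epsilon>"
    using assms by (simp add: le_divide_eq mult_left_le)
  show "z * (1 + log_plus z) powr \<delta> \<le> eta \<delta> \<epsilon> z"
    unfolding eta_def using l d assms by (intro mult_left_mono powr_mono) auto
  have "z * 1 \<le> z * (1 + log_plus z) powr (\<delta> / \<epsilon>)"
    using l assms by (intro mult_left_mono ge_one_powr_ge_zero) auto
  then show "z \<le> eta \<delta> \<epsilon> z" by (simp add: eta_def)
qed

text \<open>To be used with s = |f(y)| / t and b = v(y) / v(x), so that b^r = w(y) / w(x). For b
  \<le> 1 lower type suffices. For b > 1 submultiplicativity and growth leave \<Phi>(s) B (1 + ln
  B)^\<delta> with B = b^r; splitting off the logarithm produces B^(1+e), which the reverse Hoelder
  inequality can integrate.\<close>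

lemma young_product_split:
  assumes Phi: "\<Phi> \<in> young_class r \<delta>" and r: "r \<ge> 1" and \<delta>: "\<delta> \<ge> 0"
    and \<epsilon>: "0 < \<epsilon>" "\<epsilon> \<le> 1" and e: "e > 0" and \<kappa>: "\<kappa> > 0"
  shows "\<exists>C>0. \<forall>c s b. 0 < c \<longrightarrow> c \<le> 1 \<longrightarrow> 0 \<le> s \<longrightarrow> 0 \<le> b \<longrightarrow>
    \<Phi> (s * b) \<le> C * c powr (- \<kappa>) * (eta \<delta> \<epsilon> (\<Phi> s) * b powr r) + C * c * (b powr r) powr (1 + e)"
proof -
  have Y: "young_function \<Phi>" and sub: "submultiplicative \<Phi>" and lt: "lower_type r \<Phi>"
    using Phi by (auto simp: young_class_def)
  have P0: "\<Phi> 0 = 0" and Ppos: "\<And>t. t \<ge> 0 \<Longrightarrow> \<Phi> t \<ge> 0"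
    using Y by (auto simp: young_function_def)
  obtain C1 where C1: "C1 > 0" "\<forall>s t. 0 < s \<and> s \<le> 1 \<and> 0 < t \<longrightarrow> \<Phi> (s * t) \<le> C1 * s powr r * \<Phi> t"
    using lt by (auto simp: lower_type_def)
  obtain C2 where C2: "C2 > 0" "\<forall>b\<ge>1. \<Phi> b \<le> C2 * b powr r * (1 + ln b) powr \<delta>"
    using young_class_growth[OF Phi \<delta> r] by auto
  obtain C3 where C3: "C3 \<ge> 1" "log_split \<delta> \<kappa> e C3"
    using log_weight_split[OF \<delta> e \<kappa>] by auto
  define C where "C = C1 + C2 * C3"
  have "C2 * 1 \<le> C2 * C3" using C2(1) C3(1) by (intro mult_left_mono) auto
  then have C: "C > 0" "C1 \<le> C" "C2 * C3 \<le> C" "C2 \<le> C"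
    using C1(1) C2(1) unfolding C_def by linarith+
  have "\<Phi> (s * b) \<le> C * c powr (- \<kappa>) * (eta \<delta> \<epsilon> (\<Phi> s) * b powr r) + C * c * (b powr r) powr (1 + e)"
    if c: "0 < c" "c \<le> 1" and s: "0 \<le> s" and b: "0 \<le> b" for c s b
  proof -
    define z where "z = \<Phi> s"
    have z: "z \<ge> 0" using Ppos s by (simp add: z_def)
    note et = eta_lower_bounds[OF \<epsilon> \<delta> z]
    have e0: "eta \<delta> \<epsilon> z \<ge> 0" using et(2) z by linarith
    have n1: "0 \<le> C * c powr (- \<kappa>) * (eta \<delta> \<epsilon> z * b powr r)" and n2: "0 \<le> C * c * (b powr r) powr (1 + e)"
      using C c e0 by auto
    have ck: "c powr (- \<kappa>) \<ge> 1"
      using powr_mono2'[of "- \<kappa>" c 1] c \<kappa> by simp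
    consider "s = 0 \<or> b = 0" | "0 < s" "0 < b" "b \<le> 1" | "0 < s" "1 < b"
      using s b by fastforce
    then have "\<Phi> (s * b) \<le> C * c powr (- \<kappa>) * (eta \<delta> \<epsilon> z * b powr r) + C * c * (b powr r) powr (1 + e)"
    proof cases
      case 1
      then have "\<Phi> (s * b) = 0" using P0 by auto
      then show ?thesis using n1 n2 by linarith
    next
      case 2
      have "\<Phi> (s * b) \<le> C1 * b powr r * z"
        using C1(2) 2 unfolding z_def by (metis mult.commute)
      also have "\<dots> = C1 * 1 * (z * b powr r)" by simp
      also have "\<dots> \<le> C * c powr (- \<kappa>) * (eta \<delta> \<epsilon> z * b powr r)"
        using C C1 ck et z by (intro mult_mono) auto
      finally show ?thesis using n2 by linarith
    next
      case 3
      define B where "B = b powr r"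
      have B: "B \<ge> 1" using 3 r by (simp add: B_def ge_one_powr_ge_zero)
      have "ln b * 1 \<le> ln b * r" using 3 r by (intro mult_left_mono) auto
      then have lnB: "ln b \<le> ln B" using 3 by (simp add: B_def ln_powr mult.commute)
      have "\<Phi> (s * b) \<le> z * \<Phi> b"
        using sub 3 unfolding submultiplicative_def z_def by auto
      also have "\<dots> \<le> z * (C2 * B * (1 + ln B) powr \<delta>)"
      proof (rule mult_left_mono[OF _ z])
        have "\<Phi> b \<le> C2 * B * (1 + ln b) powr \<delta>" using C2(2) 3 by (simp add: B_def)
        also have "\<dots> \<le> C2 * B * (1 + ln B) powr \<delta>"
          using C2(1) B lnB 3 \<delta> by (intro mult_left_mono powr_mono2) auto
        finally show "\<Phi> b \<le> C2 * B * (1 + ln B) powr \<delta>" .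
      qed
      also have "\<dots> = C2 * B * (z * (1 + ln B) powr \<delta>)" by simp
      also have "\<dots> \<le> C2 * B * (C3 * c powr (- \<kappa>) * eta \<delta> \<epsilon> z + c * B powr e)"
      proof (rule mult_left_mono)
        have "z * (1 + ln B) powr \<delta> \<le> C3 * c powr (- \<kappa>) * (z * (1 + log_plus z) powr \<delta>) + c * B powr e"
          using C3(2) c z B by blast
        also have "\<dots> \<le> C3 * c powr (- \<kappa>) * eta \<delta> \<epsilon> z + c * B powr e"
          using et(1) C3(1) by (intro add_right_mono mult_left_mono) auto
        finally show "z * (1 + ln B) powr \<delta> \<le> C3 * c powr (- \<kappa>) * eta \<delta> \<epsilon> z + c * B powr e" .
      qed (use C2 B in auto)
      also have "\<dots> = C2 * C3 * (c powr (- \<kappa>) * (eta \<delta> \<epsilon> z * B)) + C2 * (c * B powr (1 + e))"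
        using B by (simp add: powr_add algebra_simps)
      also have "\<dots> \<le> C * (c powr (- \<kappa>) * (eta \<delta> \<epsilon> z * B)) + C * (c * B powr (1 + e))"
        using C e0 B c by (intro add_mono mult_right_mono) auto
      finally show ?thesis by (simp add: B_def mult_ac)
    qed
    then show ?thesis by (simp add: z_def)
  qed
  then show ?thesis using C(1) by blast
qed

section \<open>Pointwise consequence of a large Luxemburg average\<close>

lemma cubes_reverse_hoelder:
  fixes w :: "real ^ 'n \<Rightarrow> real"
  assumes w: "ample w"
  shows "\<exists>C>0. \<exists>e>0. reverse_hoelder cubes w C e"
proof -
  note ww = ample_weight[OF w]
  obtain C e where C: "C > 0" "e > 0" "reverse_hoelder hcubes w C e"
    using ample_reverse_hoelder[OF w] by auto
  have "(\<integral>\<^sup>+x\<in>R. ennreal (w x powr (1 + e)) \<partial>lebesgue) \<le>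
    ennreal (C * (mass w R / vol R) powr (1 + e) * vol R)" if R: "R \<in> cubes" for R
  proof -
    obtain a d where d: "0 < d" and Req: "R = cbox a (\<chi> i. a $ i + d)"
      using R by (auto simp: cubes_def)
    define Q where "Q = hcube a d"
    note Q = hcube_of_cube(1)[OF d Req, folded Q_def] and QR = hcube_of_cube(2)[OF d Req, folded Q_def]
      and null = hcube_of_cube(3)[OF d Req, folded Q_def] and m = hcube_of_cube(4)[OF d Req, folded Q_def]
    have "(\<integral>\<^sup>+x\<in>R. ennreal (w x powr (1 + e)) \<partial>lebesgue) = (\<integral>\<^sup>+x\<in>Q. ennreal (w x powr (1 + e)) \<partial>lebesgue)"
    proof (rule nn_integral_cong_AE)
      have "AE x in lebesgue. x \<notin> R - Q" using null by (rule AE_not_in)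
      then show "AE x in lebesgue. ennreal (w x powr (1 + e)) * indicator R x = ennreal (w x powr (1 + e)) * indicator Q x"
        using QR by (auto elim!: eventually_mono simp: indicator_def)
    qed
    also have "\<dots> \<le> ennreal (C * (mass w Q / vol Q) powr (1 + e) * vol Q)"
      using C(3) Q by blast
    also have "\<dots> \<le> ennreal (C * (mass w R / vol R) powr (1 + e) * vol R)"
      unfolding m using C(1,2) mass_mono[OF ww cubes_props(2)[OF R] hcubes_sets[OF Q] cubes_props(1)[OF R] QR]
      by (intro ennreal_leI mult_right_mono mult_left_mono powr_mono2 divide_right_mono) auto
    finally show ?thesis .
  qed
  then show ?thesis using C(1,2) by blast
qed

lemma young_measurable:
  assumes "young_function \<Phi>" "g \<in> borel_measurable M" "\<And>x. 0 \<le> g x"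
  shows "(\<lambda>x. \<Phi> (g x)) \<in> borel_measurable M"
proof -
  have "mono (\<lambda>t. \<Phi> (max 0 t))"
    by (intro monoI young_function_mono[OF assms(1)]) auto
  then have [measurable]: "(\<lambda>t. \<Phi> (max 0 t)) \<in> borel_measurable borel"
    by (rule borel_measurable_mono)
  have "(\<lambda>x. \<Phi> (max 0 (g x))) \<in> borel_measurable M"
    using assms(2) by measurable
  then show ?thesis using assms(3) by (simp add: max_absorb2)
qed

abbreviation luxemburg_dominated :: "(real \<Rightarrow> real) \<Rightarrow> real \<Rightarrow> real \<Rightarrow> (real ^ 'n \<Rightarrow> real) \<Rightarrow> (real ^ 'n \<Rightarrow> real) \<Rightarrow> real \<Rightarrow> real \<Rightarrow> bool" where
  "luxemburg_dominated \<Phi> \<delta> \<epsilon> v w \<kappa> K \<equiv> \<forall>t>0. \<forall>f\<in>borel_measurable lebesgue. \<forall>R\<in>cubes. \<forall>x. 0 < v x \<longrightarrow>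
    ennreal (t * v x) < luxemburg \<Phi> R (\<lambda>y. f y * v y) \<longrightarrow>
    ennreal (w x) \<le> ennreal (K * max 1 (mass w R / vol R / w x) powr \<kappa> / vol R) *
      (\<integral>\<^sup>+y\<in>R. ennreal (eta \<delta> \<epsilon> (\<Phi> (\<bar>f y\<bar> / t)) * w y) \<partial>lebesgue)"

text \<open>The parameter c in the product split is chosen, depending on x and R, so that the
  reverse Hoelder term uses up at most half of |R|. The other half must then come from the main
  term, and solving for w(x) gives the bound.\<close>

lemma luxemburg_pointwise_bound:
  fixes v :: "real ^ 'n \<Rightarrow> real"
  assumes Phi: "\<Phi> \<in> young_class r \<delta>" and r: "r \<ge> 1" and \<delta>: "\<delta> \<ge> 0"
    and \<epsilon>: "0 < \<epsilon>" "\<epsilon> \<le> 1" and v: "weight v" and w: "ample (\<lambda>x. v x powr r)" and \<kappa>: "\<kappa> > 0"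
  shows "\<exists>K>0. luxemburg_dominated \<Phi> \<delta> \<epsilon> v (\<lambda>x. v x powr r) \<kappa> K"
proof -
  define w where "w = (\<lambda>x. v x powr r)"
  have aw: "ample w" using assms(7) by (simp add: w_def)
  note ww = ample_weight[OF aw]
  have [measurable]: "v \<in> borel_measurable lebesgue" "w \<in> borel_measurable lebesgue"
    using v ww by (auto intro: weight_measurable)
  have Y: "young_function \<Phi>" using Phi by (simp add: young_class_def)
  have Ppos: "\<And>t. t \<ge> 0 \<Longrightarrow> \<Phi> t \<ge> 0"
    using Y by (auto simp: young_function_def)
  obtain C4 e where C4: "C4 > 0" "e > 0" "reverse_hoelder cubes w C4 e"
    using cubes_reverse_hoelder[OF aw] by auto
  \<comment> \<open>Since c is of the order of X^(-(1+e)) below, its power with exponent -\<kappa>'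
    is of the order of X^\<kappa>.\<close>
  define \<kappa>' where "\<kappa>' = \<kappa> / (1 + e)"
  have \<kappa>': "\<kappa>' > 0" using \<kappa> C4 by (simp add: \<kappa>'_def)
  obtain C3 where C3: "C3 > 0" "\<forall>c s b. 0 < c \<longrightarrow> c \<le> 1 \<longrightarrow> 0 \<le> s \<longrightarrow> 0 \<le> b \<longrightarrow>
    \<Phi> (s * b) \<le> C3 * c powr (- \<kappa>') * (eta \<delta> \<epsilon> (\<Phi> s) * b powr r) + C3 * c * (b powr r) powr (1 + e)"
    using young_product_split[OF Phi r \<delta> \<epsilon> C4(2) \<kappa>'] by auto
  \<comment> \<open>Large enough that the reverse Hoelder term is at most |R| / 2.\<close>
  define A where "A = 2 * (1 + C3 * C4)"
  have "C3 * C4 > 0" using C3(1) C4(1) by simp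
  then have A: "A \<ge> 1" "C3 * C4 / A \<le> 1 / 2" unfolding A_def by (auto simp: divide_le_eq)
  define K where "K = 2 * C3 * A powr \<kappa>'"
  have K: "K > 0" using C3 A by (simp add: K_def)
  have "ennreal (w x) \<le> ennreal (K * max 1 (mass w R / vol R / w x) powr \<kappa> / vol R) *
      (\<integral>\<^sup>+y\<in>R. ennreal (eta \<delta> \<epsilon> (\<Phi> (\<bar>f y\<bar> / t)) * w y) \<partial>lebesgue)"
    if t: "t > 0" and f: "f \<in> borel_measurable lebesgue" and R: "R \<in> cubes" and vx: "0 < v x"
      and lux: "ennreal (t * v x) < luxemburg \<Phi> R (\<lambda>y. f y * v y)" for t f R x
  proof -
    note [measurable] = f cubes_props(1)[OF R]
    have mR: "vol R > 0" by (rule cubes_props(3)[OF R])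
    have eR: "emeasure lebesgue R = ennreal (vol R)"
    proof -
      have "R \<in> lmeasurable" using R by (auto simp: cubes_def)
      then show ?thesis by (rule emeasure_eq_measure2)
    qed
    have wx: "w x > 0" using vx by (simp add: w_def)
    define X where "X = max 1 (mass w R / vol R / w x)"
    have X: "X \<ge> 1" by (simp add: X_def)
    \<comment> \<open>The power of \<open>X\<close> compensates the factor (average of w /
      w(x))^(1+e) from the reverse Hoelder inequality.\<close>
    define c where "c = 1 / A * X powr (- (1 + e))"
    have c: "0 < c" "c \<le> 1"
    proof -
      show "0 < c" using A X by (simp add: c_def)
      have "X powr (- (1 + e)) \<le> 1" using powr_mono2'[of "- (1 + e)" 1 X] X C4(2) by simp
      then have "1 / A * X powr (- (1 + e)) \<le> 1 * 1" using A by (intro mult_mono) auto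
      then show "c \<le> 1" by (simp add: c_def)
    qed
    have ck: "c powr (- \<kappa>') = A powr \<kappa>' * X powr \<kappa>"
    proof -
      have "c powr (- \<kappa>') = (1 / A) powr (- \<kappa>') * (X powr (- (1 + e))) powr (- \<kappa>')"
        unfolding c_def by (rule powr_mult)
      also have "(1 / A) powr (- \<kappa>') = A powr \<kappa>'"
        using A by (simp add: powr_divide powr_minus)
      also have "(X powr (- (1 + e))) powr (- \<kappa>') = X powr \<kappa>"
      proof -
        have "- (1 + e) * - \<kappa>' = \<kappa>" using C4(2) by (simp add: \<kappa>'_def divide_simps) (simp add: algebra_simps)
        then show ?thesis by (simp only: powr_powr)
      qed
      finally show ?thesis .
    qed
    define g where "g y = eta \<delta> \<epsilon> (\<Phi> (\<bar>f y\<bar> / t))" for y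
    have g: "g y \<ge> 0" for y
      using eta_lower_bounds(2)[OF \<epsilon> \<delta>, of "\<Phi> (\<bar>f y\<bar> / t)"] Ppos[of "\<bar>f y\<bar> / t"] t by (simp add: g_def)
    have [measurable]: "(\<lambda>y. \<Phi> (\<bar>f y\<bar> / t)) \<in> borel_measurable lebesgue"
      using t by (intro young_measurable[OF Y]) auto
    have [measurable]: "g \<in> borel_measurable lebesgue"
      unfolding g_def eta_def log_plus_def by measurable
    define I where "I = (\<integral>\<^sup>+y\<in>R. ennreal (g y * w y) \<partial>lebesgue)"
    define P where "P = (\<integral>\<^sup>+y\<in>R. ennreal (\<Phi> (\<bar>f y * v y\<bar> / (t * v x))) \<partial>lebesgue)"
    \<comment> \<open>The number t v(x) lies below the Luxemburg infimum, so it is not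
      admissible.\<close>
    have "\<not> P / emeasure lebesgue R \<le> 1"
    proof
      assume "P / emeasure lebesgue R \<le> 1"
      then have "ennreal (t * v x) \<in> {ennreal l | l. 0 < l \<and>
          (\<integral>\<^sup>+y\<in>R. ennreal (\<Phi> (\<bar>f y * v y\<bar> / l)) \<partial>lebesgue) / emeasure lebesgue R \<le> 1}"
        using t vx unfolding P_def by auto
      then have "luxemburg \<Phi> R (\<lambda>y. f y * v y) \<le> ennreal (t * v x)"
        unfolding luxemburg_def by (rule Inf_lower)
      then show False using lux by simp
    qed
    then have RP: "ennreal (vol R) \<le> P"
      using divide_le_posI_ennreal[of "emeasure lebesgue R" P 1] mR
      unfolding eR by (cases "P \<le> ennreal (vol R)") auto
    have pt: "\<Phi> (\<bar>f y * v y\<bar> / (t * v x)) \<le> C3 * c powr (- \<kappa>') / w x * (g y * w y) + C3 * c / w x powr (1 + e) * w y powr (1 + e)" for y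
    proof -
      have vy: "v y \<ge> 0" by (rule weight_nonneg[OF v])
      have eq: "\<bar>f y * v y\<bar> / (t * v x) = (\<bar>f y\<bar> / t) * (v y / v x)"
        using vy by (simp add: abs_mult)
      have B: "(v y / v x) powr r = w y / w x"
        using vy vx by (simp add: w_def powr_divide)
      have "\<Phi> ((\<bar>f y\<bar> / t) * (v y / v x)) \<le> C3 * c powr (- \<kappa>') * (g y * (v y / v x) powr r) + C3 * c * ((v y / v x) powr r) powr (1 + e)"
        unfolding g_def using t vx vy by (intro C3(2)[rule_format] c) auto
      then show ?thesis
        unfolding eq B using weight_nonneg[OF ww, of y] wx by (simp add: powr_divide)
    qed
    have "P \<le> (\<integral>\<^sup>+y. ennreal (C3 * c powr (- \<kappa>') / w x) * (ennreal (g y * w y) * indicator R y)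
        + ennreal (C3 * c / w x powr (1 + e)) * (ennreal (w y powr (1 + e)) * indicator R y) \<partial>lebesgue)"
      unfolding P_def
    proof (rule nn_integral_mono)
      fix y
      have "ennreal (\<Phi> (\<bar>f y * v y\<bar> / (t * v x))) \<le> ennreal (C3 * c powr (- \<kappa>') / w x * (g y * w y) + C3 * c / w x powr (1 + e) * w y powr (1 + e))"
        by (rule ennreal_leI[OF pt])
      also have "\<dots> = ennreal (C3 * c powr (- \<kappa>') / w x * (g y * w y)) + ennreal (C3 * c / w x powr (1 + e) * w y powr (1 + e))"
        using C3(1) c wx g[of y] weight_nonneg[OF ww, of y] by (intro ennreal_plus) auto
      also have "\<dots> = ennreal (C3 * c powr (- \<kappa>') / w x) * ennreal (g y * w y) + ennreal (C3 * c / w x powr (1 + e)) * ennreal (w y powr (1 + e))"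
        using C3(1) c wx by (subst (1 2) ennreal_mult') auto
      finally show "ennreal (\<Phi> (\<bar>f y * v y\<bar> / (t * v x))) * indicator R y \<le> ennreal (C3 * c powr (- \<kappa>') / w x) * (ennreal (g y * w y) * indicator R y)
        + ennreal (C3 * c / w x powr (1 + e)) * (ennreal (w y powr (1 + e)) * indicator R y)"
        by (cases "y \<in> R") auto
    qed
    also have "\<dots> = ennreal (C3 * c powr (- \<kappa>') / w x) * I + ennreal (C3 * c / w x powr (1 + e)) * (\<integral>\<^sup>+y\<in>R. ennreal (w y powr (1 + e)) \<partial>lebesgue)"
      unfolding I_def by (subst nn_integral_add) (auto simp: nn_integral_cmult)
    also have "\<dots> \<le> ennreal (C3 * c powr (- \<kappa>') / w x) * I + ennreal (vol R / 2)"
    proof (rule add_left_mono)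
      define W where "W = mass w R / vol R"
      have W: "W \<ge> 0" by (simp add: W_def)
      have "ennreal (C3 * c / w x powr (1 + e)) * (\<integral>\<^sup>+y\<in>R. ennreal (w y powr (1 + e)) \<partial>lebesgue)
          \<le> ennreal (C3 * c / w x powr (1 + e)) * ennreal (C4 * W powr (1 + e) * vol R)"
        unfolding W_def using C4(3) R by (intro mult_left_mono) auto
      also have "\<dots> = ennreal (C3 * C4 * c * (W / w x) powr (1 + e) * vol R)"
        using C3(1) C4(1) c wx W by (simp add: ennreal_mult[symmetric] powr_divide mult_ac)
      also have "\<dots> \<le> ennreal (C3 * C4 * c * X powr (1 + e) * vol R)"
        using C3(1) C4(1,2) c wx W by (intro ennreal_leI mult_right_mono mult_left_mono powr_mono2) (auto simp: X_def W_def)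
      also have "C3 * C4 * c * X powr (1 + e) = C3 * C4 / A * (X powr (- (1 + e)) * X powr (1 + e))"
        by (simp add: c_def)
      also have "X powr (- (1 + e)) * X powr (1 + e) = 1"
        using X by (simp add: powr_add[symmetric])
      also have "ennreal (C3 * C4 / A * 1 * vol R) \<le> ennreal (vol R / 2)"
        using mult_right_mono[OF A(2), of "vol R"] by (intro ennreal_leI) simp
      finally show "ennreal (C3 * c / w x powr (1 + e)) * (\<integral>\<^sup>+y\<in>R. ennreal (w y powr (1 + e)) \<partial>lebesgue) \<le> ennreal (vol R / 2)" .
    qed
    finally have "ennreal (vol R) \<le> ennreal (C3 * c powr (- \<kappa>') / w x) * I + ennreal (vol R / 2)"
      using RP by (rule order_trans[rotated])
    moreover have "ennreal (vol R) = ennreal (vol R / 2) + ennreal (vol R / 2)"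
      by (simp add: ennreal_plus[symmetric] del: ennreal_plus)
    ultimately have "ennreal (vol R / 2) + ennreal (vol R / 2) \<le> ennreal (vol R / 2) + ennreal (C3 * c powr (- \<kappa>') / w x) * I"
      by (simp add: add.commute)
    then have half: "ennreal (vol R / 2) \<le> ennreal (C3 * c powr (- \<kappa>') / w x) * I"
      by (simp only: ennreal_add_left_cancel_le) auto
    have "ennreal (w x) = ennreal (2 * w x / vol R) * ennreal (vol R / 2)"
      using wx mR by (simp add: ennreal_mult[symmetric])
    also have "\<dots> \<le> ennreal (2 * w x / vol R) * (ennreal (C3 * c powr (- \<kappa>') / w x) * I)"
      by (intro mult_left_mono half) auto
    also have "\<dots> = ennreal (2 * w x / vol R * (C3 * c powr (- \<kappa>') / w x)) * I"
      using wx mR C3(1) by (subst ennreal_mult) (auto simp: mult.assoc)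
    also have "2 * w x / vol R * (C3 * c powr (- \<kappa>') / w x) = K * X powr \<kappa> / vol R"
      using wx by (simp add: ck K_def)
    finally show ?thesis
      by (simp add: X_def I_def g_def)
  qed
  then show ?thesis
    using K unfolding w_def by blast
qed

section \<open>Assembly of the pointwise and the weak-type estimate\<close>

theorem theorem1:
  fixes r \<delta> :: real and \<Phi> :: "real \<Rightarrow> real" and u v :: "real ^ 'n \<Rightarrow> real"
  assumes "r \<ge> 1" and "\<delta> \<ge> 0" and "\<Phi> \<in> young_class r \<delta>"
    and "u \<in> A_1" and "weight v" and "(\<lambda>x. v x powr r) \<in> A_infinity"
  shows "\<exists>\<epsilon>\<^sub>0>0. \<forall>\<epsilon>. 0 < \<epsilon> \<and> \<epsilon> < \<epsilon>\<^sub>0 \<longrightarrow>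
    (\<exists>C>0. \<forall>t>0. \<forall>f \<in> borel_measurable lebesgue.
      weighted_measure (\<lambda>x. u x * v x powr r)
        {x. maximal \<Phi> (\<lambda>y. f y * v y) x / ennreal (v x) > ennreal t}
      \<le> ennreal C *
        (\<integral>\<^sup>+x. ennreal ((eta \<delta> \<epsilon> \<circ> \<Phi>) (\<bar>f x\<bar> / t) * u x * v x powr r) \<partial>lebesgue))"
proof (rule exI[of _ 1], intro conjI allI impI)
  \<comment> \<open>The witness 1 for the threshold comes from
    \<open>eta_lower_bounds\<close>.\<close>
  fix \<epsilon> :: real assume "0 < \<epsilon> \<and> \<epsilon> < 1"
  then have \<epsilon>: "0 < \<epsilon>" "\<epsilon> \<le> 1" by auto
  define w where "w = (\<lambda>x. v x powr r)"
  have aw: "ample w" unfolding w_def by (rule ample_A_infinity[OF assms(6)])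
  have uw: "weight u" using assms(4) by (simp add: A_1_def)
  have [measurable]: "u \<in> borel_measurable lebesgue" "w \<in> borel_measurable lebesgue"
    using uw ample_weight[OF aw] by (auto intro: weight_measurable)
  have Y: "young_function \<Phi>" using assms(3) by (simp add: young_class_def)
  obtain \<kappa> where \<kappa>: "\<kappa> > 0" and main: "\<forall>K>0. \<exists>C>0. weak_bound u w \<kappa> K C"
    using mixed_weak_bound[OF assms(4) aw] by auto
  obtain K where K: "K > 0" and lux: "luxemburg_dominated \<Phi> \<delta> \<epsilon> v w \<kappa> K"
    using luxemburg_pointwise_bound[OF assms(3,1,2) \<epsilon> assms(5) aw[unfolded w_def] \<kappa>] unfolding w_def by blast
  obtain C where C: "C > 0" and bound: "weak_bound u w \<kappa> K C"
    using main K by blast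
  have "weighted_measure (\<lambda>x. u x * v x powr r) {x. maximal \<Phi> (\<lambda>y. f y * v y) x / ennreal (v x) > ennreal t}
      \<le> ennreal C * (\<integral>\<^sup>+x. ennreal ((eta \<delta> \<epsilon> \<circ> \<Phi>) (\<bar>f x\<bar> / t) * u x * v x powr r) \<partial>lebesgue)"
    if t: "t > 0" and f: "f \<in> borel_measurable lebesgue" for t f
  proof -
    note [measurable] = f
    \<comment> \<open>Division by 0 in \<open>ennreal\<close> can give infinity, so zeros of v may
      belong to the level set; they form a null set and are discarded.\<close>
    define E where "E = {x. 0 < v x \<and> maximal \<Phi> (\<lambda>y. f y * v y) x / ennreal (v x) > ennreal t}"
    define H where "H y = ennreal (eta \<delta> \<epsilon> (\<Phi> (\<bar>f y\<bar> / t)) * w y)" for y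
    have [measurable]: "(\<lambda>y. \<Phi> (\<bar>f y\<bar> / t)) \<in> borel_measurable lebesgue"
      using t by (intro young_measurable[OF Y]) auto
    have H: "H \<in> borel_measurable lebesgue"
      unfolding H_def eta_def log_plus_def by measurable
    have "weighted_measure (\<lambda>x. u x * v x powr r) {x. maximal \<Phi> (\<lambda>y. f y * v y) x / ennreal (v x) > ennreal t}
        \<le> (\<integral>\<^sup>+x\<in>E. ennreal (u x * w x) \<partial>lebesgue)"
      unfolding weighted_measure_def
    proof (rule nn_integral_mono_AE)
      have "AE x in lebesgue. 0 < v x" using assms(5) by (simp add: weight_def)
      then show "AE x in lebesgue. ennreal (u x * v x powr r) * indicator {x. maximal \<Phi> (\<lambda>y. f y * v y) x / ennreal (v x) > ennreal t} x
          \<le> ennreal (u x * w x) * indicator E x"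
        by eventually_elim (auto simp: E_def w_def indicator_def)
    qed
    also have "\<dots> \<le> ennreal C * pairing u H"
    proof (rule bound[rule_format, OF H])
      fix x assume x: "x \<in> E"
      then have vx: "0 < v x" by (simp add: E_def)
      have "\<not> maximal \<Phi> (\<lambda>y. f y * v y) x \<le> ennreal t * ennreal (v x)"
      proof
        assume "maximal \<Phi> (\<lambda>y. f y * v y) x \<le> ennreal t * ennreal (v x)"
        then have "maximal \<Phi> (\<lambda>y. f y * v y) x / ennreal (v x) \<le> ennreal t"
          using vx by (intro divide_le_posI_ennreal) (auto simp: mult.commute)
        moreover have "ennreal t < maximal \<Phi> (\<lambda>y. f y * v y) x / ennreal (v x)"
          using x by (simp add: E_def)
        ultimately show False by (meson leD)
      qed
      then have "ennreal (t * v x) < maximal \<Phi> (\<lambda>y. f y * v y) x"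
        using t vx by (simp add: ennreal_mult not_le)
      then obtain R where R: "R \<in> cubes" "x \<in> R" "ennreal (t * v x) < luxemburg \<Phi> R (\<lambda>y. f y * v y)"
        unfolding maximal_def less_SUP_iff by auto
      have "ennreal (w x) \<le> ennreal (K * max 1 (mass w R / vol R / w x) powr \<kappa> / vol R) * (nnint R H)"
        unfolding H_def by (rule lux[rule_format, OF t f R(1) vx R(3)])
      then show "0 < w x \<and> (\<exists>R\<in>cubes. x \<in> R \<and> ennreal (w x) \<le>
          ennreal (K * max 1 (mass w R / vol R / w x) powr \<kappa> / vol R) * (nnint R H))"
        using R vx by (auto simp: w_def)
    qed
    also have "pairing u H = (\<integral>\<^sup>+x. ennreal ((eta \<delta> \<epsilon> \<circ> \<Phi>) (\<bar>f x\<bar> / t) * u x * v x powr r) \<partial>lebesgue)"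
      unfolding H_def w_def using weight_nonneg[OF uw]
      by (intro nn_integral_cong) (simp add: ennreal_mult'[symmetric] mult_ac)
    finally show ?thesis .
  qed
  then show "\<exists>C>0. \<forall>t>0. \<forall>f \<in> borel_measurable lebesgue.
      weighted_measure (\<lambda>x. u x * v x powr r) {x. maximal \<Phi> (\<lambda>y. f y * v y) x / ennreal (v x) > ennreal t}
      \<le> ennreal C * (\<integral>\<^sup>+x. ennreal ((eta \<delta> \<epsilon> \<circ> \<Phi>) (\<bar>f x\<bar> / t) * u x * v x powr r) \<partial>lebesgue)"
    using C by blast
qed simp

end
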